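(* Let $n\ge0$ be an integer, $G$ a finite group, $x\in X$ where $X$ is a system of representatives of the conjugacy classes of $G$, and let $k_1,k_2,k_3$ be commutative rings together with a short exact sequence of abelian groups $$0\to(k_1,+)\xrightarrow{\iota}(k_2,+)\xrightarrow{\pi}(k_3,+)\to0$$ which admits a symmetric section $s_\pi:k_3\to k_2$ (a set map with $\pi\circ s_\pi=\mathrm{id}$ and $s_\pi(-a)=-s_\pi(a)$ for all $a\in k_3$). Then there exists a connecting homomorphism in symmetric Hochschild cohomology, i.e. a well-defined group homomorphism $$\mathbb B_G^n:\mathrm{HHS}^n(k_3G)\to\mathrm{HHS}^{n+1}(k_1G),\qquad \mathbb B_G^n([\varphi])=[\,r_{\iota_G}\circ\delta^n_{k_2G}(s_{\pi_G}\circ\varphi)\,],$$ making the following square commutative: $$\pi^{n+1,S}_{G,x}\circ\mathbb B_G^n=\beta^{n,S}_{C_G(x)}\circ\pi^{n,S}_{G,x}:\ \mathrm{HHS}^n(k_3G)\to\mathrm{HS}^{n+1}(C_G(x),k_1x).$$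
   Context: Hochschild side. For a commutative ring $k$ and group ring $kG$, $C^n(kG,kG)=\mathrm{Hom}_k((kG)^{\otimes_k n},kG)$ ($C^0=kG$), which is identified by restriction to basis elements with $\mathrm{Maps}(G^{n},kG)$; the differential is $\delta_{kG}^n(\varphi)(g_1\otimes\dots\otimes g_{n+1})=g_1\varphi(g_2\otimes\dots\otimes g_{n+1})+\sum_{j=1}^n(-1)^j\varphi(g_1\otimes\dots\otimes g_jg_{j+1}\otimes\dots\otimes g_{n+1})+(-1)^{n+1}\varphi(g_1\otimes\dots\otimes g_n)g_{n+1}$. $\Sigma_{n+1}$ acts on $C^n(kG,kG)$ through the transpositions $\sigma_i=(i,i+1)$: for $n\ge2$, $(\sigma_1\varphi)(g_1\otimes\dots\otimes g_n)=-g_1\varphi(g_1^{-1}\otimes g_1g_2\otimes\dots\otimes g_n)$; $(\sigma_i\varphi)(g_1\otimes\dots\otimes g_n)=-\varphi(g_1\otimes\dots\otimes g_{i-1}g_i\otimes g_i^{-1}\otimes g_ig_{i+1}\otimes\dots\otimes g_n)$ for $1<i<n$; $(\sigma_n\varphi)(g_1\otimes\dots\otimes g_n)=-\varphi(g_1\otimes\dots\otimes g_{n-1}g_n\otimes g_n^{-1})g_n$; for $n=1$, $(\sigma_1\varphi)(g)=-g\varphi(g^{-1})g$. The invariants $CS^n(kG,kG)=C^n(kG,kG)^{\Sigma_{n+1}}$ form a subcomplex whose cohomology is $\mathrm{HHS}^n(kG)$. Group side (Staic). For a group $H$ and an $H$-module $A$, $C^n(H,A)=\mathrm{Maps}(H^{n},A)$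 with the standard inhomogeneous differential $\partial_A^n(\varphi)(g_1,\dots,g_{n+1})=g_1\varphi(g_2,\dots,g_{n+1})+\sum_{j=1}^n(-1)^j\varphi(g_1,\dots,g_jg_{j+1},\dots,g_{n+1})+(-1)^{n+1}\varphi(g_1,\dots,g_n)$; $\Sigma_{n+1}$ acts by $(\sigma_1\varphi)(g_1,\dots,g_n)=-g_1\varphi(g_1^{-1},g_1g_2,\dots,g_n)$ (for $n=1$: $-g_1\varphi(g_1^{-1})$), $(\sigma_i\varphi)(g_1,\dots,g_n)=-\varphi(g_1,\dots,g_{i-1}g_i,g_i^{-1},g_ig_{i+1},\dots,g_n)$ for $1<i<n$, $(\sigma_n\varphi)(g_1,\dots,g_n)=-\varphi(g_1,\dots,g_{n-1}g_n,g_n^{-1})$ for $n\ge2$. $CS^n(H,A)$ is the subcomplex of invariants and $\mathrm{HS}^n(H,A)$ its cohomology. Induced sequences. $\iota$ and $\pi$ induce coefficientwise a short exact sequence $0\to k_1G\xrightarrow{\iota_G}k_2G\xrightarrow{\pi_G}k_3G\to0$, $\iota_G(a g)=\iota(a)g$, $\pi_G(ag)=\pi(a)g$. Let $r_\iota:\ker\pi\to k_1$ be the inverse of $k_1\to\ker\pi$, $a\mapsto\iota(a)$. Define coefficientwise $r_{\iota_G}:\ker\pi_G\to k_1G$, $r_{\iota_G}(\sum_g a_gg)=\sum_g r_\iota(a_g)g$, and $s_{\pi_G}:k_3G\to k_2G$, $s_{\pi_G}(\sum_ga_gg)=\sum_gs_\pi(a_g)g$. In the formula for $\mathbb B_G^n$,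 $\varphi$ is a cocycle in $CS^n(k_3G,k_3G)$, and compositions with $s_{\pi_G}$ and $r_{\iota_G}$ are taken on basis tuples $g_1\otimes\dots\otimes g_n$ (with $g_i\in G$) and then extended linearly over $k_2$, respectively $k_1$. For $x\in X$, $kx$ is the trivial $C_G(x)$-module, where $C_G(x)$ is the centralizer of $x$ in $G$, and one has the short exact sequence $0\to k_1x\xrightarrow{\iota_x}k_2x\xrightarrow{\pi_x}k_3x\to0$ with $\iota_x(ax)=\iota(a)x$, $\pi_x(ax)=\pi(a)x$, $s_{\pi_x}(ax)=s_\pi(a)x$, $r_{\iota_x}(ax)=r_\iota(a)x$. The homomorphism $\beta^{n,S}_{C_G(x)}:\mathrm{HS}^n(C_G(x),k_3x)\to\mathrm{HS}^{n+1}(C_G(x),k_1x)$ is $[\psi]\mapsto[r_{\iota_x}\circ\partial^n_{k_2x}(s_{\pi_x}\circ\psi)]$. For a commutative ring $k$, $\pi^{n,S}_{G,x}:\mathrm{HHS}^n(kG)\to\mathrm{HS}^n(C_G(x),kx)$ is induced by $\pi^n_{G,x}:C^n(kG,kG)\to C^n(C_G(x),kx)$, $\pi^n_{G,x}(\varphi)(h_1,\dots,h_n)=a\,x$ where $a$ is the coefficient of $x$ in $\varphi(h_1\otimes\dots\otimes h_n)h_n^{-1}\cdots h_1^{-1}$. *)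

theory Defs
  imports "HOL-Algebra.Algebra"
begin

section \<open>Free modules and group rings\<close>

text \<open>The free module on a set \<open>S\<close>: finitely supported functions \<open>S \<rightarrow> k\<close>, the element
  \<open>\<Sum>s. a\<^sub>s s\<close> being the function \<open>s \<mapsto> a\<^sub>s\<close>. The multiplicative fields of the record are
  irrelevant, as usual for modules in HOL-Algebra.\<close>

definition free_module :: "('k, 'm) ring_scheme \<Rightarrow> 's set \<Rightarrow> ('k, 's \<Rightarrow> 'k) module" where
  "free_module k S =
    \<lparr>carrier = {a \<in> S \<rightarrow>\<^sub>E carrier k. finite {s \<in> S. a s \<noteq> \<zero>\<^bsub>k\<^esub>}},
     monoid.mult = undefined, one = undefined,
     ring.zero = (\<lambda>s\<in>S. \<zero>\<^bsub>k\<^esub>), ring.add = (\<lambda>a b. \<lambda>s\<in>S. a s \<oplus>\<^bsub>k\<^esub> b s),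
     module.smult = (\<lambda>c a. \<lambda>s\<in>S. c \<otimes>\<^bsub>k\<^esub> a s)\<rparr>"

definition group_elem ::
  "('k, 'm) ring_scheme \<Rightarrow> ('g, 'n) monoid_scheme \<Rightarrow> 'g \<Rightarrow> 'g \<Rightarrow> 'k" where
  "group_elem k G g = (\<lambda>h\<in>carrier G. if h = g then \<one>\<^bsub>k\<^esub> else \<zero>\<^bsub>k\<^esub>)"

definition group_ring ::
  "('k, 'm) ring_scheme \<Rightarrow> ('g, 'n) monoid_scheme \<Rightarrow> ('k, 'g \<Rightarrow> 'k) module" where
  "group_ring k G = (free_module k (carrier G))
    \<lparr>monoid.mult := (\<lambda>a b. \<lambda>g\<in>carrier G.
        \<Oplus>\<^bsub>k\<^esub>h\<in>{h \<in> carrier G. a h \<noteq> \<zero>\<^bsub>k\<^esub>}. a h \<otimes>\<^bsub>k\<^esub> b (inv\<^bsub>G\<^esub> h \<otimes>\<^bsub>G\<^esub> g)),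
     one := group_elem k G \<one>\<^bsub>G\<^esub>\<rparr>"

text \<open>The coefficientwise extension of a set map \<open>f\<close>. With \<open>S = carrier G\<close> it gives
  \<open>\<iota>\<^sub>G\<close>, \<open>\<pi>\<^sub>G\<close>, \<open>s\<^sub>\<pi>\<^sub>G\<close>, \<open>r\<^sub>\<iota>\<^sub>G\<close>; with \<open>S = {x}\<close> it gives \<open>\<iota>\<^sub>x\<close>, \<open>\<pi>\<^sub>x\<close>,
  \<open>s\<^sub>\<pi>\<^sub>x\<close>, \<open>r\<^sub>\<iota>\<^sub>x\<close>.\<close>

definition coeffwise :: "'s set \<Rightarrow> ('a \<Rightarrow> 'b) \<Rightarrow> ('s \<Rightarrow> 'a) \<Rightarrow> 's \<Rightarrow> 'b" where
  "coeffwise S f a = (\<lambda>s\<in>S. f (a s))"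


section \<open>Symmetric cochain complexes\<close>

text \<open>The Hochschild complex of \<open>kG\<close> and the group cohomology complex of an \<open>H\<close>-module are both
  instances of one construction: \<open>H\<close> is a group acting on the additive group of \<open>A\<close> by
  \<open>l g a = g a\<close> on the left and by \<open>r g a = a g\<close> on the right (for an \<open>H\<close>-module the right
  action is trivial). An \<open>n\<close>-cochain is a map \<open>H\<^sup>n \<rightarrow> A\<close>, and \<open>H\<^sup>n\<close> consists of the lists of
  length \<open>n\<close>; in particular \<open>H\<^sup>0 = {[]}\<close> and \<open>C\<^sup>0\<close> is \<open>A\<close>.\<close>

definition tuples :: "('g, 'n) monoid_scheme \<Rightarrow> nat \<Rightarrow> 'g list set" where
  "tuples H n = {gs. length gs = n \<and> set gs \<subseteq> carrier H}"

definition cochains ::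
  "('g, 'n) monoid_scheme \<Rightarrow> ('a, 'm) ring_scheme \<Rightarrow> nat \<Rightarrow> ('g list \<Rightarrow> 'a) monoid" where
  "cochains H A n =
    \<lparr>carrier = tuples H n \<rightarrow>\<^sub>E carrier A,
     monoid.mult = (\<lambda>\<phi> \<psi>. \<lambda>gs\<in>tuples H n. \<phi> gs \<oplus>\<^bsub>A\<^esub> \<psi> gs),
     one = (\<lambda>gs\<in>tuples H n. \<zero>\<^bsub>A\<^esub>)\<rparr>"

text \<open>\<open>(g\<^sub>1,\<dots>,g\<^sub>n\<^sub>+\<^sub>1) \<mapsto> (g\<^sub>1,\<dots>,g\<^sub>jg\<^sub>j\<^sub>+\<^sub>1,\<dots>,g\<^sub>n\<^sub>+\<^sub>1)\<close>, where \<open>g\<^sub>j\<close> is \<open>gs ! (j - 1)\<close>.\<close>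

definition merge :: "('g, 'n) monoid_scheme \<Rightarrow> nat \<Rightarrow> 'g list \<Rightarrow> 'g list" where
  "merge H j gs = take (j - 1) gs @ [gs ! (j - 1) \<otimes>\<^bsub>H\<^esub> gs ! j] @ drop (j + 1) gs"

definition coboundary ::
  "('g, 'n) monoid_scheme \<Rightarrow> ('a, 'm) ring_scheme \<Rightarrow> ('g \<Rightarrow> 'a \<Rightarrow> 'a) \<Rightarrow> ('g \<Rightarrow> 'a \<Rightarrow> 'a)
    \<Rightarrow> nat \<Rightarrow> ('g list \<Rightarrow> 'a) \<Rightarrow> 'g list \<Rightarrow> 'a" where
  "coboundary H A l r n \<phi> = (\<lambda>gs\<in>tuples H (Suc n).
     l (hd gs) (\<phi> (tl gs))
     \<oplus>\<^bsub>A\<^esub> (\<Oplus>\<^bsub>A\<^esub>j\<in>{1..n}. add_pow A ((- 1 :: int) ^ j) (\<phi> (merge H j gs)))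
     \<oplus>\<^bsub>A\<^esub> add_pow A ((- 1 :: int) ^ (n + 1)) (r (last gs) (\<phi> (butlast gs))))"

text \<open>\<open>(g\<^sub>1,\<dots>,g\<^sub>n) \<mapsto> (g\<^sub>1,\<dots>,g\<^sub>i\<^sub>-\<^sub>1g\<^sub>i, g\<^sub>i\<^sup>-\<^sup>1, g\<^sub>ig\<^sub>i\<^sub>+\<^sub>1,\<dots>,g\<^sub>n)\<close>; the neighbours of position \<open>i\<close>
  are changed only if they exist.\<close>

definition twist :: "('g, 'n) monoid_scheme \<Rightarrow> nat \<Rightarrow> 'g list \<Rightarrow> 'g list" where
  "twist H i gs = (let g = (\<lambda>p. gs ! (p - 1)) in
     map (\<lambda>p. if p + 1 = i then g p \<otimes>\<^bsub>H\<^esub> g i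
              else if p = i then inv\<^bsub>H\<^esub> (g i)
              else if p = i + 1 then g i \<otimes>\<^bsub>H\<^esub> g p
              else g p) [1..<length gs + 1])"

text \<open>The action of the transposition \<open>\<sigma>\<^sub>i = (i, i + 1)\<close>, \<open>1 \<le> i \<le> n\<close>. For \<open>n = i = 1\<close> both
  outer factors occur.\<close>

definition transp_act ::
  "('g, 'n) monoid_scheme \<Rightarrow> ('a, 'm) ring_scheme \<Rightarrow> ('g \<Rightarrow> 'a \<Rightarrow> 'a) \<Rightarrow> ('g \<Rightarrow> 'a \<Rightarrow> 'a)
    \<Rightarrow> nat \<Rightarrow> nat \<Rightarrow> ('g list \<Rightarrow> 'a) \<Rightarrow> 'g list \<Rightarrow> 'a" where
  "transp_act H A l r n i \<phi> = (\<lambda>gs\<in>tuples H n.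
     let a = \<phi> (twist H i gs);
         b = (if i = 1 then l (hd gs) a else a);
         c = (if i = n then r (last gs) b else b)
     in \<ominus>\<^bsub>A\<^esub> c)"

text \<open>Invariance under \<open>\<Sigma>\<^sub>n\<^sub>+\<^sub>1\<close> is invariance under its generators \<open>\<sigma>\<^sub>1,\<dots>,\<sigma>\<^sub>n\<close>, through which
  the action is given.\<close>

definition sym_cochains ::
  "('g, 'n) monoid_scheme \<Rightarrow> ('a, 'm) ring_scheme \<Rightarrow> ('g \<Rightarrow> 'a \<Rightarrow> 'a) \<Rightarrow> ('g \<Rightarrow> 'a \<Rightarrow> 'a)
    \<Rightarrow> nat \<Rightarrow> ('g list \<Rightarrow> 'a) set" where
  "sym_cochains H A l r n =
    {\<phi> \<in> carrier (cochains H A n). \<forall>i\<in>{1..n}. transp_act H A l r n i \<phi> = \<phi>}"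

definition sym_cocycles ::
  "('g, 'n) monoid_scheme \<Rightarrow> ('a, 'm) ring_scheme \<Rightarrow> ('g \<Rightarrow> 'a \<Rightarrow> 'a) \<Rightarrow> ('g \<Rightarrow> 'a \<Rightarrow> 'a)
    \<Rightarrow> nat \<Rightarrow> ('g list \<Rightarrow> 'a) set" where
  "sym_cocycles H A l r n =
    {\<phi> \<in> sym_cochains H A l r n. coboundary H A l r n \<phi> = \<one>\<^bsub>cochains H A (Suc n)\<^esub>}"

definition sym_coboundaries ::
  "('g, 'n) monoid_scheme \<Rightarrow> ('a, 'm) ring_scheme \<Rightarrow> ('g \<Rightarrow> 'a \<Rightarrow> 'a) \<Rightarrow> ('g \<Rightarrow> 'a \<Rightarrow> 'a)
    \<Rightarrow> nat \<Rightarrow> ('g list \<Rightarrow> 'a) set" where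
  "sym_coboundaries H A l r n =
    (case n of 0 \<Rightarrow> {\<one>\<^bsub>cochains H A 0\<^esub>}
     | Suc m \<Rightarrow> coboundary H A l r m ` sym_cochains H A l r m)"

definition sym_cohomology ::
  "('g, 'n) monoid_scheme \<Rightarrow> ('a, 'm) ring_scheme \<Rightarrow> ('g \<Rightarrow> 'a \<Rightarrow> 'a) \<Rightarrow> ('g \<Rightarrow> 'a \<Rightarrow> 'a)
    \<Rightarrow> nat \<Rightarrow> ('g list \<Rightarrow> 'a) set monoid" where
  "sym_cohomology H A l r n =
    (cochains H A n)\<lparr>carrier := sym_cocycles H A l r n\<rparr> Mod sym_coboundaries H A l r n"

definition sym_class ::
  "('g, 'n) monoid_scheme \<Rightarrow> ('a, 'm) ring_scheme \<Rightarrow> ('g \<Rightarrow> 'a \<Rightarrow> 'a) \<Rightarrow> ('g \<Rightarrow> 'a \<Rightarrow> 'a)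
    \<Rightarrow> nat \<Rightarrow> ('g list \<Rightarrow> 'a) \<Rightarrow> ('g list \<Rightarrow> 'a) set" where
  "sym_class H A l r n \<phi> = sym_coboundaries H A l r n #>\<^bsub>cochains H A n\<^esub> \<phi>"


section \<open>Symmetric Hochschild cohomology of a group ring\<close>

definition lmul ::
  "('k, 'm) ring_scheme \<Rightarrow> ('g, 'n) monoid_scheme \<Rightarrow> 'g \<Rightarrow> ('g \<Rightarrow> 'k) \<Rightarrow> 'g \<Rightarrow> 'k" where
  "lmul k G g a = group_elem k G g \<otimes>\<^bsub>group_ring k G\<^esub> a"

definition rmul ::
  "('k, 'm) ring_scheme \<Rightarrow> ('g, 'n) monoid_scheme \<Rightarrow> 'g \<Rightarrow> ('g \<Rightarrow> 'k) \<Rightarrow> 'g \<Rightarrow> 'k" where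
  "rmul k G g a = a \<otimes>\<^bsub>group_ring k G\<^esub> group_elem k G g"

abbreviation hochschild_d where
  "hochschild_d k G \<equiv> coboundary G (group_ring k G) (lmul k G) (rmul k G)"

abbreviation HHS_cocycles where
  "HHS_cocycles k G \<equiv> sym_cocycles G (group_ring k G) (lmul k G) (rmul k G)"

abbreviation HHS where
  "HHS k G \<equiv> sym_cohomology G (group_ring k G) (lmul k G) (rmul k G)"

abbreviation HHS_class where
  "HHS_class k G \<equiv> sym_class G (group_ring k G) (lmul k G) (rmul k G)"


section \<open>Symmetric group cohomology\<close>

abbreviation group_d where
  "group_d H A act \<equiv> coboundary H A act (\<lambda>_ a. a)"

abbreviation HS where
  "HS H A act \<equiv> sym_cohomology H A act (\<lambda>_ a. a)"

abbreviation HS_class where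
  "HS_class H A act \<equiv> sym_class H A act (\<lambda>_ a. a)"

abbreviation trivial_act :: "'h \<Rightarrow> 'a \<Rightarrow> 'a" where
  "trivial_act \<equiv> (\<lambda>_ a. a)"


section \<open>Conjugacy classes and centralizers\<close>

definition conj_class_reps :: "('g, 'n) monoid_scheme \<Rightarrow> 'g set \<Rightarrow> bool" where
  "conj_class_reps G T = (T \<subseteq> carrier G \<and>
    (\<forall>C\<in>orbits G (carrier G) (\<lambda>g. \<lambda>h\<in>carrier G. g \<otimes>\<^bsub>G\<^esub> h \<otimes>\<^bsub>G\<^esub> (inv\<^bsub>G\<^esub> g)).
      \<exists>!x. x \<in> T \<inter> C))"

definition centralizer :: "('g, 'n) monoid_scheme \<Rightarrow> 'g \<Rightarrow> ('g, 'n) monoid_scheme" where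
  "centralizer G x = G\<lparr>carrier := {g \<in> carrier G. g \<otimes>\<^bsub>G\<^esub> x = x \<otimes>\<^bsub>G\<^esub> g}\<rparr>"


section \<open>The maps of the square\<close>

text \<open>The cochains \<open>r\<^sub>\<iota>\<^sub>G \<circ> \<delta>(s\<^sub>\<pi>\<^sub>G \<circ> \<phi>)\<close> and \<open>r\<^sub>\<iota>\<^sub>x \<circ> \<partial>(s\<^sub>\<pi>\<^sub>x \<circ> \<psi>)\<close>. The map \<open>r\<^sub>\<iota>\<close> is
  \<open>inv_into (carrier k1) \<iota>\<close>, which is meaningful on the image of \<open>\<iota>\<close>, that is, on the kernel
  of \<open>\<pi>\<close>.\<close>

definition lift_coboundary ::
  "('k2, 'm) ring_scheme \<Rightarrow> ('g, 'n) monoid_scheme \<Rightarrow> ('k3 \<Rightarrow> 'k2) \<Rightarrow> nat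
    \<Rightarrow> ('g list \<Rightarrow> 'g \<Rightarrow> 'k3) \<Rightarrow> 'g list \<Rightarrow> 'g \<Rightarrow> 'k2" where
  "lift_coboundary k2 G s n \<phi> =
    hochschild_d k2 G n (compose (tuples G n) (coeffwise (carrier G) s) \<phi>)"

definition hochschild_connecting ::
  "('k1, 'l) ring_scheme \<Rightarrow> ('k2, 'm) ring_scheme \<Rightarrow> ('g, 'n) monoid_scheme \<Rightarrow> ('k1 \<Rightarrow> 'k2)
    \<Rightarrow> ('k3 \<Rightarrow> 'k2) \<Rightarrow> nat \<Rightarrow> ('g list \<Rightarrow> 'g \<Rightarrow> 'k3) \<Rightarrow> 'g list \<Rightarrow> 'g \<Rightarrow> 'k1" where
  "hochschild_connecting k1 k2 G \<iota> s n \<phi> =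
    compose (tuples G (Suc n)) (coeffwise (carrier G) (inv_into (carrier k1) \<iota>))
      (lift_coboundary k2 G s n \<phi>)"

definition group_connecting ::
  "('k1, 'l) ring_scheme \<Rightarrow> ('k2, 'm) ring_scheme \<Rightarrow> ('h, 'n) monoid_scheme \<Rightarrow> 'h \<Rightarrow> ('k1 \<Rightarrow> 'k2)
    \<Rightarrow> ('k3 \<Rightarrow> 'k2) \<Rightarrow> nat \<Rightarrow> ('h list \<Rightarrow> 'h \<Rightarrow> 'k3) \<Rightarrow> 'h list \<Rightarrow> 'h \<Rightarrow> 'k1" where
  "group_connecting k1 k2 H x \<iota> s n \<psi> =
    compose (tuples H (Suc n)) (coeffwise {x} (inv_into (carrier k1) \<iota>))
      (group_d H (free_module k2 {x}) trivial_act n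
        (compose (tuples H n) (coeffwise {x} s) \<psi>))"

text \<open>\<open>\<pi>\<^sup>n\<^sub>G\<^sub>,\<^sub>x\<close> on cochains: \<open>foldr\<close> multiplies \<open>\<phi>(h\<^sub>1,\<dots>,h\<^sub>n)\<close> on the right first by
  \<open>h\<^sub>n\<^sup>-\<^sup>1\<close> and last by \<open>h\<^sub>1\<^sup>-\<^sup>1\<close>.\<close>

definition proj_cochain ::
  "('k, 'm) ring_scheme \<Rightarrow> ('g, 'n) monoid_scheme \<Rightarrow> 'g \<Rightarrow> nat
    \<Rightarrow> ('g list \<Rightarrow> 'g \<Rightarrow> 'k) \<Rightarrow> 'g list \<Rightarrow> 'g \<Rightarrow> 'k" where
  "proj_cochain k G x n \<phi> = (\<lambda>hs\<in>tuples (centralizer G x) n.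
     restrict (foldr (\<lambda>h a. rmul k G (inv\<^bsub>G\<^esub> h) a) hs (\<phi> hs)) {x})"

text \<open>The maps induced on cohomology, by taking the union of the classes of the images of all
  representatives; it is a single class precisely when the map is well defined.\<close>

definition HHS_proj ::
  "('k, 'm) ring_scheme \<Rightarrow> ('g, 'n) monoid_scheme \<Rightarrow> 'g \<Rightarrow> nat
    \<Rightarrow> ('g list \<Rightarrow> 'g \<Rightarrow> 'k) set \<Rightarrow> ('g list \<Rightarrow> 'g \<Rightarrow> 'k) set" where
  "HHS_proj k G x n c =
    (\<Union>\<phi>\<in>c. HS_class (centralizer G x) (free_module k {x}) trivial_act n (proj_cochain k G x n \<phi>))"

definition HS_connecting ::
  "('k1, 'l) ring_scheme \<Rightarrow> ('k2, 'm) ring_scheme \<Rightarrow> ('h, 'n) monoid_scheme \<Rightarrow> 'h \<Rightarrow> ('k1 \<Rightarrow> 'k2)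
    \<Rightarrow> ('k3 \<Rightarrow> 'k2) \<Rightarrow> nat \<Rightarrow> ('h list \<Rightarrow> 'h \<Rightarrow> 'k3) set \<Rightarrow> ('h list \<Rightarrow> 'h \<Rightarrow> 'k1) set" where
  "HS_connecting k1 k2 H x \<iota> s n c =
    (\<Union>\<psi>\<in>c. HS_class H (free_module k1 {x}) trivial_act (Suc n)
              (group_connecting k1 k2 H x \<iota> s n \<psi>))"

end

theory Submission
  imports Defs
begin

text \<open>
  Both complexes of the theorem are cochain complexes of a group \<open>H\<close> with values in an
  \<open>H\<close>-bimodule \<open>A\<close>. In homogeneous form, a cochain \<open>\<phi>\<close> becomes
  \<open>F(x\<^sub>0,\<dots>,x\<^sub>n) = x\<^sub>0 \<phi>(x\<^sub>0\<^sup>-\<^sup>1x\<^sub>1,\<dots>,x\<^sub>n\<^sub>-\<^sub>1\<^sup>-\<^sup>1x\<^sub>n) x\<^sub>n\<^sup>-\<^sup>1\<close>. The differential is then the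
  alternating sum of the faces of \<open>F\<close> (\<open>homogenize_coboundary\<close>), and the transposition
  \<open>\<sigma>\<^sub>i\<close> exchanges \<open>x\<^sub>i\<^sub>-\<^sub>1\<close> and \<open>x\<^sub>i\<close> with a sign (\<open>homogenize_transp_act\<close>), so that the
  invariant cochains are exactly those with alternating \<open>F\<close> (\<open>sym_cochains_iff\<close>). In this form
  it is plain that the invariants are a subcomplex, and a map of cochains that is given on homogeneous
  forms by applying a map of coefficients value by value commutes with everything that this map
  respects: an odd map of coefficients preserves invariant cochains, an additive one moreover gives
  a map of complexes.

  For an extension \<open>0 \<rightarrow> A\<^sub>1 \<rightarrow> A\<^sub>2 \<rightarrow> A\<^sub>3 \<rightarrow> 0\<close> of bimodules whose set-theoretic section \<open>s\<close>
  is equivariant and odd, \<open>s\<close> carries invariant cochains to invariant cochains, which is the one place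
  where the snake lemma for the invariant subcomplexes could fail; the usual diagram chase
  then gives the connecting homomorphism. Since \<open>s\<close> is not additive, the formula is a homomorphism
  only up to coboundaries, and the lemma \<open>coboundary_lifts_cohomologous\<close> supplies the coboundary.
  Coefficientwise maps of group rings are equivariant because the group only permutes the
  coefficients, so \<open>\<iota>\<close>, \<open>\<pi>\<close> and \<open>s\<close> induce such an extension of group rings, and likewise of
  the trivial modules \<open>k\<^sub>i x\<close>.

  In homogeneous form, the projection to the centralizer of \<open>x\<close> only restricts \<open>F\<close> to tuples of the
  centralizer and takes the coefficient of \<open>x\<close> (\<open>projection_cochain_map\<close>). It is therefore a map of
  complexes preserving invariants. It also commutes with coefficientwise maps
  (\<open>projection_coeffwise\<close>), so the square commutes already for the cocycles in the two
  explicit formulas.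
\<close>

lemma tuples_0 [simp]: "tuples H 0 = {[]}"
  by (auto simp: tuples_def)

lemma Cons_in_tuples [simp]: "x # xs \<in> tuples H (Suc n) \<longleftrightarrow> x \<in> carrier H \<and> xs \<in> tuples H n"
  by (auto simp: tuples_def)

lemma butlast_closed: "xs \<in> tuples H (Suc n) \<Longrightarrow> butlast xs \<in> tuples H n"
  by (auto simp: tuples_def dest: in_set_butlastD)

lemma tuples_SucE:
  assumes "xs \<in> tuples H (Suc n)"
  obtains y ys where "xs = y # ys" "y \<in> carrier H" "ys \<in> tuples H n"
  using assms by (cases xs) (auto simp: tuples_def)

section \<open>Alternating sums of faces\<close>

text \<open>The sum of \<open>(-1)\<^sup>j F(x\<^sub>0,\<dots>,x\<^sub>j omitted,\<dots>,x\<^sub>n)\<close> over all \<open>j\<close>, split into the face that omits the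
  first entry and the faces that keep it. The recursion lets identities of simplicial type be
  proved by induction on the list, without double sums.\<close>

fun alt_diff :: "('a, 'm) ring_scheme \<Rightarrow> ('g list \<Rightarrow> 'a) \<Rightarrow> 'g list \<Rightarrow> 'a" where
  "alt_diff A F [] = \<zero>\<^bsub>A\<^esub>"
| "alt_diff A F (x # xs) = F xs \<ominus>\<^bsub>A\<^esub> alt_diff A (\<lambda>ys. F (x # ys)) xs"

definition alternating ::
  "('g, 'n) monoid_scheme \<Rightarrow> ('a, 'm) ring_scheme \<Rightarrow> nat \<Rightarrow> ('g list \<Rightarrow> 'a) \<Rightarrow> bool" where
  "alternating H A n F \<longleftrightarrow>
    (\<forall>us a b vs. us @ a # b # vs \<in> tuples H n \<longrightarrow>
       F (us @ b # a # vs) = \<ominus>\<^bsub>A\<^esub> F (us @ a # b # vs))"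

lemma prefix_Pi_tuples:
  "F \<in> tuples H (Suc n) \<rightarrow> B \<Longrightarrow> x \<in> carrier H \<Longrightarrow> (\<lambda>ys. F (x # ys)) \<in> tuples H n \<rightarrow> B"
  by auto

context abelian_group
begin

lemma neg_zero: "\<ominus> \<zero> = \<zero>"
  by (rule minus_equality) simp_all

lemmas additive_simps = neg_zero minus_eq a_ac minus_add r_neg l_neg r_neg1 r_neg2

lemma alt_diff_closed:
  "F \<in> tuples H n \<rightarrow> carrier G \<Longrightarrow> xs \<in> tuples H (Suc n) \<Longrightarrow> alt_diff G F xs \<in> carrier G"
proof (induction n arbitrary: F xs)
  case 0
  then show ?case by (auto elim!: tuples_SucE simp: Pi_def)
next
  case (Suc n)
  from Suc.prems obtain x ys where xs: "xs = x # ys" "x \<in> carrier H" "ys \<in> tuples H (Suc n)"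
    by (blast elim: tuples_SucE)
  with Suc.prems Suc.IH[OF prefix_Pi_tuples[OF Suc.prems(1) xs(2)] xs(3)] show ?case
    by (auto simp: Pi_def)
qed

lemma alt_diff_cong:
  "(\<And>ys. ys \<in> tuples H n \<Longrightarrow> F ys = F' ys) \<Longrightarrow> xs \<in> tuples H (Suc n)
    \<Longrightarrow> alt_diff G F xs = alt_diff G F' xs"
proof (induction n arbitrary: F F' xs)
  case 0
  then show ?case by (auto elim!: tuples_SucE)
next
  case (Suc n)
  from Suc.prems obtain x ys where xs: "xs = x # ys" "x \<in> carrier H" "ys \<in> tuples H (Suc n)"
    by (blast elim: tuples_SucE)
  have "alt_diff G (\<lambda>zs. F (x # zs)) ys = alt_diff G (\<lambda>zs. F' (x # zs)) ys"
    using Suc.prems(1) xs by (intro Suc.IH) auto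
  with xs Suc.prems(1) show ?case by simp
qed

lemma alt_diff_add:
  "F \<in> tuples H n \<rightarrow> carrier G \<Longrightarrow> F' \<in> tuples H n \<rightarrow> carrier G \<Longrightarrow> xs \<in> tuples H (Suc n)
    \<Longrightarrow> alt_diff G (\<lambda>ys. F ys \<oplus> F' ys) xs = alt_diff G F xs \<oplus> alt_diff G F' xs"
proof (induction n arbitrary: F F' xs)
  case 0
  then show ?case by (auto elim!: tuples_SucE simp: Pi_def additive_simps)
next
  case (Suc n)
  from Suc.prems obtain x ys where xs: "xs = x # ys" "x \<in> carrier H" "ys \<in> tuples H (Suc n)"
    by (blast elim: tuples_SucE)
  note pre = prefix_Pi_tuples[OF Suc.prems(1) xs(2)] prefix_Pi_tuples[OF Suc.prems(2) xs(2)]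
  have "F ys \<in> carrier G" "F' ys \<in> carrier G" using Suc.prems xs by auto
  with xs Suc.IH[OF pre xs(3)] alt_diff_closed[OF pre(1) xs(3)] alt_diff_closed[OF pre(2) xs(3)]
  show ?case by (simp add: additive_simps)
qed

lemma alt_diff_minus:
  assumes F: "F \<in> tuples H n \<rightarrow> carrier G" and xs: "xs \<in> tuples H (Suc n)"
  shows "alt_diff G (\<lambda>ys. \<ominus> F ys) xs = \<ominus> alt_diff G F xs"
proof -
  have F': "(\<lambda>ys. \<ominus> F ys) \<in> tuples H n \<rightarrow> carrier G" using F by auto
  have z: "alt_diff G (\<lambda>_. \<zero>) xs = \<zero>" for xs :: "'c list"
    by (induction xs) (simp_all add: additive_simps)
  have "alt_diff G (\<lambda>ys. \<ominus> F ys) xs \<oplus> alt_diff G F xs = alt_diff G (\<lambda>ys. \<ominus> F ys \<oplus> F ys) xs"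
    by (rule alt_diff_add[OF F' F xs, symmetric])
  also have "\<dots> = alt_diff G (\<lambda>_. \<zero>) xs"
    using F by (intro alt_diff_cong[OF _ xs]) (auto simp: Pi_def l_neg)
  finally show ?thesis
    using alt_diff_closed[OF F xs] alt_diff_closed[OF F' xs] z minus_equality by metis
qed

lemma alt_diff_diff:
  assumes F: "F \<in> tuples H n \<rightarrow> carrier G" "F' \<in> tuples H n \<rightarrow> carrier G"
    and xs: "xs \<in> tuples H (Suc n)"
  shows "alt_diff G (\<lambda>ys. F ys \<ominus> F' ys) xs = alt_diff G F xs \<ominus> alt_diff G F' xs"
  unfolding minus_eq
  using alt_diff_add[of F H n "\<lambda>ys. \<ominus> F' ys" xs] alt_diff_minus[OF F(2) xs] F xs by (auto simp: Pi_def)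

text \<open>With \<open>F\<^sub>x = F (x # _)\<close>, the recursion gives \<open>d (d F) (x # xs) = d F xs - d (F - d F\<^sub>x) xs\<close>.
  The two copies of \<open>d F xs\<close> cancel and \<open>d (d F\<^sub>x) xs\<close> remains.\<close>

lemma alt_diff_square:
  "F \<in> tuples H n \<rightarrow> carrier G \<Longrightarrow> xs \<in> tuples H (Suc (Suc n))
    \<Longrightarrow> alt_diff G (alt_diff G F) xs = \<zero>"
proof (induction n arbitrary: F xs)
  case 0
  then show ?case by (auto elim!: tuples_SucE simp: Pi_def additive_simps)
next
  case (Suc n)
  from Suc.prems obtain x ys where xs: "xs = x # ys" "x \<in> carrier H" "ys \<in> tuples H (Suc (Suc n))"
    by (blast elim: tuples_SucE)
  note pre = prefix_Pi_tuples[OF Suc.prems(1) xs(2)]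
  have d: "alt_diff G (\<lambda>zs. F (x # zs)) \<in> tuples H (Suc n) \<rightarrow> carrier G"
    using alt_diff_closed[OF pre] by auto
  have "alt_diff G (\<lambda>zs. alt_diff G F (x # zs)) ys
    = alt_diff G F ys \<ominus> alt_diff G (alt_diff G (\<lambda>zs. F (x # zs))) ys"
    using alt_diff_diff[OF Suc.prems(1) d xs(3)] by simp
  also have "\<dots> = alt_diff G F ys"
    using Suc.IH[OF pre xs(3)] alt_diff_closed[OF Suc.prems(1) xs(3)] by (simp add: additive_simps)
  finally show ?case
    using xs alt_diff_closed[OF Suc.prems(1) xs(3)] by (simp add: additive_simps)
qed

lemma alternating_prefix:
  "alternating H G (Suc n) F \<Longrightarrow> x \<in> carrier H \<Longrightarrow> alternating H G n (\<lambda>ys. F (x # ys))"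
  unfolding alternating_def by (metis Cons_in_tuples append_Cons)

text \<open>Let two neighbours be exchanged. Peeling off the entries before them by the recursion leaves
  the case where they come first: the two faces that omit one of them are interchanged,
  and they carry opposite signs; the remaining faces contain both.\<close>

lemma alternating_alt_diff:
  assumes "F \<in> tuples H n \<rightarrow> carrier G" "alternating H G n F"
  shows "alternating H G (Suc n) (alt_diff G F)"
proof -
  have "alt_diff G F (us @ b # a # vs) = \<ominus> alt_diff G F (us @ a # b # vs)"
    if "us @ a # b # vs \<in> tuples H (Suc n)" "F \<in> tuples H n \<rightarrow> carrier G" "alternating H G n F"
    for us a b vs F and n :: nat
    using that
  proof (induction us arbitrary: F n)
    case Nil
    then obtain m where n: "n = Suc m"
      by (cases n) (auto simp: tuples_def)
    have ab: "a \<in> carrier H" "b \<in> carrier H" "vs \<in> tuples H m" using Nil n by auto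
    have F: "F (a # vs) \<in> carrier G" "F (b # vs) \<in> carrier G" using Nil n ab by auto
    let ?D = "\<lambda>a b. alt_diff G (\<lambda>ys. F (a # b # ys)) vs"
    have "?D b a = \<ominus> ?D a b \<and> ?D a b \<in> carrier G"
    proof (cases m)
      case 0
      then show ?thesis using ab by (simp add: additive_simps)
    next
      case (Suc l)
      have Fab: "(\<lambda>ys. F (a # b # ys)) \<in> tuples H l \<rightarrow> carrier G"
        using Nil.prems(2) n ab Suc by auto
      have "?D b a = alt_diff G (\<lambda>ys. \<ominus> F (a # b # ys)) vs"
      proof (rule alt_diff_cong)
        fix ys assume "ys \<in> tuples H l"
        then have "[] @ a # b # ys \<in> tuples H n" using n ab Suc by simp
        then have "F ([] @ b # a # ys) = \<ominus> F ([] @ a # b # ys)"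
          using Nil.prems(3) unfolding alternating_def by blast
        then show "F (b # a # ys) = \<ominus> F (a # b # ys)" by simp
      qed (use ab Suc in simp)
      with alt_diff_minus[OF Fab] alt_diff_closed[OF Fab] ab Suc show ?thesis by simp
    qed
    with F show ?case by (simp add: additive_simps)
  next
    case (Cons x us)
    then obtain m where n: "n = Suc m"
      by (cases n) (auto simp: tuples_def)
    have x: "x \<in> carrier H" "us @ a # b # vs \<in> tuples H n" using Cons by auto
    have pre: "(\<lambda>ys. F (x # ys)) \<in> tuples H m \<rightarrow> carrier G" using Cons x n by auto
    have "F (us @ b # a # vs) = \<ominus> F (us @ a # b # vs)"
      using Cons.prems(3) x(2) unfolding alternating_def by blast
    moreover have "F (us @ a # b # vs) \<in> carrier G" using x Cons by auto
    moreover have "alt_diff G (\<lambda>ys. F (x # ys)) (us @ b # a # vs)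
        = \<ominus> alt_diff G (\<lambda>ys. F (x # ys)) (us @ a # b # vs)"
      using Cons.IH[OF _ pre] alternating_prefix[of H m F x] Cons.prems(3) x n by simp
    moreover have "alt_diff G (\<lambda>ys. F (x # ys)) (us @ a # b # vs) \<in> carrier G"
      using alt_diff_closed[OF pre] x n by simp
    ultimately show ?case by (simp add: additive_simps)
  qed
  then show ?thesis using assms unfolding alternating_def by blast
qed

lemma alt_diff_hom:
  assumes K: "carrier K \<subseteq> carrier H" and B: "abelian_group B"
    and u: "u \<in> hom (add_monoid G) (add_monoid B)"
    and F: "F \<in> tuples H n \<rightarrow> carrier G" and xs: "xs \<in> tuples H (Suc n)"
  shows "alt_diff B (\<lambda>ys. u (F ys)) xs = u (alt_diff G F xs)"
proof -
  interpret B: abelian_group B by (rule B)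
  interpret u: group_hom "add_monoid G" "add_monoid B" u
    using u a_group B.a_group by (simp add: group_hom_def group_hom_axioms_def)
  have zero: "u \<zero> = \<zero>\<^bsub>B\<^esub>" using u.hom_one by simp
  have diff: "u (a \<ominus> b) = u a \<ominus>\<^bsub>B\<^esub> u b" if "a \<in> carrier G" "b \<in> carrier G" for a b
    using that u.hom_mult[of a "\<ominus> b"] u.hom_inv[of b] by (simp add: minus_eq B.minus_eq a_inv_def)
  show ?thesis using F xs
  proof (induction n arbitrary: F xs)
    case 0
    then show ?case by (auto elim!: tuples_SucE simp: Pi_def diff zero)
  next
    case (Suc n)
    from Suc.prems obtain x ys where xs: "xs = x # ys" "x \<in> carrier H" "ys \<in> tuples H (Suc n)"
      by (blast elim: tuples_SucE)
    note pre = prefix_Pi_tuples[OF Suc.prems(1) xs(2)]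
    have "F ys \<in> carrier G" using Suc.prems xs by auto
    with xs Suc.IH[OF pre xs(3)] alt_diff_closed[OF pre xs(3)]
    show ?case by (simp add: diff)
  qed
qed

end

section \<open>Cochains of a bimodule and their homogeneous form\<close>

text \<open>The lists \<open>partial_products H x gs\<close> and \<open>quotients H xs\<close> pass between inhomogeneous
  coordinates \<open>g\<^sub>i = x\<^sub>i\<^sub>-\<^sub>1\<^sup>-\<^sup>1x\<^sub>i\<close> and homogeneous ones; a homogeneous tuple is determined by its quotients
  and its first entry.\<close>

fun partial_products :: "('g, 'n) monoid_scheme \<Rightarrow> 'g \<Rightarrow> 'g list \<Rightarrow> 'g list" where
  "partial_products H x [] = [x]"
| "partial_products H x (g # gs) = x # partial_products H (x \<otimes>\<^bsub>H\<^esub> g) gs"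

fun quotients :: "('g, 'n) monoid_scheme \<Rightarrow> 'g list \<Rightarrow> 'g list" where
  "quotients H (x # y # ys) = (inv\<^bsub>H\<^esub> x \<otimes>\<^bsub>H\<^esub> y) # quotients H (y # ys)"
| "quotients H xs = []"

text \<open>All terms of the coboundary except the first one, which is the only one that involves the left
  action; they correspond to the faces of a homogeneous tuple that keep the entry \<open>x\<^sub>0\<close>.\<close>

fun coboundary_tail ::
  "('g, 'n) monoid_scheme \<Rightarrow> ('a, 'm) ring_scheme \<Rightarrow> ('g \<Rightarrow> 'a \<Rightarrow> 'a) \<Rightarrow> ('g list \<Rightarrow> 'a) \<Rightarrow> 'g list \<Rightarrow> 'a"
  where
  "coboundary_tail H A r \<phi> [] = \<zero>\<^bsub>A\<^esub>"
| "coboundary_tail H A r \<phi> [g] = \<ominus>\<^bsub>A\<^esub> r g (\<phi> [])"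
| "coboundary_tail H A r \<phi> (g # h # gs) =
    \<ominus>\<^bsub>A\<^esub> (\<phi> ((g \<otimes>\<^bsub>H\<^esub> h) # gs) \<oplus>\<^bsub>A\<^esub> coboundary_tail H A r (\<lambda>hs. \<phi> (g # hs)) (h # gs))"

lemma partial_products_ne [simp]: "partial_products H x gs \<noteq> []"
  by (cases gs) auto

lemma hd_partial_products [simp]: "hd (partial_products H x gs) = x"
  by (cases gs) auto

lemma length_quotients [simp]: "length (quotients H xs) = length xs - 1"
  by (induction xs rule: quotients.induct) auto

lemma nth_quotients:
  "Suc i < length xs \<Longrightarrow> quotients H xs ! i = inv\<^bsub>H\<^esub> (xs ! i) \<otimes>\<^bsub>H\<^esub> (xs ! Suc i)"
  by (induction xs arbitrary: i rule: quotients.induct) (auto simp: nth_Cons split: nat.splits)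

context group
begin

lemma partial_products_closed:
  "x \<in> carrier G \<Longrightarrow> gs \<in> tuples G n \<Longrightarrow> partial_products G x gs \<in> tuples G (Suc n)"
  by (induction n arbitrary: x gs) (auto elim!: tuples_SucE)

lemma quotients_closed: "xs \<in> tuples G (Suc n) \<Longrightarrow> quotients G xs \<in> tuples G n"
  by (induction n arbitrary: xs) (auto elim!: tuples_SucE)

lemma quotients_partial_products:
  "x \<in> carrier G \<Longrightarrow> gs \<in> tuples G n \<Longrightarrow> quotients G (partial_products G x gs) = gs"
proof (induction n arbitrary: x gs)
  case (Suc n)
  then obtain g hs where gs: "gs = g # hs" "g \<in> carrier G" "hs \<in> tuples G n"
    by (blast elim: tuples_SucE)
  obtain zs where "partial_products G (x \<otimes> g) hs = (x \<otimes> g) # zs"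
    by (cases hs) auto
  with Suc gs show ?case using Suc.IH[of "x \<otimes> g" hs] by (simp add: inv_solve_left' m_assoc[symmetric])
qed simp

lemma partial_products_quotients:
  "xs \<in> tuples G (Suc n) \<Longrightarrow> partial_products G (hd xs) (quotients G xs) = xs"
proof (induction n arbitrary: xs)
  case 0
  then show ?case by (auto elim!: tuples_SucE)
next
  case (Suc n)
  then obtain x y ys where xs: "xs = x # y # ys" "x \<in> carrier G" "y \<in> carrier G" "ys \<in> tuples G n"
    by (blast elim: tuples_SucE)
  then have "x \<otimes> (inv x \<otimes> y) = y" by (simp add: m_assoc[symmetric])
  with Suc.IH[of "y # ys"] xs show ?case by simp
qed

lemma last_partial_products_closed:
  "x \<in> carrier G \<Longrightarrow> gs \<in> tuples G n \<Longrightarrow> last (partial_products G x gs) \<in> carrier G"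
  using partial_products_closed[of x gs n] last_in_set[OF partial_products_ne]
  by (fastforce simp: tuples_def)

lemma last_partial_products_mult:
  "x \<in> carrier G \<Longrightarrow> y \<in> carrier G \<Longrightarrow> gs \<in> tuples G n
    \<Longrightarrow> last (partial_products G (x \<otimes> y) gs) = x \<otimes> last (partial_products G y gs)"
proof (induction n arbitrary: y gs)
  case (Suc n)
  then show ?case by (auto elim!: tuples_SucE simp: m_assoc)
qed simp

end

locale group_bimodule = H: group H + A: abelian_group A
  for H :: "('g, 'n) monoid_scheme" (structure) and A :: "('a, 'm) ring_scheme" (structure) +
  fixes l r :: "'g \<Rightarrow> 'a \<Rightarrow> 'a"
  assumes l_closed: "g \<in> carrier H \<Longrightarrow> a \<in> carrier A \<Longrightarrow> l g a \<in> carrier A"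
    and r_closed: "g \<in> carrier H \<Longrightarrow> a \<in> carrier A \<Longrightarrow> r g a \<in> carrier A"
    and l_add: "g \<in> carrier H \<Longrightarrow> a \<in> carrier A \<Longrightarrow> b \<in> carrier A \<Longrightarrow>
      l g (a \<oplus>\<^bsub>A\<^esub> b) = l g a \<oplus>\<^bsub>A\<^esub> l g b"
    and r_add: "g \<in> carrier H \<Longrightarrow> a \<in> carrier A \<Longrightarrow> b \<in> carrier A \<Longrightarrow>
      r g (a \<oplus>\<^bsub>A\<^esub> b) = r g a \<oplus>\<^bsub>A\<^esub> r g b"
    and l_one: "a \<in> carrier A \<Longrightarrow> l \<one>\<^bsub>H\<^esub> a = a"
    and r_one: "a \<in> carrier A \<Longrightarrow> r \<one>\<^bsub>H\<^esub> a = a"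
    and l_mult: "g \<in> carrier H \<Longrightarrow> h \<in> carrier H \<Longrightarrow> a \<in> carrier A \<Longrightarrow>
      l g (l h a) = l (g \<otimes>\<^bsub>H\<^esub> h) a"
    and r_mult: "g \<in> carrier H \<Longrightarrow> h \<in> carrier H \<Longrightarrow> a \<in> carrier A \<Longrightarrow>
      r h (r g a) = r (g \<otimes>\<^bsub>H\<^esub> h) a"
    and l_r: "g \<in> carrier H \<Longrightarrow> h \<in> carrier H \<Longrightarrow> a \<in> carrier A \<Longrightarrow>
      l g (r h a) = r h (l g a)"
begin

lemma l_minus: assumes "g \<in> carrier H" "a \<in> carrier A" shows "l g (\<ominus>\<^bsub>A\<^esub> a) = \<ominus>\<^bsub>A\<^esub> l g a"
proof -
  interpret group_hom "add_monoid A" "add_monoid A" "l g"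
    using A.a_group assms(1) l_closed l_add by unfold_locales (auto simp: hom_def group_def)
  show ?thesis using hom_inv[of a] assms by (simp add: a_inv_def)
qed

lemma r_minus: assumes "g \<in> carrier H" "a \<in> carrier A" shows "r g (\<ominus>\<^bsub>A\<^esub> a) = \<ominus>\<^bsub>A\<^esub> r g a"
proof -
  interpret group_hom "add_monoid A" "add_monoid A" "r g"
    using A.a_group assms(1) r_closed r_add by unfold_locales (auto simp: hom_def group_def)
  show ?thesis using hom_inv[of a] assms by (simp add: a_inv_def)
qed

text \<open>The left factor \<open>x\<^sub>0\<close> and the right factor \<open>x\<^sub>n\<^sup>-\<^sup>1\<close> absorb the two outer actions in the
  coboundary and in the action of \<open>\<sigma>\<^sub>1\<close> and \<open>\<sigma>\<^sub>n\<close>.\<close>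

definition homogenize :: "('g list \<Rightarrow> 'a) \<Rightarrow> 'g list \<Rightarrow> 'a" where
  "homogenize \<phi> xs = l (hd xs) (r (inv\<^bsub>H\<^esub> (last xs)) (\<phi> (quotients H xs)))"

abbreviation C :: "nat \<Rightarrow> ('g list \<Rightarrow> 'a) monoid" where "C \<equiv> cochains H A"
abbreviation \<delta> :: "nat \<Rightarrow> ('g list \<Rightarrow> 'a) \<Rightarrow> 'g list \<Rightarrow> 'a" where "\<delta> \<equiv> coboundary H A l r"

lemma hd_last_closed:
  "xs \<in> tuples H (Suc n) \<Longrightarrow> hd xs \<in> carrier H" "xs \<in> tuples H (Suc n) \<Longrightarrow> last xs \<in> carrier H"
  by (auto simp: tuples_def subset_iff length_Suc_conv)

lemma homogenize_closed:
  "\<phi> \<in> tuples H n \<rightarrow> carrier A \<Longrightarrow> xs \<in> tuples H (Suc n) \<Longrightarrow> homogenize \<phi> xs \<in> carrier A"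
  using H.quotients_closed[of xs n] hd_last_closed[of xs n]
  by (auto simp: homogenize_def Pi_def intro!: l_closed r_closed)

lemma l_inj: "g \<in> carrier H \<Longrightarrow> a \<in> carrier A \<Longrightarrow> b \<in> carrier A \<Longrightarrow> l g a = l g b \<longleftrightarrow> a = b"
  by (metis H.inv_closed H.l_inv l_mult l_one)

lemma r_inj: "g \<in> carrier H \<Longrightarrow> a \<in> carrier A \<Longrightarrow> b \<in> carrier A \<Longrightarrow> r g a = r g b \<longleftrightarrow> a = b"
  by (metis H.inv_closed H.r_inv r_mult r_one)

lemma homogenize_partial_products:
  "x \<in> carrier H \<Longrightarrow> gs \<in> tuples H n \<Longrightarrow>
   homogenize \<phi> (partial_products H x gs) = l x (r (inv\<^bsub>H\<^esub> (last (partial_products H x gs))) (\<phi> gs))"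
  by (simp add: homogenize_def H.quotients_partial_products)

text \<open>The value of \<open>\<phi>\<close> at \<open>(g\<^sub>1,\<dots>,g\<^sub>n)\<close> can be read off from the tuple
  \<open>(1, g\<^sub>1, g\<^sub>1g\<^sub>2, \<dots>)\<close>, since group elements act injectively. This is how identities of homogeneous
  forms are brought back to cochains.\<close>

lemma homogenize_inject:
  assumes \<phi>: "\<phi> \<in> carrier (C n)" and \<psi>: "\<psi> \<in> carrier (C n)"
    and eq: "\<And>xs. xs \<in> tuples H (Suc n) \<Longrightarrow> homogenize \<phi> xs = homogenize \<psi> xs"
  shows "\<phi> = \<psi>"
proof (rule extensionalityI[of _ "tuples H n"])
  show "\<phi> \<in> extensional (tuples H n)" "\<psi> \<in> extensional (tuples H n)"
    using \<phi> \<psi> by (auto simp: cochains_def PiE_def)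
  fix gs assume gs: "gs \<in> tuples H n"
  let ?xs = "partial_products H \<one>\<^bsub>H\<^esub> gs"
  have "?xs \<in> tuples H (Suc n)" using gs by (simp add: H.partial_products_closed)
  moreover have "\<phi> gs \<in> carrier A" "\<psi> gs \<in> carrier A" using gs \<phi> \<psi> by (auto simp: cochains_def)
  ultimately show "\<phi> gs = \<psi> gs"
    using gs eq[of ?xs] H.last_partial_products_closed[of "\<one>\<^bsub>H\<^esub>" gs n]
    by (simp add: homogenize_partial_products l_inj r_inj r_closed)
qed

subsection \<open>The coboundary is the alternating sum of faces\<close>

lemma coboundary_tail_closed:
  "\<phi> \<in> tuples H n \<rightarrow> carrier A \<Longrightarrow> gs \<in> tuples H (Suc n) \<Longrightarrow> coboundary_tail H A r \<phi> gs \<in> carrier A"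
proof (induction n arbitrary: \<phi> gs)
  case 0
  then show ?case by (auto elim!: tuples_SucE simp: r_closed)
next
  case (Suc n)
  then obtain g h hs where gs: "gs = g # h # hs" "g \<in> carrier H" "h \<in> carrier H" "hs \<in> tuples H n"
    by (blast elim: tuples_SucE)
  have "coboundary_tail H A r (\<lambda>hs. \<phi> (g # hs)) (h # hs) \<in> carrier A"
    using Suc gs by (intro Suc.IH) auto
  moreover have "\<phi> ((g \<otimes>\<^bsub>H\<^esub> h) # hs) \<in> carrier A" using Suc gs by auto
  ultimately show ?case using gs by simp
qed

lemma merge_closed:
  assumes "gs \<in> tuples H (Suc n)" "j \<in> {1..n}"
  shows "merge H j gs \<in> tuples H n"
proof -
  have "gs ! (j - 1) \<in> carrier H" "gs ! j \<in> carrier H" using assms by (auto simp: tuples_def subset_iff)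
  moreover have "set (take (j-1) gs) \<subseteq> carrier H" "set (drop (j+1) gs) \<subseteq> carrier H"
    using assms set_take_subset[of "j-1" gs] set_drop_subset[of "j+1" gs] by (auto simp: tuples_def)
  ultimately show ?thesis using assms by (auto simp: tuples_def merge_def)
qed

lemma add_pow_neg_one_Suc:
  "a \<in> carrier A \<Longrightarrow> add_pow A ((- 1 :: int) ^ Suc j) a = \<ominus>\<^bsub>A\<^esub> add_pow A ((- 1 :: int) ^ j) a"
  using A.add.int_pow_neg[of a "(-1) ^ j"] by simp

text \<open>For \<open>j > 1\<close>, merging at position \<open>j\<close> leaves the first entry alone, so the terms with \<open>j > 1\<close>
  and the last term form the same sum, with opposite sign, for the cochain \<open>\<phi>(g, \<dots>)\<close>.\<close>

lemma coboundary_tail_eq: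
  "\<phi> \<in> tuples H n \<rightarrow> carrier A \<Longrightarrow> gs \<in> tuples H (Suc n) \<Longrightarrow>
    (\<Oplus>\<^bsub>A\<^esub>j\<in>{1..n}. add_pow A ((- 1 :: int) ^ j) (\<phi> (merge H j gs)))
     \<oplus>\<^bsub>A\<^esub> add_pow A ((- 1 :: int) ^ (n + 1)) (r (last gs) (\<phi> (butlast gs)))
    = coboundary_tail H A r \<phi> gs"
proof (induction n arbitrary: \<phi> gs)
  case 0
  then obtain g where gs: "gs = [g]" "g \<in> carrier H" by (auto elim!: tuples_SucE)
  with 0 have "r g (\<phi> []) \<in> carrier A" by (auto simp: r_closed)
  with gs show ?case by (simp add: A.add.int_pow_neg)
next
  case (Suc n)
  then obtain g h hs where gs: "gs = g # h # hs" "g \<in> carrier H" "h \<in> carrier H" "hs \<in> tuples H n"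
    by (blast elim: tuples_SucE)
  define \<psi> where "\<psi> = (\<lambda>hs. \<phi> (g # hs))"
  have \<psi>: "\<psi> \<in> tuples H n \<rightarrow> carrier A" using Suc.prems gs by (auto simp: \<psi>_def)
  have hhs: "h # hs \<in> tuples H (Suc n)" using gs by simp
  define f where "f = (\<lambda>j. add_pow A ((- 1 :: int) ^ j) (\<psi> (merge H j (h # hs))))"
  have f: "f \<in> {1..n} \<rightarrow> carrier A"
    unfolding f_def using \<psi> merge_closed[OF hhs] by (auto intro!: A.add.int_pow_closed)
  define t where "t = add_pow A ((- 1 :: int) ^ (n + 1)) (r (last (h # hs)) (\<psi> (butlast (h # hs))))"
  have bl: "butlast (h # hs) \<in> tuples H n" "last (h # hs) \<in> carrier H"
    using butlast_closed[OF hhs] hd_last_closed(2)[OF hhs] by auto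
  have rc: "r (last (h # hs)) (\<psi> (butlast (h # hs))) \<in> carrier A"
    using \<psi> bl by (intro r_closed) auto
  then have t: "t \<in> carrier A" unfolding t_def by (auto intro!: A.add.int_pow_closed)
  let ?m = "\<phi> ((g \<otimes>\<^bsub>H\<^esub> h) # hs)"
  have m: "?m \<in> carrier A" using Suc.prems gs by auto
  let ?F = "\<lambda>j. add_pow A ((- 1 :: int) ^ j) (\<phi> (merge H j gs))"
  have Suc_term: "?F (Suc j) = \<ominus>\<^bsub>A\<^esub> f j" if j: "j \<in> {1..n}" for j
  proof -
    from j obtain i where "j = Suc i" by (cases j) auto
    then have "merge H (Suc j) gs = g # merge H j (h # hs)" by (simp add: merge_def gs)
    moreover have "\<psi> (merge H j (h # hs)) \<in> carrier A" using \<psi> merge_closed[OF hhs j] by auto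
    ultimately show ?thesis
      using add_pow_neg_one_Suc[of "\<psi> (merge H j (h # hs))" j]
      by (simp add: f_def \<psi>_def del: power_Suc)
  qed
  have one_term: "?F 1 = \<ominus>\<^bsub>A\<^esub> ?m" using m by (simp add: merge_def gs A.add.int_pow_neg)
  have F: "?F \<in> Suc ` {1..n} \<rightarrow> carrier A"
  proof
    fix i assume "i \<in> Suc ` {1..n}"
    then obtain j where j: "i = Suc j" "j \<in> {1..n}" by blast
    then have "f j \<in> carrier A" using f by blast
    then have "\<ominus>\<^bsub>A\<^esub> f j \<in> carrier A" by simp
    with Suc_term[OF j(2)] j(1) show "?F i \<in> carrier A" by (simp only:)
  qed
  have split: "{1..Suc n} = insert 1 (Suc ` {1..n})"
    by (auto simp: image_iff)
  have "finsum A ?F {1..Suc n} = ?F 1 \<oplus>\<^bsub>A\<^esub> finsum A ?F (Suc ` {1..n})"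
    unfolding split
  proof (rule A.finsum_insert[OF _ _ F])
    show "?F 1 \<in> carrier A" unfolding one_term using m by (rule A.a_inv_closed)
  qed simp_all
  also have "finsum A ?F (Suc ` {1..n}) = (\<Oplus>\<^bsub>A\<^esub>j\<in>{1..n}. ?F (Suc j))"
    using F by (rule A.finsum_reindex) simp
  also have "\<dots> = (\<Oplus>\<^bsub>A\<^esub>j\<in>{1..n}. \<ominus>\<^bsub>A\<^esub> f j)"
    using f by (intro A.finsum_cong'[OF refl _ Suc_term] Pi_I A.a_inv_closed) (rule Pi_mem)
  also have "\<dots> = \<ominus>\<^bsub>A\<^esub> finsum A f {1..n}"
  proof -
    have "finsum A (\<lambda>j. \<ominus>\<^bsub>A\<^esub> f j) {1..n} \<oplus>\<^bsub>A\<^esub> finsum A f {1..n} = finsum A (\<lambda>j. \<ominus>\<^bsub>A\<^esub> f j \<oplus>\<^bsub>A\<^esub> f j) {1..n}"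
      using f by (subst A.finsum_addf) (auto simp: Pi_def)
    also have "\<dots> = finsum A (\<lambda>j. \<zero>\<^bsub>A\<^esub>) {1..n}"
      using f by (intro A.finsum_cong') (auto simp: Pi_def A.l_neg)
    also have "\<dots> = \<zero>\<^bsub>A\<^esub>" by (rule A.finsum_zero)
    finally show ?thesis
      using A.minus_equality[of "finsum A (\<lambda>j. \<ominus>\<^bsub>A\<^esub> f j) {1..n}" "finsum A f {1..n}"] f
      by (simp add: Pi_def)
  qed
  finally have sum: "finsum A ?F {1..Suc n} = \<ominus>\<^bsub>A\<^esub> ?m \<oplus>\<^bsub>A\<^esub> \<ominus>\<^bsub>A\<^esub> finsum A f {1..n}"
    using one_term by simp
  have last: "add_pow A ((- 1 :: int) ^ (Suc n + 1)) (r (last gs) (\<phi> (butlast gs))) = \<ominus>\<^bsub>A\<^esub> t"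
    using add_pow_neg_one_Suc[OF rc, of "n + 1"] by (simp add: t_def gs \<psi>_def del: power_Suc)
  have IH: "finsum A f {1..n} \<oplus>\<^bsub>A\<^esub> t = coboundary_tail H A r \<psi> (h # hs)"
    using Suc.IH[OF \<psi> hhs] by (simp only: f_def t_def)
  have "finsum A f {1..n} \<in> carrier A" using f by (rule A.finsum_closed)
  then have "\<ominus>\<^bsub>A\<^esub> ?m \<oplus>\<^bsub>A\<^esub> \<ominus>\<^bsub>A\<^esub> finsum A f {1..n} \<oplus>\<^bsub>A\<^esub> \<ominus>\<^bsub>A\<^esub> t
      = \<ominus>\<^bsub>A\<^esub> (?m \<oplus>\<^bsub>A\<^esub> (finsum A f {1..n} \<oplus>\<^bsub>A\<^esub> t))"
    using m t by (simp add: A.additive_simps)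
  then show ?case unfolding sum last IH by (simp add: gs \<psi>_def)
qed

lemma coboundary_eq:
  assumes \<phi>: "\<phi> \<in> carrier (C n)" and gs: "gs \<in> tuples H (Suc n)"
  shows "\<delta> n \<phi> gs = l (hd gs) (\<phi> (tl gs)) \<oplus>\<^bsub>A\<^esub> coboundary_tail H A r \<phi> gs"
proof -
  have \<phi>': "\<phi> \<in> tuples H n \<rightarrow> carrier A" using \<phi> by (auto simp: cochains_def)
  have 1: "l (hd gs) (\<phi> (tl gs)) \<in> carrier A"
    using \<phi>' gs by (auto elim!: tuples_SucE intro!: l_closed)
  have 2: "(\<Oplus>\<^bsub>A\<^esub>j\<in>{1..n}. add_pow A ((- 1 :: int) ^ j) (\<phi> (merge H j gs))) \<in> carrier A"
    using \<phi>' merge_closed[OF gs] by (intro A.finsum_closed) (auto intro!: A.add.int_pow_closed)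
  have "butlast gs \<in> tuples H n" by (rule butlast_closed[OF gs])
  then have 3: "add_pow A ((- 1 :: int) ^ (n + 1)) (r (last gs) (\<phi> (butlast gs))) \<in> carrier A"
    using \<phi>' hd_last_closed[OF gs] by (intro A.add.int_pow_closed r_closed) auto
  show ?thesis using gs coboundary_tail_eq[OF \<phi>' gs, symmetric] A.a_assoc[OF 1 2 3]
    by (simp add: coboundary_def)
qed

lemma coboundary_closed:
  assumes \<phi>: "\<phi> \<in> carrier (C n)" shows "\<delta> n \<phi> \<in> carrier (C (Suc n))"
proof -
  have \<phi>': "\<phi> \<in> tuples H n \<rightarrow> carrier A" using \<phi> by (auto simp: cochains_def)
  have "\<delta> n \<phi> gs \<in> carrier A" if gs: "gs \<in> tuples H (Suc n)" for gs
  proof -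
    from gs obtain y ys where "gs = y # ys" "y \<in> carrier H" "ys \<in> tuples H n" 
      by (blast elim: tuples_SucE)
    with \<phi>' coboundary_tail_closed[OF \<phi>' gs] coboundary_eq[OF \<phi> gs] show ?thesis
      by (auto intro!: l_closed)
  qed
  then show ?thesis by (auto simp: cochains_def coboundary_def)
qed

text \<open>Induction along the two recursions, which run in parallel: omitting an inner entry multiplies
  the two adjacent quotients, omitting the last entry turns the last quotient into a factor on the
  right. The induction generalizes over the part of the tuple that has already been passed: this part is
  hidden in \<open>F\<close>, its first entry is \<open>x\<close>, its last one is \<open>y\<close>, and the corresponding
  arguments of the cochain are hidden in \<open>\<phi>\<close>.\<close>

lemma alt_diff_coboundary_tail:
  assumes x: "x \<in> carrier H"
  shows "y \<in> carrier H \<Longrightarrow> gs \<in> tuples H (Suc n) \<Longrightarrow> \<phi> \<in> tuples H n \<rightarrow> carrier A \<Longrightarrow>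
    (n = 0 \<Longrightarrow> F [] = l x (r (inv\<^bsub>H\<^esub> y) (\<phi> []))) \<Longrightarrow>
    (\<And>gs. n \<noteq> 0 \<Longrightarrow> gs \<in> tuples H n \<Longrightarrow>
       F (partial_products H (y \<otimes>\<^bsub>H\<^esub> hd gs) (tl gs))
         = l x (r (inv\<^bsub>H\<^esub> (last (partial_products H y gs))) (\<phi> gs))) \<Longrightarrow>
    alt_diff A F (partial_products H (y \<otimes>\<^bsub>H\<^esub> hd gs) (tl gs))
      = \<ominus>\<^bsub>A\<^esub> l x (r (inv\<^bsub>H\<^esub> (last (partial_products H y gs))) (coboundary_tail H A r \<phi> gs))"
proof (induction n arbitrary: y gs \<phi> F)
  case 0
  then obtain g where gs: "gs = [g]" "g \<in> carrier H" by (auto elim!: tuples_SucE)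
  have \<phi>: "\<phi> [] \<in> carrier A" using 0 by auto
  have "r (inv\<^bsub>H\<^esub> (y \<otimes>\<^bsub>H\<^esub> g)) (r g (\<phi> [])) = r (inv\<^bsub>H\<^esub> y) (\<phi> [])"
    using gs \<phi> 0 by (simp add: r_mult H.inv_mult_group H.m_assoc[symmetric])
  with gs \<phi> 0 x show ?case
    by (simp add: r_minus l_minus r_closed l_closed A.additive_simps)
next
  case (Suc n)
  then obtain g h hs where gs: "gs = g # h # hs" "g \<in> carrier H" "h \<in> carrier H" "hs \<in> tuples H n"
    by (blast elim: tuples_SucE)
  let ?z = "inv\<^bsub>H\<^esub> (last (partial_products H (y \<otimes>\<^bsub>H\<^esub> g) (h # hs)))"
  have z: "?z \<in> carrier H"
    using Suc.prems gs H.last_partial_products_closed[of "y \<otimes>\<^bsub>H\<^esub> g" "h # hs" "Suc n"] by auto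
  have IH: "alt_diff A (\<lambda>zs. F ((y \<otimes>\<^bsub>H\<^esub> g) # zs)) (partial_products H (y \<otimes>\<^bsub>H\<^esub> g \<otimes>\<^bsub>H\<^esub> hd (h # hs)) (tl (h # hs)))
      = \<ominus>\<^bsub>A\<^esub> l x (r ?z (coboundary_tail H A r (\<lambda>hs. \<phi> (g # hs)) (h # hs)))"
  proof (rule Suc.IH)
    show "n = 0 \<Longrightarrow> F [y \<otimes>\<^bsub>H\<^esub> g] = l x (r (inv\<^bsub>H\<^esub> (y \<otimes>\<^bsub>H\<^esub> g)) (\<phi> [g]))"
      using Suc.prems(5)[of "[g]"] gs by simp
    fix ks assume ks: "n \<noteq> 0" "ks \<in> tuples H n"
    then obtain k ls where k: "ks = k # ls" "k \<in> carrier H"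
      by (cases n) (auto elim: tuples_SucE)
    show "F ((y \<otimes>\<^bsub>H\<^esub> g) # partial_products H (y \<otimes>\<^bsub>H\<^esub> g \<otimes>\<^bsub>H\<^esub> hd ks) (tl ks)) =
      l x (r (inv\<^bsub>H\<^esub> (last (partial_products H (y \<otimes>\<^bsub>H\<^esub> g) ks))) (\<phi> (g # ks)))"
      using Suc.prems(5)[of "g # ks"] gs ks k by simp
  qed (use Suc.prems gs in auto)
  have F: "F (partial_products H (y \<otimes>\<^bsub>H\<^esub> g \<otimes>\<^bsub>H\<^esub> h) hs) = l x (r ?z (\<phi> ((g \<otimes>\<^bsub>H\<^esub> h) # hs)))"
    using Suc.prems(5)[of "(g \<otimes>\<^bsub>H\<^esub> h) # hs"] gs Suc.prems by (simp add: H.m_assoc)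
  have c: "\<phi> ((g \<otimes>\<^bsub>H\<^esub> h) # hs) \<in> carrier A"
    "coboundary_tail H A r (\<lambda>hs. \<phi> (g # hs)) (h # hs) \<in> carrier A"
    using Suc.prems gs by (auto intro!: coboundary_tail_closed[of _ n])
  show ?case
    using IH F c z x gs by (simp add: r_minus l_minus r_add l_add r_closed l_closed A.additive_simps)
qed

lemma homogenize_coboundary:
  assumes \<phi>: "\<phi> \<in> carrier (C n)" and xs: "xs \<in> tuples H (Suc (Suc n))"
  shows "homogenize (\<delta> n \<phi>) xs = alt_diff A (homogenize \<phi>) xs"
proof -
  define x gs where "x = hd xs" and "gs = quotients H xs"
  have x: "x \<in> carrier H" and gs: "gs \<in> tuples H (Suc n)" and eq: "xs = partial_products H x gs"
    using xs hd_last_closed[OF xs] H.quotients_closed H.partial_products_quotients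
    by (auto simp: x_def gs_def)
  have \<phi>': "\<phi> \<in> tuples H n \<rightarrow> carrier A" using \<phi> by (auto simp: cochains_def)
  obtain g hs where gs': "gs = g # hs" "g \<in> carrier H" "hs \<in> tuples H n"
    using gs by (blast elim: tuples_SucE)
  let ?z = "inv\<^bsub>H\<^esub> (last (partial_products H x gs))"
  have z: "?z \<in> carrier H" using x gs by (simp add: H.last_partial_products_closed)
  have "alt_diff A (\<lambda>zs. homogenize \<phi> (x # zs)) (partial_products H (x \<otimes>\<^bsub>H\<^esub> hd gs) (tl gs))
      = \<ominus>\<^bsub>A\<^esub> l x (r ?z (coboundary_tail H A r \<phi> gs))"
  proof (rule alt_diff_coboundary_tail[OF x x gs \<phi>'])
    show "homogenize \<phi> [x] = l x (r (inv\<^bsub>H\<^esub> x) (\<phi> []))" by (simp add: homogenize_def)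
    fix ks assume ks: "n \<noteq> 0" "ks \<in> tuples H n"
    then obtain k ls where k: "ks = k # ls" "k \<in> carrier H"
      by (cases n) (auto elim: tuples_SucE)
    with homogenize_partial_products[OF x ks(2)] 
    show "homogenize \<phi> (x # partial_products H (x \<otimes>\<^bsub>H\<^esub> hd ks) (tl ks)) =
      l x (r (inv\<^bsub>H\<^esub> (last (partial_products H x ks))) (\<phi> ks))" by simp
  qed
  moreover have "homogenize \<phi> (partial_products H (x \<otimes>\<^bsub>H\<^esub> g) hs) = l x (r ?z (l g (\<phi> hs)))"
  proof -
    have c: "\<phi> hs \<in> carrier A" using gs' \<phi>' by auto
    have "homogenize \<phi> (partial_products H (x \<otimes>\<^bsub>H\<^esub> g) hs) = l (x \<otimes>\<^bsub>H\<^esub> g) (r ?z (\<phi> hs))"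
      using gs' x homogenize_partial_products[of "x \<otimes>\<^bsub>H\<^esub> g" hs n \<phi>] by simp
    also have "\<dots> = l x (l g (r ?z (\<phi> hs)))"
      using l_mult[OF x gs'(2) r_closed[OF z c]] by simp
    also have "l g (r ?z (\<phi> hs)) = r ?z (l g (\<phi> hs))" by (rule l_r[OF gs'(2) z c])
    finally show ?thesis .
  qed
  moreover have "homogenize (\<delta> n \<phi>) xs = l x (r ?z (l g (\<phi> hs) \<oplus>\<^bsub>A\<^esub> coboundary_tail H A r \<phi> gs))"
    using homogenize_partial_products[OF x gs] coboundary_eq[OF \<phi> gs] by (simp add: eq gs')
  moreover have "l g (\<phi> hs) \<in> carrier A" "coboundary_tail H A r \<phi> gs \<in> carrier A"
    using gs' \<phi>' coboundary_tail_closed[OF \<phi>' gs] by (auto intro!: l_closed)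
  ultimately show ?thesis
    using x z by (simp add: eq gs' r_add l_add l_closed r_closed A.additive_simps)
qed

end

lemma swap_in_tuples: "us @ b # a # vs \<in> tuples H n \<longleftrightarrow> us @ a # b # vs \<in> tuples H n"
  by (auto simp: tuples_def)

lemma alternating_cong:
  assumes "\<And>xs. xs \<in> tuples H n \<Longrightarrow> F xs = F' xs"
  shows "alternating H A n F \<longleftrightarrow> alternating H A n F'"
  unfolding alternating_def by (metis assms swap_in_tuples)

lemma nth_twist:
  "p < length gs \<Longrightarrow> twist H i gs ! p =
    (if Suc (Suc p) = i then gs ! p \<otimes>\<^bsub>H\<^esub> gs ! (i - 1)
     else if Suc p = i then inv\<^bsub>H\<^esub> (gs ! (i - 1))
     else if p = i then gs ! (i - 1) \<otimes>\<^bsub>H\<^esub> gs ! p else gs ! p)"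
  by (simp add: twist_def Let_def del: upt_Suc)

text \<open>Exchanging \<open>x\<^sub>i\<^sub>-\<^sub>1\<close> and \<open>x\<^sub>i\<close> inverts the quotient \<open>g\<^sub>i\<close> between them and multiplies its two
  neighbours by it, which is the rule by which \<open>\<sigma>\<^sub>i\<close> changes the arguments of a cochain.\<close>

lemma (in group) twist_quotients:
  assumes "us @ a # b # vs \<in> tuples G (Suc n)"
  shows "twist G (Suc (length us)) (quotients G (us @ a # b # vs)) = quotients G (us @ b # a # vs)"
proof (rule nth_equalityI)
  let ?xs = "us @ a # b # vs" and ?ys = "us @ b # a # vs" and ?L = "length us"
  let ?q = "quotients G ?xs"
  show "length (twist G (Suc ?L) ?q) = length (quotients G ?ys)"
    by (simp add: twist_def Let_def del: upt_Suc)
  fix p assume "p < length (twist G (Suc ?L) ?q)"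
  then have p: "Suc p < length ?xs" by (simp add: twist_def Let_def del: upt_Suc)
  have cl: "?xs ! q \<in> carrier G" if "q < length ?xs" for q
    using assms that nth_mem[of q ?xs] unfolding tuples_def by blast
  have ab: "?xs ! ?L = a" "?xs ! Suc ?L = b" "a \<in> carrier G" "b \<in> carrier G"
    using assms by (auto simp: nth_append tuples_def)
  have ys: "?ys ! q = (if q = ?L then b else if q = Suc ?L then a else ?xs ! q)" for q
    by (auto simp: nth_append nth_Cons split: nat.splits)
  have q: "?q ! j = inv (?xs ! j) \<otimes> (?xs ! Suc j)" if "Suc j < length ?xs" for j
    using that by (rule nth_quotients)
  have "twist G (Suc ?L) ?q ! p = (if Suc p = ?L then ?q ! p \<otimes> ?q ! ?L
      else if p = ?L then inv (?q ! ?L) else if p = Suc ?L then ?q ! ?L \<otimes> ?q ! p else ?q ! p)"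
    using p by (subst nth_twist) auto
  also have "\<dots> = inv (?ys ! p) \<otimes> (?ys ! Suc p)"
  proof -
    note c = cl[of p] cl[of "Suc p"] ab(3,4) p
    have cancel: "y \<otimes> (inv y \<otimes> z) = z" "inv y \<otimes> (y \<otimes> z) = z" if "y \<in> carrier G" "z \<in> carrier G" for y z
      using that by (simp_all add: m_assoc[symmetric])
    consider "Suc p = ?L" | "p = ?L" | "p = Suc ?L" | "Suc p < ?L \<or> p > Suc ?L" by linarith
    then show ?thesis
    proof cases
      case 1
      then have "?xs ! Suc p = a" using ab(1) by simp
      with 1 c show ?thesis by (simp add: ys q ab m_assoc cancel)
    next
      case 2
      with c show ?thesis by (simp add: ys q ab inv_mult_group)
    next
      case 3
      with c ab show ?thesis by (simp add: ys q m_assoc cancel del: nth_append_length_plus)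
    next
      case 4
      then show ?thesis using p by (auto simp add: ys q)
    qed
  qed
  also have "\<dots> = quotients G ?ys ! p"
    using p by (subst nth_quotients) auto
  finally show "twist G (Suc ?L) ?q ! p = quotients G ?ys ! p" .
qed

lemma (in group) twist_closed:
  assumes "gs \<in> tuples G n" "i \<in> {1..n}" shows "twist G i gs \<in> tuples G n"
proof -
  have len: "length gs = n" using assms by (simp add: tuples_def)
  have cl: "gs ! q \<in> carrier G" if "q < n" for q
    using assms(1) that nth_mem[of q gs] by (auto simp: tuples_def)
  show ?thesis
    using assms(2) by (auto simp: tuples_def twist_def Let_def len cl simp del: upt_Suc)
qed

context group_bimodule
begin

lemma transp_act_closed:
  assumes "\<phi> \<in> carrier (C n)" "i \<in> {1..n}" shows "transp_act H A l r n i \<phi> \<in> carrier (C n)"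
proof -
  have "transp_act H A l r n i \<phi> gs \<in> carrier A" if gs: "gs \<in> tuples H n" for gs
  proof -
    obtain m where n: "n = Suc m" using assms(2) by (cases n) auto
    have "\<phi> (twist H i gs) \<in> carrier A"
      using assms(1) H.twist_closed[OF gs assms(2)] by (auto simp: cochains_def)
    then show ?thesis
      using gs hd_last_closed[of gs m] n
      by (auto simp: transp_act_def Let_def intro!: l_closed r_closed)
  qed
  then show ?thesis by (auto simp: cochains_def transp_act_def)
qed

text \<open>For \<open>i = 1\<close> the entry \<open>x\<^sub>0\<close> changes to \<open>x\<^sub>1 = x\<^sub>0g\<^sub>1\<close>, for \<open>i = n\<close> the entry \<open>x\<^sub>n\<close> changes to
  \<open>x\<^sub>n\<^sub>-\<^sub>1 = x\<^sub>ng\<^sub>n\<^sup>-\<^sup>1\<close>; the outer factors \<open>g\<^sub>1\<close> and \<open>g\<^sub>n\<close> in the definition of the action account for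
  exactly these changes. The two conditions are independent, as they must be for \<open>n = 1\<close>.\<close>

lemma homogenize_transp_act:
  assumes \<phi>: "\<phi> \<in> carrier (C n)" and xs: "us @ a # b # vs \<in> tuples H (Suc n)"
  shows "homogenize (transp_act H A l r n (Suc (length us)) \<phi>) (us @ a # b # vs)
    = \<ominus>\<^bsub>A\<^esub> homogenize \<phi> (us @ b # a # vs)"
proof -
  let ?xs = "us @ a # b # vs" and ?ys = "us @ b # a # vs"
  let ?gs = "quotients H ?xs" and ?hs = "quotients H ?ys"
  have n: "n = Suc (length us + length vs)" using xs by (auto simp: tuples_def)
  have ys: "?ys \<in> tuples H (Suc n)" using xs by (simp add: swap_in_tuples)
  have gs: "?gs \<in> tuples H n" and hs: "?hs \<in> tuples H n"
    using H.quotients_closed xs ys by auto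
  have ab: "a \<in> carrier H" "b \<in> carrier H" using xs by (auto simp: tuples_def)
  have ends: "hd ?xs \<in> carrier H" "last ?xs \<in> carrier H" "hd ?ys \<in> carrier H" "last ?ys \<in> carrier H"
    "hd ?gs \<in> carrier H" "last ?gs \<in> carrier H"
    using hd_last_closed xs ys gs n by blast+
  have c: "\<phi> ?hs \<in> carrier A" using \<phi> hs by (auto simp: cochains_def)
  have hd: "hd ?xs \<otimes>\<^bsub>H\<^esub> hd ?gs = hd ?ys" if "us = []"
    using that ab by (simp add: H.m_assoc[symmetric])
  have hd': "hd ?xs = hd ?ys" if "us \<noteq> []"
    using that by (cases us) auto
  have last: "last ?gs \<otimes>\<^bsub>H\<^esub> inv\<^bsub>H\<^esub> (last ?xs) = inv\<^bsub>H\<^esub> (last ?ys)" if "vs = []"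
  proof -
    have "last ?gs = ?gs ! length us"
    proof -
      have "?gs \<noteq> []" using n by (simp flip: length_0_conv)
      then show ?thesis using that last_conv_nth[of ?gs] by simp
    qed
    also have "\<dots> = inv\<^bsub>H\<^esub> a \<otimes>\<^bsub>H\<^esub> b"
      by (subst nth_quotients) (auto simp: nth_append)
    finally show ?thesis using that ab by (simp add: H.m_assoc)
  qed
  have last': "last ?xs = last ?ys" if "vs \<noteq> []"
    using that by simp
  define z where "z = (if us = [] then l (hd ?gs) (\<phi> ?hs) else \<phi> ?hs)"
  define w where "w = (if vs = [] then r (last ?gs) z else z)"
  have z: "z \<in> carrier A" using c ends by (auto simp: z_def l_closed)
  have w: "w \<in> carrier A" using z ends by (auto simp: w_def r_closed)
  have "transp_act H A l r n (Suc (length us)) \<phi> ?gs = \<ominus>\<^bsub>A\<^esub> w"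
    unfolding transp_act_def Let_def restrict_apply'[OF gs] H.twist_quotients[OF xs]
    using n by (simp add: z_def w_def)
  moreover have "r (inv\<^bsub>H\<^esub> (last ?xs)) w = r (inv\<^bsub>H\<^esub> (last ?ys)) z"
  proof (cases "vs = []")
    case True
    have "r (inv\<^bsub>H\<^esub> (last ?xs)) (r (last ?gs) z) = r (last ?gs \<otimes>\<^bsub>H\<^esub> inv\<^bsub>H\<^esub> (last ?xs)) z"
      using ends z by (intro r_mult) auto
    with True last show ?thesis by (simp add: w_def)
  next
    case False
    with last' show ?thesis by (simp add: w_def)
  qed
  moreover have "l (hd ?xs) (r (inv\<^bsub>H\<^esub> (last ?ys)) z) = l (hd ?ys) (r (inv\<^bsub>H\<^esub> (last ?ys)) (\<phi> ?hs))"
  proof (cases "us = []")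
    case True
    have "l (hd ?xs) (r (inv\<^bsub>H\<^esub> (last ?ys)) (l (hd ?gs) (\<phi> ?hs)))
        = l (hd ?xs) (l (hd ?gs) (r (inv\<^bsub>H\<^esub> (last ?ys)) (\<phi> ?hs)))"
      using l_r[of "hd ?gs" "inv\<^bsub>H\<^esub> (last ?ys)" "\<phi> ?hs"] ends c by simp
    also have "\<dots> = l (hd ?ys) (r (inv\<^bsub>H\<^esub> (last ?ys)) (\<phi> ?hs))"
      using l_mult[of "hd ?xs" "hd ?gs" "r (inv\<^bsub>H\<^esub> (last ?ys)) (\<phi> ?hs)"] ends c hd[OF True]
      by (simp add: r_closed)
    finally show ?thesis using True by (simp add: z_def)
  next
    case False
    with hd' show ?thesis by (simp add: z_def)
  qed
  moreover have "l (hd ?xs) (r (inv\<^bsub>H\<^esub> (last ?xs)) (\<ominus>\<^bsub>A\<^esub> w)) = \<ominus>\<^bsub>A\<^esub> l (hd ?xs) (r (inv\<^bsub>H\<^esub> (last ?xs)) w)"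
    using l_minus[OF ends(1) r_closed[OF H.inv_closed[OF ends(2)] w]]
      r_minus[OF H.inv_closed[OF ends(2)] w] by simp
  ultimately show ?thesis by (simp only: homogenize_def)
qed

lemma sym_cochains_iff:
  "\<phi> \<in> sym_cochains H A l r n \<longleftrightarrow> \<phi> \<in> carrier (C n) \<and> alternating H A (Suc n) (homogenize \<phi>)"
proof (cases "\<phi> \<in> carrier (C n)")
  case \<phi>: True
  then have \<phi>': "\<phi> \<in> tuples H n \<rightarrow> carrier A" by (auto simp: cochains_def)
  show ?thesis
  proof
    assume sym: "\<phi> \<in> sym_cochains H A l r n"
    have "homogenize \<phi> (us @ b # a # vs) = \<ominus>\<^bsub>A\<^esub> homogenize \<phi> (us @ a # b # vs)"
      if xs: "us @ a # b # vs \<in> tuples H (Suc n)" for us a b vs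
    proof -
      have "Suc (length us) \<in> {1..n}" using xs by (auto simp: tuples_def)
      then have "transp_act H A l r n (Suc (length us)) \<phi> = \<phi>"
        using sym by (simp add: sym_cochains_def)
      with homogenize_transp_act[OF \<phi> xs] homogenize_closed[OF \<phi>', of "us @ b # a # vs"] xs
      show ?thesis by (simp add: swap_in_tuples)
    qed
    with \<phi> show "\<phi> \<in> carrier (C n) \<and> alternating H A (Suc n) (homogenize \<phi>)"
      by (simp add: alternating_def)
  next
    assume alt: "\<phi> \<in> carrier (C n) \<and> alternating H A (Suc n) (homogenize \<phi>)"
    have "transp_act H A l r n i \<phi> = \<phi>" if i: "i \<in> {1..n}" for i
    proof (rule homogenize_inject[OF transp_act_closed[OF \<phi> i] \<phi>])
      fix xs assume xs: "xs \<in> tuples H (Suc n)"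
      define us a b vs where "us = take (i - 1) xs" and "a = xs ! (i - 1)" and "b = xs ! i"
        and "vs = drop (Suc i) xs"
      have len: "length xs = Suc n" using xs by (simp add: tuples_def)
      have eq: "xs = us @ a # b # vs"
        using id_take_nth_drop[of "i - 1" xs] Cons_nth_drop_Suc[of i xs] len i
        by (cases i) (simp_all add: us_def a_def b_def vs_def)
      have i': "i = Suc (length us)" using i len by (auto simp: us_def)
      show "homogenize (transp_act H A l r n i \<phi>) xs = homogenize \<phi> xs"
        using homogenize_transp_act[OF \<phi>, of us a b vs] alt xs homogenize_closed[OF \<phi>' xs]
        by (simp add: eq i' alternating_def)
    qed
    with \<phi> show "\<phi> \<in> sym_cochains H A l r n" by (simp add: sym_cochains_def)
  qed
qed (simp add: sym_cochains_def)

lemma sym_cochains_swap: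
  "\<phi> \<in> sym_cochains H A l r n \<Longrightarrow> us @ a # b # vs \<in> tuples H (Suc n) \<Longrightarrow>
    homogenize \<phi> (us @ b # a # vs) = \<ominus>\<^bsub>A\<^esub> homogenize \<phi> (us @ a # b # vs)"
  unfolding sym_cochains_iff alternating_def by blast

lemma sym_cochainsI:
  "\<phi> \<in> carrier (C n) \<Longrightarrow>
    (\<And>us a b vs. us @ a # b # vs \<in> tuples H (Suc n) \<Longrightarrow>
      homogenize \<phi> (us @ b # a # vs) = \<ominus>\<^bsub>A\<^esub> homogenize \<phi> (us @ a # b # vs)) \<Longrightarrow>
    \<phi> \<in> sym_cochains H A l r n"
  unfolding sym_cochains_iff alternating_def by blast

subsection \<open>The complex of invariants and its cohomology\<close>

lemma cochain_closed: "\<phi> \<in> carrier (C n) \<Longrightarrow> gs \<in> tuples H n \<Longrightarrow> \<phi> gs \<in> carrier A"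
  by (auto simp: cochains_def)

lemma cochain_Pi: "\<phi> \<in> carrier (C n) \<Longrightarrow> \<phi> \<in> tuples H n \<rightarrow> carrier A"
  by (auto simp: cochains_def)

lemma cochain_eqI:
  "\<phi> \<in> carrier (C n) \<Longrightarrow> \<psi> \<in> carrier (C n) \<Longrightarrow> (\<And>gs. gs \<in> tuples H n \<Longrightarrow> \<phi> gs = \<psi> gs) \<Longrightarrow> \<phi> = \<psi>"
  by (auto simp: cochains_def intro: PiE_ext)

lemma mult_cochains: "gs \<in> tuples H n \<Longrightarrow> (\<phi> \<otimes>\<^bsub>C n\<^esub> \<psi>) gs = \<phi> gs \<oplus>\<^bsub>A\<^esub> \<psi> gs"
  by (simp add: cochains_def)

lemma one_cochains: "gs \<in> tuples H n \<Longrightarrow> \<one>\<^bsub>C n\<^esub> gs = \<zero>\<^bsub>A\<^esub>"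
  by (simp add: cochains_def)

lemma comm_group_cochains: "comm_group (C n)"
proof (rule comm_groupI)
  fix \<phi> assume \<phi>: "\<phi> \<in> carrier (C n)"
  let ?\<psi> = "\<lambda>gs\<in>tuples H n. \<ominus>\<^bsub>A\<^esub> \<phi> gs"
  have "?\<psi> \<in> carrier (C n)" "?\<psi> \<otimes>\<^bsub>C n\<^esub> \<phi> = \<one>\<^bsub>C n\<^esub>"
    using \<phi> by (auto simp: cochains_def PiE_iff A.l_neg intro!: restrict_ext)
  then show "\<exists>\<psi>\<in>carrier (C n). \<psi> \<otimes>\<^bsub>C n\<^esub> \<phi> = \<one>\<^bsub>C n\<^esub>" by blast
  show "\<one>\<^bsub>C n\<^esub> \<otimes>\<^bsub>C n\<^esub> \<phi> = \<phi>"
    using \<phi> by (auto simp: cochains_def PiE_iff extensional_def)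
qed (auto simp: cochains_def PiE_iff A.a_ac intro!: restrict_ext)

sublocale C: comm_group "C n" for n
  by (rule comm_group_cochains)

lemma homogenize_mult:
  assumes "\<phi> \<in> carrier (C n)" "\<psi> \<in> carrier (C n)" "xs \<in> tuples H (Suc n)"
  shows "homogenize (\<phi> \<otimes>\<^bsub>C n\<^esub> \<psi>) xs = homogenize \<phi> xs \<oplus>\<^bsub>A\<^esub> homogenize \<psi> xs"
  using assms H.quotients_closed[OF assms(3)] hd_last_closed[OF assms(3)]
  by (simp add: homogenize_def mult_cochains l_add r_add r_closed cochain_closed)

lemma homogenize_one:
  assumes "xs \<in> tuples H (Suc n)" shows "homogenize \<one>\<^bsub>C n\<^esub> xs = \<zero>\<^bsub>A\<^esub>"
proof -
  have "homogenize \<one>\<^bsub>C n\<^esub> xs \<in> carrier A"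
    by (rule homogenize_closed[OF cochain_Pi[OF C.one_closed] assms])
  moreover have "homogenize \<one>\<^bsub>C n\<^esub> xs = homogenize \<one>\<^bsub>C n\<^esub> xs \<oplus>\<^bsub>A\<^esub> homogenize \<one>\<^bsub>C n\<^esub> xs"
    using homogenize_mult[OF C.one_closed C.one_closed assms] by simp
  ultimately show ?thesis by (metis A.add.l_cancel_one)
qed

lemma homogenize_inv:
  assumes "\<phi> \<in> carrier (C n)" "xs \<in> tuples H (Suc n)"
  shows "homogenize (inv\<^bsub>C n\<^esub> \<phi>) xs = \<ominus>\<^bsub>A\<^esub> homogenize \<phi> xs"
  using homogenize_mult[OF C.inv_closed[OF assms(1)] assms] homogenize_one[OF assms(2)] assms(1)
    homogenize_closed[OF cochain_Pi[OF assms(1)] assms(2)]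
    homogenize_closed[OF cochain_Pi[OF C.inv_closed[OF assms(1)]] assms(2)]
  by (intro A.minus_equality[symmetric]) simp_all

lemma coboundary_hom: "group_hom (C n) (C (Suc n)) (\<delta> n)"
proof (unfold_locales, rule homI)
  fix \<phi> \<psi> assume \<phi>: "\<phi> \<in> carrier (C n)" and \<psi>: "\<psi> \<in> carrier (C n)"
  show "\<delta> n (\<phi> \<otimes>\<^bsub>C n\<^esub> \<psi>) = \<delta> n \<phi> \<otimes>\<^bsub>C (Suc n)\<^esub> \<delta> n \<psi>"
  proof (rule homogenize_inject)
    fix xs assume xs: "xs \<in> tuples H (Suc (Suc n))"
    note c = homogenize_closed[OF cochain_Pi]
    have "homogenize (\<delta> n (\<phi> \<otimes>\<^bsub>C n\<^esub> \<psi>)) xs = alt_diff A (homogenize (\<phi> \<otimes>\<^bsub>C n\<^esub> \<psi>)) xs"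
      using \<phi> \<psi> xs by (simp add: homogenize_coboundary)
    also have "\<dots> = alt_diff A (\<lambda>ys. homogenize \<phi> ys \<oplus>\<^bsub>A\<^esub> homogenize \<psi> ys) xs"
      using \<phi> \<psi> xs by (intro A.alt_diff_cong[of H "Suc n"]) (simp_all add: homogenize_mult)
    also have "\<dots> = alt_diff A (homogenize \<phi>) xs \<oplus>\<^bsub>A\<^esub> alt_diff A (homogenize \<psi>) xs"
      using \<phi> \<psi> xs c by (intro A.alt_diff_add[of _ H "Suc n"]) auto
    also have "\<dots> = homogenize (\<delta> n \<phi> \<otimes>\<^bsub>C (Suc n)\<^esub> \<delta> n \<psi>) xs"
      using \<phi> \<psi> xs by (simp add: homogenize_mult homogenize_coboundary coboundary_closed)
    finally show "homogenize (\<delta> n (\<phi> \<otimes>\<^bsub>C n\<^esub> \<psi>)) xs = homogenize (\<delta> n \<phi> \<otimes>\<^bsub>C (Suc n)\<^esub> \<delta> n \<psi>) xs" .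
  qed (use \<phi> \<psi> in \<open>simp_all add: coboundary_closed\<close>)
qed (rule coboundary_closed)

lemma coboundary_coboundary:
  assumes "\<phi> \<in> carrier (C n)" shows "\<delta> (Suc n) (\<delta> n \<phi>) = \<one>\<^bsub>C (Suc (Suc n))\<^esub>"
proof (rule homogenize_inject)
  fix xs assume xs: "xs \<in> tuples H (Suc (Suc (Suc n)))"
  have "homogenize (\<delta> (Suc n) (\<delta> n \<phi>)) xs = alt_diff A (homogenize (\<delta> n \<phi>)) xs"
    using assms xs by (simp add: homogenize_coboundary coboundary_closed)
  also have "\<dots> = alt_diff A (alt_diff A (homogenize \<phi>)) xs"
    using assms xs by (intro A.alt_diff_cong[of H "Suc (Suc n)"]) (simp_all add: homogenize_coboundary)
  also have "\<dots> = \<zero>\<^bsub>A\<^esub>"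
    using assms xs homogenize_closed[OF cochain_Pi] by (intro A.alt_diff_square[of _ H "Suc n"]) auto
  finally show "homogenize (\<delta> (Suc n) (\<delta> n \<phi>)) xs = homogenize \<one>\<^bsub>C (Suc (Suc n))\<^esub> xs"
    using xs by (simp add: homogenize_one)
qed (use assms in \<open>simp_all add: coboundary_closed\<close>)

lemma coboundary_sym_cochains:
  assumes "\<phi> \<in> sym_cochains H A l r n" shows "\<delta> n \<phi> \<in> sym_cochains H A l r (Suc n)"
proof -
  have \<phi>: "\<phi> \<in> carrier (C n)" "alternating H A (Suc n) (homogenize \<phi>)"
    using assms by (simp_all add: sym_cochains_iff)
  then have "alternating H A (Suc (Suc n)) (alt_diff A (homogenize \<phi>))"
    using homogenize_closed[OF cochain_Pi] by (intro A.alternating_alt_diff) auto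
  with \<phi> show ?thesis
    using alternating_cong[of H "Suc (Suc n)" "homogenize (\<delta> n \<phi>)" "alt_diff A (homogenize \<phi>)" A]
    by (simp add: sym_cochains_iff coboundary_closed homogenize_coboundary)
qed

lemma subgroup_sym_cochains: "subgroup (sym_cochains H A l r n) (C n)"
proof
  fix \<phi> \<psi> assume \<phi>: "\<phi> \<in> sym_cochains H A l r n" and \<psi>: "\<psi> \<in> sym_cochains H A l r n"
  have "homogenize (\<phi> \<otimes>\<^bsub>C n\<^esub> \<psi>) (us @ b # a # vs) = \<ominus>\<^bsub>A\<^esub> homogenize (\<phi> \<otimes>\<^bsub>C n\<^esub> \<psi>) (us @ a # b # vs)"
    if xs: "us @ a # b # vs \<in> tuples H (Suc n)" for us a b vs
  proof -
    have swap: "homogenize \<chi> (us @ b # a # vs) = \<ominus>\<^bsub>A\<^esub> homogenize \<chi> (us @ a # b # vs)"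
      and c: "\<chi> \<in> carrier (C n)" "homogenize \<chi> (us @ a # b # vs) \<in> carrier A"
      if "\<chi> \<in> sym_cochains H A l r n" for \<chi>
      using that xs sym_cochains_swap[OF that xs] homogenize_closed[OF cochain_Pi[of \<chi> n] xs]
      by (simp_all add: sym_cochains_iff)
    show ?thesis
      using c[OF \<phi>] c[OF \<psi>] xs
      by (simp add: homogenize_mult swap_in_tuples swap[OF \<phi>] swap[OF \<psi>] A.minus_add)
  qed
  with \<phi> \<psi> show "\<phi> \<otimes>\<^bsub>C n\<^esub> \<psi> \<in> sym_cochains H A l r n"
    by (intro sym_cochainsI) (simp_all add: sym_cochains_iff)
next
  fix \<phi> assume \<phi>: "\<phi> \<in> sym_cochains H A l r n"
  have "homogenize (inv\<^bsub>C n\<^esub> \<phi>) (us @ b # a # vs) = \<ominus>\<^bsub>A\<^esub> homogenize (inv\<^bsub>C n\<^esub> \<phi>) (us @ a # b # vs)"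
    if xs: "us @ a # b # vs \<in> tuples H (Suc n)" for us a b vs
    using \<phi> xs homogenize_inv[of \<phi> n "us @ b # a # vs"] homogenize_inv[OF _ xs, of \<phi>]
      sym_cochains_swap[OF \<phi> xs]
    by (simp add: swap_in_tuples sym_cochains_iff)
  with \<phi> show "inv\<^bsub>C n\<^esub> \<phi> \<in> sym_cochains H A l r n"
    by (intro sym_cochainsI) (simp_all add: sym_cochains_iff)
next
  show "\<one>\<^bsub>C n\<^esub> \<in> sym_cochains H A l r n"
    by (intro sym_cochainsI) (simp_all add: homogenize_one swap_in_tuples A.neg_zero)
qed (simp add: sym_cochains_def subset_iff)

lemma sym_cocycles_eq: "sym_cocycles H A l r n = sym_cochains H A l r n \<inter> kernel (C n) (C (Suc n)) (\<delta> n)"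
  by (auto simp: sym_cocycles_def kernel_def sym_cochains_def)

lemma subgroup_sym_cocycles: "subgroup (sym_cocycles H A l r n) (C n)"
  unfolding sym_cocycles_eq
  by (intro C.subgroups_Inter_pair subgroup_sym_cochains group_hom.subgroup_kernel coboundary_hom)

lemma subgroup_sym_coboundaries: "subgroup (sym_coboundaries H A l r n) (C n)"
proof (cases n)
  case 0
  then show ?thesis using C.triv_subgroup[of 0] by (simp add: sym_coboundaries_def)
next
  case (Suc m)
  then show ?thesis
    using group_hom.subgroup_img_is_subgroup[OF coboundary_hom subgroup_sym_cochains]
    by (simp add: sym_coboundaries_def)
qed

lemma coboundary_sym_cocycles:
  "\<phi> \<in> sym_cochains H A l r n \<Longrightarrow> \<delta> n \<phi> \<in> sym_cocycles H A l r (Suc n)"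
  using coboundary_sym_cochains[of \<phi> n] coboundary_coboundary[of \<phi> n]
  by (simp add: sym_cocycles_def sym_cochains_def)

lemma sym_coboundaries_subset: "sym_coboundaries H A l r n \<subseteq> sym_cocycles H A l r n"
  using subgroup.one_closed[OF subgroup_sym_cocycles[of 0]] coboundary_sym_cocycles
  by (auto simp: sym_coboundaries_def split: nat.splits)

lemma comm_group_sym_cocycles: "comm_group (C n\<lparr>carrier := sym_cocycles H A l r n\<rparr>)"
proof -
  interpret Z: group "C n\<lparr>carrier := sym_cocycles H A l r n\<rparr>"
    by (rule C.subgroup_imp_group[OF subgroup_sym_cocycles])
  show ?thesis
    using subgroup.subset[OF subgroup_sym_cocycles, of n]
    by (intro Z.group_comm_groupI) (auto simp: C.m_comm subset_iff)
qed

lemma subgroup_coboundaries_cocycles: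
  "subgroup (sym_coboundaries H A l r n) (C n\<lparr>carrier := sym_cocycles H A l r n\<rparr>)"
  by (rule C.subgroup_incl[OF subgroup_sym_coboundaries subgroup_sym_cocycles sym_coboundaries_subset])

lemma sym_class_eq:
  "sym_class H A l r n \<phi> = sym_coboundaries H A l r n #>\<^bsub>C n\<lparr>carrier := sym_cocycles H A l r n\<rparr>\<^esub> \<phi>"
  by (simp add: sym_class_def r_coset_def)

lemma carrier_sym_cohomology:
  "carrier (sym_cohomology H A l r n) = sym_class H A l r n ` sym_cocycles H A l r n"
  by (auto simp: sym_cohomology_def FactGroup_def RCOSETS_def sym_class_eq)

end

section \<open>Homomorphisms of cohomology groups\<close>

text \<open>A connecting map is multiplicative only up to coboundaries, whence the form of the last
  hypothesis. As \<open>f\<close> carries \<open>N\<close> to \<open>N'\<close>, the elements of one coset of \<open>N\<close> have images in one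
  coset of \<open>N'\<close>, so that the union below is a single coset.\<close>

lemma quotient_map:
  fixes D (structure) and D' (structure)
  assumes D: "comm_group D" "subgroup N D" and D': "comm_group D'" "subgroup N' D'"
    and f: "f \<in> carrier D \<rightarrow> carrier D'" and fN: "f ` N \<subseteq> N'"
    and mult: "\<And>a b. a \<in> carrier D \<Longrightarrow> b \<in> carrier D \<Longrightarrow>
      f (a \<otimes>\<^bsub>D\<^esub> b) \<in> N' #>\<^bsub>D'\<^esub> (f a \<otimes>\<^bsub>D'\<^esub> f b)"
  shows quotient_map_class:
      "\<phi> \<in> carrier D \<Longrightarrow> (\<Union>\<psi>\<in>N #>\<^bsub>D\<^esub> \<phi>. N' #>\<^bsub>D'\<^esub> f \<psi>) = N' #>\<^bsub>D'\<^esub> f \<phi>"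
    and quotient_map_hom:
      "group_hom (D Mod N) (D' Mod N') (\<lambda>c. \<Union>\<psi>\<in>c. N' #>\<^bsub>D'\<^esub> f \<psi>)"
proof -
  interpret D: comm_group D by (rule D)
  interpret D': comm_group D' by (rule D')
  interpret N: normal N D by (rule D.subgroup_imp_normal[OF D(2)])
  interpret N': normal N' D' by (rule D'.subgroup_imp_normal[OF D'(2)])
  have cl: "(\<Union>\<psi>\<in>N #>\<^bsub>D\<^esub> \<phi>. N' #>\<^bsub>D'\<^esub> f \<psi>) = N' #>\<^bsub>D'\<^esub> f \<phi>" if \<phi>: "\<phi> \<in> carrier D" for \<phi>
  proof -
    have "N' #>\<^bsub>D'\<^esub> f \<psi> = N' #>\<^bsub>D'\<^esub> f \<phi>" if \<psi>: "\<psi> \<in> N #>\<^bsub>D\<^esub> \<phi>" for \<psi>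
    proof -
      obtain \<nu> where \<nu>: "\<nu> \<in> N" "\<psi> = \<nu> \<otimes>\<^bsub>D\<^esub> \<phi>" using \<psi> by (auto simp: r_coset_def)
      have fc: "f \<phi> \<in> carrier D'" "f \<nu> \<in> carrier D'" "f \<nu> \<in> N'" using f fN \<phi> \<nu> N.subset by auto
      have "f \<psi> \<in> N' #>\<^bsub>D'\<^esub> (f \<nu> \<otimes>\<^bsub>D'\<^esub> f \<phi>)" using mult[of \<nu> \<phi>] \<nu> \<phi> N.subset by auto
      then have "N' #>\<^bsub>D'\<^esub> f \<psi> = N' #>\<^bsub>D'\<^esub> (f \<nu> \<otimes>\<^bsub>D'\<^esub> f \<phi>)"
        using fc D'.repr_independence[OF _ _ D'(2)] by simp
      also have "\<dots> = (N' #>\<^bsub>D'\<^esub> f \<nu>) #>\<^bsub>D'\<^esub> f \<phi>"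
        using fc N'.subset by (simp add: D'.coset_mult_assoc)
      also have "N' #>\<^bsub>D'\<^esub> f \<nu> = N'" using fc D'(2) by (intro D'.coset_join2)
      finally show ?thesis .
    qed
    then show ?thesis by (intro UN_constant_eq[OF D.rcos_self[OF \<phi> D(2)]] ballI)
  qed
  show "\<phi> \<in> carrier D \<Longrightarrow> (\<Union>\<psi>\<in>N #>\<^bsub>D\<^esub> \<phi>. N' #>\<^bsub>D'\<^esub> f \<psi>) = N' #>\<^bsub>D'\<^esub> f \<phi>" by (rule cl)
  show "group_hom (D Mod N) (D' Mod N') (\<lambda>c. \<Union>\<psi>\<in>c. N' #>\<^bsub>D'\<^esub> f \<psi>)"
  proof (intro group_hom.intro group_hom_axioms.intro homI N.factorgroup_is_group N'.factorgroup_is_group)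
    fix c assume "c \<in> carrier (D Mod N)"
    then obtain a where "a \<in> carrier D" "c = N #>\<^bsub>D\<^esub> a" by (auto simp: FactGroup_def RCOSETS_def)
    then show "(\<Union>\<psi>\<in>c. N' #>\<^bsub>D'\<^esub> f \<psi>) \<in> carrier (D' Mod N')"
      using f by (auto simp: cl FactGroup_def RCOSETS_def)
  next
    fix c d assume "c \<in> carrier (D Mod N)" "d \<in> carrier (D Mod N)"
    then obtain a b where ab: "a \<in> carrier D" "c = N #>\<^bsub>D\<^esub> a" "b \<in> carrier D" "d = N #>\<^bsub>D\<^esub> b"
      by (auto simp: FactGroup_def RCOSETS_def)
    have fc: "f a \<in> carrier D'" "f b \<in> carrier D'" using ab f by auto
    have "(\<Union>\<psi>\<in>c \<otimes>\<^bsub>D Mod N\<^esub> d. N' #>\<^bsub>D'\<^esub> f \<psi>) = N' #>\<^bsub>D'\<^esub> f (a \<otimes>\<^bsub>D\<^esub> b)"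
      using ab by (simp add: FactGroup_def N.rcos_sum cl)
    also have "\<dots> = N' #>\<^bsub>D'\<^esub> (f a \<otimes>\<^bsub>D'\<^esub> f b)"
      using mult[of a b] ab fc D'.repr_independence[OF _ _ D'(2)] by simp
    finally show "(\<Union>\<psi>\<in>c \<otimes>\<^bsub>D Mod N\<^esub> d. N' #>\<^bsub>D'\<^esub> f \<psi>)
        = (\<Union>\<psi>\<in>c. N' #>\<^bsub>D'\<^esub> f \<psi>) \<otimes>\<^bsub>D' Mod N'\<^esub> (\<Union>\<psi>\<in>d. N' #>\<^bsub>D'\<^esub> f \<psi>)"
      using ab fc by (simp add: cl FactGroup_def N'.rcos_sum)
  qed
qed

lemma cohomology_map:
  assumes S: "group_bimodule H A l r" and T: "group_bimodule K B l' r'"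
    and f: "f \<in> sym_cocycles H A l r n \<rightarrow> sym_cocycles K B l' r' m"
    and fB: "f ` sym_coboundaries H A l r n \<subseteq> sym_coboundaries K B l' r' m"
    and mult: "\<And>\<phi> \<psi>. \<phi> \<in> sym_cocycles H A l r n \<Longrightarrow> \<psi> \<in> sym_cocycles H A l r n \<Longrightarrow>
      f (\<phi> \<otimes>\<^bsub>cochains H A n\<^esub> \<psi>) \<in> sym_class K B l' r' m (f \<phi> \<otimes>\<^bsub>cochains K B m\<^esub> f \<psi>)"
  shows cohomology_map_class: "\<phi> \<in> sym_cocycles H A l r n \<Longrightarrow>
      (\<Union>\<psi>\<in>sym_class H A l r n \<phi>. sym_class K B l' r' m (f \<psi>)) = sym_class K B l' r' m (f \<phi>)"
    and cohomology_map_hom: "group_hom (sym_cohomology H A l r n) (sym_cohomology K B l' r' m)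
      (\<lambda>c. \<Union>\<psi>\<in>c. sym_class K B l' r' m (f \<psi>))"
proof -
  interpret S: group_bimodule H A l r by (rule S)
  interpret T: group_bimodule K B l' r' by (rule T)
  note q = S.comm_group_sym_cocycles S.subgroup_coboundaries_cocycles
    T.comm_group_sym_cocycles T.subgroup_coboundaries_cocycles
  show "\<phi> \<in> sym_cocycles H A l r n \<Longrightarrow>
      (\<Union>\<psi>\<in>sym_class H A l r n \<phi>. sym_class K B l' r' m (f \<psi>)) = sym_class K B l' r' m (f \<phi>)"
    unfolding S.sym_class_eq T.sym_class_eq
    using f fB mult[unfolded T.sym_class_eq] by (intro quotient_map_class q) auto
  show "group_hom (sym_cohomology H A l r n) (sym_cohomology K B l' r' m)
      (\<lambda>c. \<Union>\<psi>\<in>c. sym_class K B l' r' m (f \<psi>))"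
    unfolding T.sym_class_eq sym_cohomology_def
    using f fB mult[unfolded T.sym_class_eq] by (intro quotient_map_hom q) auto
qed

subsection \<open>Maps of cochains that are pointwise on homogeneous cochains\<close>

text \<open>Here \<open>f\<close> is described by what it does to homogeneous forms, namely restriction to tuples of
  \<open>K\<close> followed by \<open>u\<close>. Coefficient maps and the projection to a centralizer are both of this kind.
  So is the section of an extension, for which \<open>u\<close> is odd instead of additive.\<close>

locale pointwise_cochain_map =
  S: group_bimodule H A l r + T: group_bimodule K B l' r'
  for H :: "('g, 'n) monoid_scheme" and A :: "('a, 'm) ring_scheme" and l r
    and K :: "('g, 'o) monoid_scheme" and B :: "('b, 'p) ring_scheme" and l' r' +
  fixes u :: "'a \<Rightarrow> 'b" and f :: "nat \<Rightarrow> ('g list \<Rightarrow> 'a) \<Rightarrow> 'g list \<Rightarrow> 'b"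
  assumes carrier_subset: "carrier K \<subseteq> carrier H"
    and u_closed: "a \<in> carrier A \<Longrightarrow> u a \<in> carrier B"
    and f_closed: "\<phi> \<in> carrier (cochains H A n) \<Longrightarrow> f n \<phi> \<in> carrier (cochains K B n)"
    and homogenize_f: "\<phi> \<in> carrier (cochains H A n) \<Longrightarrow> xs \<in> tuples K (Suc n) \<Longrightarrow>
      T.homogenize (f n \<phi>) xs = u (S.homogenize \<phi> xs)"
begin

lemma tuples_subset: "xs \<in> tuples K n \<Longrightarrow> xs \<in> tuples H n"
  using carrier_subset by (auto simp: tuples_def)

end

locale odd_cochain_map = pointwise_cochain_map +
  assumes u_minus: "a \<in> carrier A \<Longrightarrow> u (\<ominus>\<^bsub>A\<^esub> a) = \<ominus>\<^bsub>B\<^esub> u a"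
begin

lemma f_sym:
  assumes \<phi>: "\<phi> \<in> sym_cochains H A l r n" shows "f n \<phi> \<in> sym_cochains K B l' r' n"
proof (rule T.sym_cochainsI)
  have \<phi>': "\<phi> \<in> carrier (cochains H A n)" using \<phi> by (simp add: sym_cochains_def)
  then show "f n \<phi> \<in> carrier (cochains K B n)" by (rule f_closed)
  fix us a b vs assume xs: "us @ a # b # vs \<in> tuples K (Suc n)"
  show "T.homogenize (f n \<phi>) (us @ b # a # vs) = \<ominus>\<^bsub>B\<^esub> T.homogenize (f n \<phi>) (us @ a # b # vs)"
    using xs \<phi>' S.sym_cochains_swap[OF \<phi> tuples_subset[OF xs]]
      S.homogenize_closed[OF S.cochain_Pi[OF \<phi>'] tuples_subset[OF xs]]
    by (simp add: homogenize_f swap_in_tuples u_minus)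
qed

end

locale cochain_map = pointwise_cochain_map +
  assumes u_add: "a \<in> carrier A \<Longrightarrow> b \<in> carrier A \<Longrightarrow> u (a \<oplus>\<^bsub>A\<^esub> b) = u a \<oplus>\<^bsub>B\<^esub> u b"
begin

lemma u_hom: "u \<in> hom (add_monoid A) (add_monoid B)"
  using u_closed u_add by (auto simp: hom_def)

sublocale odd_cochain_map
proof
  interpret u: group_hom "add_monoid A" "add_monoid B" u
    using u_hom S.A.a_group T.A.a_group by (simp add: group_hom_def group_hom_axioms_def)
  show "u (\<ominus>\<^bsub>A\<^esub> a) = \<ominus>\<^bsub>B\<^esub> u a" if "a \<in> carrier A" for a
    using that u.hom_inv[of a] by (simp add: a_inv_def)
qed

lemma f_hom: "group_hom (cochains H A n) (cochains K B n) (f n)"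
proof (unfold_locales, rule homI)
  fix \<phi> \<psi> assume \<phi>: "\<phi> \<in> carrier (cochains H A n)" and \<psi>: "\<psi> \<in> carrier (cochains H A n)"
  show "f n (\<phi> \<otimes>\<^bsub>cochains H A n\<^esub> \<psi>) = f n \<phi> \<otimes>\<^bsub>cochains K B n\<^esub> f n \<psi>"
  proof (rule T.homogenize_inject)
    fix xs assume xs: "xs \<in> tuples K (Suc n)"
    note xs' = tuples_subset[OF xs]
    show "T.homogenize (f n (\<phi> \<otimes>\<^bsub>cochains H A n\<^esub> \<psi>)) xs
        = T.homogenize (f n \<phi> \<otimes>\<^bsub>cochains K B n\<^esub> f n \<psi>) xs"
      using \<phi> \<psi> xs xs' S.homogenize_closed[OF S.cochain_Pi[OF \<phi>] xs'] S.homogenize_closed[OF S.cochain_Pi[OF \<psi>] xs']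
      by (simp add: homogenize_f f_closed T.homogenize_mult S.homogenize_mult u_add)
  qed (use \<phi> \<psi> in \<open>simp_all add: f_closed\<close>)
qed (rule f_closed)

lemma f_one: "f n \<one>\<^bsub>cochains H A n\<^esub> = \<one>\<^bsub>cochains K B n\<^esub>"
  by (rule group_hom.hom_one[OF f_hom])

lemma f_coboundary:
  assumes \<phi>: "\<phi> \<in> carrier (cochains H A n)"
  shows "f (Suc n) (coboundary H A l r n \<phi>) = coboundary K B l' r' n (f n \<phi>)"
proof (rule T.homogenize_inject)
  fix xs assume xs: "xs \<in> tuples K (Suc (Suc n))"
  note xs' = tuples_subset[OF xs]
  have F: "S.homogenize \<phi> \<in> tuples H (Suc n) \<rightarrow> carrier A"
    using S.homogenize_closed[OF S.cochain_Pi[OF \<phi>]] by blast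
  have "T.homogenize (f (Suc n) (coboundary H A l r n \<phi>)) xs = u (alt_diff A (S.homogenize \<phi>) xs)"
    using \<phi> xs xs' by (simp add: homogenize_f S.coboundary_closed S.homogenize_coboundary)
  also have "\<dots> = alt_diff B (\<lambda>ys. u (S.homogenize \<phi> ys)) xs"
    by (rule S.A.alt_diff_hom[OF carrier_subset T.A.abelian_group_axioms u_hom F xs', symmetric])
  also have "\<dots> = alt_diff B (T.homogenize (f n \<phi>)) xs"
    using \<phi> xs by (intro T.A.alt_diff_cong[of K "Suc n"]) (simp_all add: homogenize_f)
  also have "\<dots> = T.homogenize (coboundary K B l' r' n (f n \<phi>)) xs"
    using \<phi> xs by (simp add: T.homogenize_coboundary f_closed)
  finally show "T.homogenize (f (Suc n) (coboundary H A l r n \<phi>)) xs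
    = T.homogenize (coboundary K B l' r' n (f n \<phi>)) xs" .
qed (use \<phi> in \<open>simp_all add: f_closed S.coboundary_closed T.coboundary_closed\<close>)

lemma f_cocycle: "\<phi> \<in> sym_cocycles H A l r n \<Longrightarrow> f n \<phi> \<in> sym_cocycles K B l' r' n"
  using f_coboundary[of \<phi> n] f_one[of "Suc n"] f_sym[of \<phi> n]
  by (simp add: sym_cocycles_def sym_cochains_def)

lemma f_coboundaries: "f n ` sym_coboundaries H A l r n \<subseteq> sym_coboundaries K B l' r' n"
proof (cases n)
  case 0
  then show ?thesis using f_one[of 0] by (simp add: sym_coboundaries_def)
next
  case (Suc m)
  have "f (Suc m) (coboundary H A l r m \<phi>) \<in> coboundary K B l' r' m ` sym_cochains K B l' r' m"
    if "\<phi> \<in> sym_cochains H A l r m" for \<phi>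
    using that f_sym[OF that] f_coboundary[of \<phi> m] by (simp add: sym_cochains_def)
  then show ?thesis using Suc by (auto simp: sym_coboundaries_def)
qed

lemma f_mult_class:
  assumes "\<phi> \<in> sym_cocycles H A l r n" "\<psi> \<in> sym_cocycles H A l r n"
  shows "f n (\<phi> \<otimes>\<^bsub>cochains H A n\<^esub> \<psi>) \<in> sym_class K B l' r' n (f n \<phi> \<otimes>\<^bsub>cochains K B n\<^esub> f n \<psi>)"
proof -
  have c: "\<phi> \<in> carrier (cochains H A n)" "\<psi> \<in> carrier (cochains H A n)"
    using assms subgroup.subset[OF S.subgroup_sym_cocycles] by blast+
  have "f n (\<phi> \<otimes>\<^bsub>cochains H A n\<^esub> \<psi>) = f n \<phi> \<otimes>\<^bsub>cochains K B n\<^esub> f n \<psi>"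
    by (rule group_hom.hom_mult[OF f_hom c])
  then show ?thesis
    unfolding sym_class_def
    using c by (simp add: f_closed T.C.rcos_self[OF _ T.subgroup_sym_coboundaries])
qed

lemma induced_class:
  "\<phi> \<in> sym_cocycles H A l r n \<Longrightarrow>
    (\<Union>\<psi>\<in>sym_class H A l r n \<phi>. sym_class K B l' r' n (f n \<psi>)) = sym_class K B l' r' n (f n \<phi>)"
  using f_cocycle f_coboundaries f_mult_class
  by (intro cohomology_map_class S.group_bimodule_axioms T.group_bimodule_axioms) auto

lemma induced_hom:
  "group_hom (sym_cohomology H A l r n) (sym_cohomology K B l' r' n)
    (\<lambda>c. \<Union>\<psi>\<in>c. sym_class K B l' r' n (f n \<psi>))"
  using f_cocycle f_coboundaries f_mult_class
  by (intro cohomology_map_hom S.group_bimodule_axioms T.group_bimodule_axioms) auto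

end

lemma coefficient_cochain_map:
  assumes S: "group_bimodule H A l r" and T: "group_bimodule H B l' r'"
    and u: "\<And>a. a \<in> carrier A \<Longrightarrow> u a \<in> carrier B"
    and l: "\<And>g a. g \<in> carrier H \<Longrightarrow> a \<in> carrier A \<Longrightarrow> u (l g a) = l' g (u a)"
    and r: "\<And>g a. g \<in> carrier H \<Longrightarrow> a \<in> carrier A \<Longrightarrow> u (r g a) = r' g (u a)"
  shows "pointwise_cochain_map H A l r H B l' r' u (\<lambda>n. compose (tuples H n) u)"
proof -
  interpret S: group_bimodule H A l r by (rule S)
  interpret T: group_bimodule H B l' r' by (rule T)
  show ?thesis
  proof
    fix n \<phi> xs assume \<phi>: "\<phi> \<in> carrier (cochains H A n)" and xs: "xs \<in> tuples H (Suc n)"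
    show "T.homogenize (compose (tuples H n) u \<phi>) xs = u (S.homogenize \<phi> xs)"
      using S.H.quotients_closed[OF xs] S.hd_last_closed[OF xs] S.cochain_closed[OF \<phi>]
      by (simp add: S.homogenize_def T.homogenize_def compose_def l r S.r_closed)
  qed (use u in \<open>auto simp: cochains_def compose_def\<close>)
qed

section \<open>The connecting homomorphism of an extension with an odd equivariant section\<close>

text \<open>The map \<open>s\<close> is a section of \<open>p\<close> as a map of sets; on the kernel of \<open>p\<close>, which is the image of
  \<open>i\<close>, the map \<open>q\<close> is the inverse of \<open>i\<close>.\<close>

locale odd_split_extension =
  A1: group_bimodule H A1 l1 r1 + A2: group_bimodule H A2 l2 r2 + A3: group_bimodule H A3 l3 r3
  for H :: "('g, 'n) monoid_scheme" and A1 :: "('a, 'm) ring_scheme" and l1 r1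
    and A2 :: "('b, 'o) ring_scheme" and l2 r2 and A3 :: "('c, 'p) ring_scheme" and l3 r3 +
  fixes i :: "'a \<Rightarrow> 'b" and p :: "'b \<Rightarrow> 'c" and s :: "'c \<Rightarrow> 'b" and q :: "'b \<Rightarrow> 'a"
  assumes i_closed: "a \<in> carrier A1 \<Longrightarrow> i a \<in> carrier A2"
    and p_closed: "b \<in> carrier A2 \<Longrightarrow> p b \<in> carrier A3"
    and s_closed: "c \<in> carrier A3 \<Longrightarrow> s c \<in> carrier A2"
    and i_add: "a \<in> carrier A1 \<Longrightarrow> a' \<in> carrier A1 \<Longrightarrow> i (a \<oplus>\<^bsub>A1\<^esub> a') = i a \<oplus>\<^bsub>A2\<^esub> i a'"
    and p_add: "b \<in> carrier A2 \<Longrightarrow> b' \<in> carrier A2 \<Longrightarrow> p (b \<oplus>\<^bsub>A2\<^esub> b') = p b \<oplus>\<^bsub>A3\<^esub> p b'"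
    and s_minus: "c \<in> carrier A3 \<Longrightarrow> s (\<ominus>\<^bsub>A3\<^esub> c) = \<ominus>\<^bsub>A2\<^esub> s c"
    and p_s: "c \<in> carrier A3 \<Longrightarrow> p (s c) = c"
    and q_i: "a \<in> carrier A1 \<Longrightarrow> q (i a) = a"
    and exact: "i ` carrier A1 = {b \<in> carrier A2. p b = \<zero>\<^bsub>A3\<^esub>}"
    and i_l: "g \<in> carrier H \<Longrightarrow> a \<in> carrier A1 \<Longrightarrow> i (l1 g a) = l2 g (i a)"
    and i_r: "g \<in> carrier H \<Longrightarrow> a \<in> carrier A1 \<Longrightarrow> i (r1 g a) = r2 g (i a)"
    and p_l: "g \<in> carrier H \<Longrightarrow> b \<in> carrier A2 \<Longrightarrow> p (l2 g b) = l3 g (p b)"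
    and p_r: "g \<in> carrier H \<Longrightarrow> b \<in> carrier A2 \<Longrightarrow> p (r2 g b) = r3 g (p b)"
    and s_l: "g \<in> carrier H \<Longrightarrow> c \<in> carrier A3 \<Longrightarrow> s (l3 g c) = l2 g (s c)"
    and s_r: "g \<in> carrier H \<Longrightarrow> c \<in> carrier A3 \<Longrightarrow> s (r3 g c) = r2 g (s c)"
begin

abbreviation I where "I n \<equiv> compose (tuples H n) i"
abbreviation P where "P n \<equiv> compose (tuples H n) p"
abbreviation S where "S n \<equiv> compose (tuples H n) s"

sublocale I: cochain_map H A1 l1 r1 H A2 l2 r2 i I
  using i_add i_closed i_l i_r
  by (intro cochain_map.intro coefficient_cochain_map cochain_map_axioms.intro
      A1.group_bimodule_axioms A2.group_bimodule_axioms)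

sublocale P: cochain_map H A2 l2 r2 H A3 l3 r3 p P
  using p_add p_closed p_l p_r
  by (intro cochain_map.intro coefficient_cochain_map cochain_map_axioms.intro
      A2.group_bimodule_axioms A3.group_bimodule_axioms)

sublocale S: odd_cochain_map H A3 l3 r3 H A2 l2 r2 s S
  using s_minus s_closed s_l s_r
  by (intro odd_cochain_map.intro coefficient_cochain_map odd_cochain_map_axioms.intro
      A2.group_bimodule_axioms A3.group_bimodule_axioms)

definition connecting :: "nat \<Rightarrow> ('g list \<Rightarrow> 'c) \<Rightarrow> 'g list \<Rightarrow> 'a" where
  "connecting n \<phi> = compose (tuples H (Suc n)) q (A2.\<delta> n (S n \<phi>))"

lemma i_inject: "a \<in> carrier A1 \<Longrightarrow> a' \<in> carrier A1 \<Longrightarrow> i a = i a' \<longleftrightarrow> a = a'"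
  by (metis q_i)

lemma I_inject: "\<theta> \<in> carrier (A1.C n) \<Longrightarrow> \<theta>' \<in> carrier (A1.C n) \<Longrightarrow> I n \<theta> = I n \<theta>' \<Longrightarrow> \<theta> = \<theta>'"
proof (rule A1.cochain_eqI)
  fix gs assume *: "\<theta> \<in> carrier (A1.C n)" "\<theta>' \<in> carrier (A1.C n)" "I n \<theta> = I n \<theta>'" "gs \<in> tuples H n"
  have "i (\<theta> gs) = I n \<theta> gs" using *(4) by (simp add: compose_eq)
  also have "\<dots> = i (\<theta>' gs)" unfolding *(3) using *(4) by (simp add: compose_eq)
  finally have "i (\<theta> gs) = i (\<theta>' gs)" .
  with * show "\<theta> gs = \<theta>' gs" by (simp add: i_inject A1.cochain_closed)
qed

lemma P_S: "\<phi> \<in> carrier (A3.C n) \<Longrightarrow> P n (S n \<phi>) = \<phi>"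
  by (rule A3.cochain_eqI[OF P.f_closed[OF S.f_closed]]) (simp_all add: compose_eq A3.cochain_closed p_s)

text \<open>The symmetric cochains of \<open>A\<^sub>1\<close> are all symmetric cochains of \<open>A\<^sub>2\<close> with values in the
  kernel of \<open>p\<close>: since \<open>i\<close> is injective and odd, the alternating property can be tested after \<open>i\<close>.\<close>

lemma kernel_lift:
  assumes \<chi>: "\<chi> \<in> sym_cochains H A2 l2 r2 n" and ker: "P n \<chi> = \<one>\<^bsub>A3.C n\<^esub>"
  shows "compose (tuples H n) q \<chi> \<in> sym_cochains H A1 l1 r1 n"
    and "I n (compose (tuples H n) q \<chi>) = \<chi>"
proof -
  let ?\<theta> = "compose (tuples H n) q \<chi>"
  have \<chi>': "\<chi> \<in> carrier (A2.C n)" using \<chi> by (simp add: sym_cochains_def)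
  have q: "q (\<chi> gs) \<in> carrier A1 \<and> i (q (\<chi> gs)) = \<chi> gs" if gs: "gs \<in> tuples H n" for gs
  proof -
    have "\<chi> gs \<in> i ` carrier A1"
      using fun_cong[OF ker, of gs] gs A2.cochain_closed[OF \<chi>' gs]
      by (simp add: exact compose_eq A3.one_cochains)
    then show ?thesis using q_i by auto
  qed
  have \<theta>: "?\<theta> \<in> carrier (A1.C n)"
    using q by (simp add: cochains_def compose_def)
  show eq: "I n ?\<theta> = \<chi>"
    using q by (intro A2.cochain_eqI[OF I.f_closed[OF \<theta>] \<chi>']) (simp add: compose_eq)
  show "?\<theta> \<in> sym_cochains H A1 l1 r1 n"
  proof (rule A1.sym_cochainsI[OF \<theta>])
    fix us a b vs assume xs: "us @ a # b # vs \<in> tuples H (Suc n)"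
    let ?F = "A1.homogenize ?\<theta>"
    have c: "?F (us @ a # b # vs) \<in> carrier A1" "?F (us @ b # a # vs) \<in> carrier A1"
      using xs A1.homogenize_closed[OF A1.cochain_Pi[OF \<theta>]] by (simp_all add: swap_in_tuples)
    have "i (?F (us @ b # a # vs)) = \<ominus>\<^bsub>A2\<^esub> i (?F (us @ a # b # vs))"
      using A2.sym_cochains_swap[OF \<chi> xs] I.homogenize_f[OF \<theta>, unfolded eq] xs
      by (simp add: swap_in_tuples)
    then show "?F (us @ b # a # vs) = \<ominus>\<^bsub>A1\<^esub> ?F (us @ a # b # vs)"
      using c I.u_minus[OF c(1)] i_inject[OF c(2) A1.A.a_inv_closed[OF c(1)]] by simp
  qed
qed

lemma connecting_cocycle:
  assumes "\<phi> \<in> sym_cocycles H A3 l3 r3 n"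
  shows "P (Suc n) (A2.\<delta> n (S n \<phi>)) = \<one>\<^bsub>A3.C (Suc n)\<^esub>"
    and "I (Suc n) (connecting n \<phi>) = A2.\<delta> n (S n \<phi>)"
    and "connecting n \<phi> \<in> sym_cocycles H A1 l1 r1 (Suc n)"
proof -
  have \<phi>: "\<phi> \<in> sym_cochains H A3 l3 r3 n" "\<phi> \<in> carrier (A3.C n)" "A3.\<delta> n \<phi> = \<one>\<^bsub>A3.C (Suc n)\<^esub>"
    using assms by (simp_all add: sym_cocycles_def sym_cochains_def)
  have S\<phi>: "S n \<phi> \<in> carrier (A2.C n)" using \<phi> by (simp add: S.f_closed)
  show ker: "P (Suc n) (A2.\<delta> n (S n \<phi>)) = \<one>\<^bsub>A3.C (Suc n)\<^esub>"
    using \<phi> S\<phi> by (simp add: P.f_coboundary P_S)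
  note lift = kernel_lift[OF A2.coboundary_sym_cochains[OF S.f_sym[OF \<phi>(1)]] ker, folded connecting_def]
  show I: "I (Suc n) (connecting n \<phi>) = A2.\<delta> n (S n \<phi>)" by (rule lift)
  have c: "connecting n \<phi> \<in> carrier (A1.C (Suc n))" using lift(1) by (simp add: sym_cochains_def)
  have "A1.\<delta> (Suc n) (connecting n \<phi>) = \<one>\<^bsub>A1.C (Suc (Suc n))\<^esub>"
  proof (rule I_inject[of _ "Suc (Suc n)"])
    show "I (Suc (Suc n)) (A1.\<delta> (Suc n) (connecting n \<phi>)) = I (Suc (Suc n)) \<one>\<^bsub>A1.C (Suc (Suc n))\<^esub>"
      using c S\<phi> by (simp add: I.f_coboundary I I.f_one A2.coboundary_coboundary)
  qed (use c in \<open>simp_all add: A1.coboundary_closed\<close>)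
  with lift(1) show "connecting n \<phi> \<in> sym_cocycles H A1 l1 r1 (Suc n)" by (simp add: sym_cocycles_def)
qed

text \<open>Two symmetric lifts of one cochain differ by \<open>i \<theta>\<close> for a symmetric cochain \<open>\<theta>\<close>, hence the
  preimages of their coboundaries under \<open>i\<close> differ by \<open>\<delta> \<theta>\<close>. Independence of the representative and additivity of
  the connecting map are both instances, for suitable pairs of lifts.\<close>

lemma coboundary_lifts_cohomologous:
  assumes \<chi>: "\<chi> \<in> sym_cochains H A2 l2 r2 n" and \<chi>': "\<chi>' \<in> sym_cochains H A2 l2 r2 n"
    and eq: "P n \<chi> = P n \<chi>'"
    and \<alpha>: "\<alpha> \<in> carrier (A1.C (Suc n))" "I (Suc n) \<alpha> = A2.\<delta> n \<chi>"
    and \<alpha>': "\<alpha>' \<in> carrier (A1.C (Suc n))" "I (Suc n) \<alpha>' = A2.\<delta> n \<chi>'"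
  shows "\<alpha> \<in> sym_class H A1 l1 r1 (Suc n) \<alpha>'"
proof -
  have c: "\<chi> \<in> carrier (A2.C n)" "\<chi>' \<in> carrier (A2.C n)" using \<chi> \<chi>' by (simp_all add: sym_cochains_def)
  define \<omega> where "\<omega> = \<chi> \<otimes>\<^bsub>A2.C n\<^esub> inv\<^bsub>A2.C n\<^esub> \<chi>'"
  have \<omega>: "\<omega> \<in> sym_cochains H A2 l2 r2 n"
    unfolding \<omega>_def using \<chi> \<chi>'
    by (intro subgroup.m_closed[OF A2.subgroup_sym_cochains] subgroup.m_inv_closed[OF A2.subgroup_sym_cochains])
  have \<omega>c: "\<omega> \<in> carrier (A2.C n)" using \<omega> by (simp add: sym_cochains_def)
  have \<chi>eq: "\<omega> \<otimes>\<^bsub>A2.C n\<^esub> \<chi>' = \<chi>"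
    using c by (simp add: \<omega>_def A2.C.m_assoc)
  interpret hom_P: group_hom "A2.C n" "A3.C n" "P n" by (rule P.f_hom)
  interpret d2: group_hom "A2.C n" "A2.C (Suc n)" "A2.\<delta> n" by (rule A2.coboundary_hom)
  interpret hom_I: group_hom "A1.C (Suc n)" "A2.C (Suc n)" "I (Suc n)" by (rule I.f_hom)
  have ker: "P n \<omega> = \<one>\<^bsub>A3.C n\<^esub>"
    using hom_P.hom_mult[OF c(1) A2.C.inv_closed[OF c(2)]] hom_P.hom_inv[OF c(2)] hom_P.hom_closed[OF c(2)] eq
    by (simp add: \<omega>_def)
  define \<theta> where "\<theta> = compose (tuples H n) q \<omega>"
  have \<theta>: "\<theta> \<in> sym_cochains H A1 l1 r1 n" "I n \<theta> = \<omega>"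
    using kernel_lift[OF \<omega> ker] by (simp_all add: \<theta>_def)
  have \<theta>c: "\<theta> \<in> carrier (A1.C n)" using \<theta>(1) by (simp add: sym_cochains_def)
  have "\<alpha> = A1.\<delta> n \<theta> \<otimes>\<^bsub>A1.C (Suc n)\<^esub> \<alpha>'"
  proof (rule I_inject[of _ "Suc n"])
    have "I (Suc n) (A1.\<delta> n \<theta> \<otimes>\<^bsub>A1.C (Suc n)\<^esub> \<alpha>') = A2.\<delta> n \<omega> \<otimes>\<^bsub>A2.C (Suc n)\<^esub> A2.\<delta> n \<chi>'"
      unfolding hom_I.hom_mult[OF A1.coboundary_closed[OF \<theta>c] \<alpha>'(1)] I.f_coboundary[OF \<theta>c] \<theta>(2) \<alpha>'(2) ..
    also have "\<dots> = A2.\<delta> n \<chi>" using d2.hom_mult[OF \<omega>c c(2)] \<chi>eq by simp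
    finally show "I (Suc n) \<alpha> = I (Suc n) (A1.\<delta> n \<theta> \<otimes>\<^bsub>A1.C (Suc n)\<^esub> \<alpha>')" using \<alpha>(2) by (rule trans[rotated, OF sym])
  qed (use \<alpha>(1) \<alpha>'(1) \<theta>c in \<open>auto intro!: A1.C.m_closed A1.coboundary_closed\<close>)
  then show ?thesis
    using \<theta>(1) by (auto simp only: sym_class_def r_coset_def sym_coboundaries_def nat.case)
qed

text \<open>Compare the lifts \<open>s(\<phi> + \<psi>)\<close> and \<open>s \<phi> + s \<psi>\<close> of \<open>\<phi> + \<psi>\<close>.\<close>

lemma connecting_mult:
  assumes \<phi>: "\<phi> \<in> sym_cocycles H A3 l3 r3 n" and \<psi>: "\<psi> \<in> sym_cocycles H A3 l3 r3 n"
  shows "connecting n (\<phi> \<otimes>\<^bsub>A3.C n\<^esub> \<psi>)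
    \<in> sym_class H A1 l1 r1 (Suc n) (connecting n \<phi> \<otimes>\<^bsub>A1.C (Suc n)\<^esub> connecting n \<psi>)"
proof (rule coboundary_lifts_cohomologous)
  have \<phi>\<psi>: "\<phi> \<otimes>\<^bsub>A3.C n\<^esub> \<psi> \<in> sym_cocycles H A3 l3 r3 n"
    using \<phi> \<psi> by (simp add: subgroup.m_closed[OF A3.subgroup_sym_cocycles])
  have sym: "\<chi> \<in> sym_cochains H A3 l3 r3 n" "\<chi> \<in> carrier (A3.C n)" "S n \<chi> \<in> carrier (A2.C n)"
    "connecting n \<chi> \<in> carrier (A1.C (Suc n))"
    if "\<chi> \<in> sym_cocycles H A3 l3 r3 n" for \<chi>
    using that connecting_cocycle(3)[OF that] S.f_closed
    by (auto simp: sym_cocycles_def sym_cochains_def)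
  note c = sym[OF \<phi>] sym[OF \<psi>] sym[OF \<phi>\<psi>]
  show "S n (\<phi> \<otimes>\<^bsub>A3.C n\<^esub> \<psi>) \<in> sym_cochains H A2 l2 r2 n" using c by (intro S.f_sym)
  show "S n \<phi> \<otimes>\<^bsub>A2.C n\<^esub> S n \<psi> \<in> sym_cochains H A2 l2 r2 n"
    using c by (intro subgroup.m_closed[OF A2.subgroup_sym_cochains] S.f_sym)
  show "P n (S n (\<phi> \<otimes>\<^bsub>A3.C n\<^esub> \<psi>)) = P n (S n \<phi> \<otimes>\<^bsub>A2.C n\<^esub> S n \<psi>)"
    using c by (simp add: P_S group_hom.hom_mult[OF P.f_hom])
  show "I (Suc n) (connecting n (\<phi> \<otimes>\<^bsub>A3.C n\<^esub> \<psi>)) = A2.\<delta> n (S n (\<phi> \<otimes>\<^bsub>A3.C n\<^esub> \<psi>))"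
    by (rule connecting_cocycle(2)[OF \<phi>\<psi>])
  show "I (Suc n) (connecting n \<phi> \<otimes>\<^bsub>A1.C (Suc n)\<^esub> connecting n \<psi>) = A2.\<delta> n (S n \<phi> \<otimes>\<^bsub>A2.C n\<^esub> S n \<psi>)"
    using c by (simp add: group_hom.hom_mult[OF I.f_hom] group_hom.hom_mult[OF A2.coboundary_hom]
      connecting_cocycle(2)[OF \<phi>] connecting_cocycle(2)[OF \<psi>])
qed (use assms connecting_cocycle(3) subgroup.m_closed[OF A3.subgroup_sym_cocycles]
    subgroup.subset[OF A1.subgroup_sym_cocycles] in \<open>blast intro: A1.C.m_closed\<close>)+

text \<open>A coboundary \<open>\<phi> = \<delta> \<psi>\<close> also has the lift \<open>\<delta>(s \<psi>)\<close>, whose coboundary vanishes; compare it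
  with \<open>s \<phi>\<close>.\<close>

lemma connecting_coboundaries:
  "connecting n ` sym_coboundaries H A3 l3 r3 n \<subseteq> sym_coboundaries H A1 l1 r1 (Suc n)"
proof
  fix \<alpha> assume "\<alpha> \<in> connecting n ` sym_coboundaries H A3 l3 r3 n"
  then obtain \<phi> where \<phi>: "\<phi> \<in> sym_coboundaries H A3 l3 r3 n" and \<alpha>: "\<alpha> = connecting n \<phi>" by blast
  have \<phi>z: "\<phi> \<in> sym_cocycles H A3 l3 r3 n" using \<phi> A3.sym_coboundaries_subset by blast
  then have \<phi>c: "\<phi> \<in> carrier (A3.C n)" "\<phi> \<in> sym_cochains H A3 l3 r3 n"
    by (auto simp: sym_cocycles_def sym_cochains_def)
  obtain \<chi> where \<chi>: "\<chi> \<in> sym_cochains H A2 l2 r2 n" "P n \<chi> = \<phi>" "A2.\<delta> n \<chi> = \<one>\<^bsub>A2.C (Suc n)\<^esub>"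
  proof (cases n)
    \<comment> \<open>In degree 0 the only coboundary is 0, and its lift 0 has to be compared with \<open>s 0\<close>, which is
      2-torsion but possibly nonzero.\<close>
    case 0
    show thesis
    proof (rule that)
      show "\<one>\<^bsub>A2.C n\<^esub> \<in> sym_cochains H A2 l2 r2 n" by (rule subgroup.one_closed[OF A2.subgroup_sym_cochains])
      show "P n \<one>\<^bsub>A2.C n\<^esub> = \<phi>" using \<phi> 0 by (simp add: sym_coboundaries_def P.f_one del: tuples_0)
      show "A2.\<delta> n \<one>\<^bsub>A2.C n\<^esub> = \<one>\<^bsub>A2.C (Suc n)\<^esub>" by (rule group_hom.hom_one[OF A2.coboundary_hom])
    qed
  next
    case (Suc m)
    then obtain \<psi> where \<psi>: "\<psi> \<in> sym_cochains H A3 l3 r3 m" "\<phi> = A3.\<delta> m \<psi>"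
      using \<phi> by (auto simp: sym_coboundaries_def)
    have \<psi>c: "\<psi> \<in> carrier (A3.C m)" using \<psi> by (simp add: sym_cochains_def)
    show thesis
    proof (rule that)
      show "A2.\<delta> m (S m \<psi>) \<in> sym_cochains H A2 l2 r2 n"
        using A2.coboundary_sym_cochains[OF S.f_sym[OF \<psi>(1)]] Suc by simp
      show "P n (A2.\<delta> m (S m \<psi>)) = \<phi>"
        using \<psi> \<psi>c Suc by (simp add: P.f_coboundary S.f_closed P_S)
      show "A2.\<delta> n (A2.\<delta> m (S m \<psi>)) = \<one>\<^bsub>A2.C (Suc n)\<^esub>"
        using \<psi>c Suc by (simp add: A2.coboundary_coboundary S.f_closed)
    qed
  qed
  have "connecting n \<phi> \<in> sym_class H A1 l1 r1 (Suc n) \<one>\<^bsub>A1.C (Suc n)\<^esub>"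
  proof (rule coboundary_lifts_cohomologous[OF S.f_sym[OF \<phi>c(2)] \<chi>(1)])
    show "P n (S n \<phi>) = P n \<chi>" using \<chi> \<phi>c by (simp add: P_S)
    show "connecting n \<phi> \<in> carrier (A1.C (Suc n))"
      using connecting_cocycle(3)[OF \<phi>z] subgroup.subset[OF A1.subgroup_sym_cocycles] by blast
    show "I (Suc n) \<one>\<^bsub>A1.C (Suc n)\<^esub> = A2.\<delta> n \<chi>" using \<chi> by (simp add: I.f_one)
  qed (use connecting_cocycle(2)[OF \<phi>z] in simp_all)
  then show "\<alpha> \<in> sym_coboundaries H A1 l1 r1 (Suc n)"
    unfolding \<alpha> sym_class_def
    using A1.C.coset_mult_one[OF subgroup.subset[OF A1.subgroup_sym_coboundaries]] by simp
qed

lemma connecting_class: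
  "\<phi> \<in> sym_cocycles H A3 l3 r3 n \<Longrightarrow>
    (\<Union>\<psi>\<in>sym_class H A3 l3 r3 n \<phi>. sym_class H A1 l1 r1 (Suc n) (connecting n \<psi>))
      = sym_class H A1 l1 r1 (Suc n) (connecting n \<phi>)"
  using connecting_cocycle(3) connecting_coboundaries connecting_mult
  by (intro cohomology_map_class A1.group_bimodule_axioms A3.group_bimodule_axioms) auto

lemma connecting_hom:
  "group_hom (sym_cohomology H A3 l3 r3 n) (sym_cohomology H A1 l1 r1 (Suc n))
    (\<lambda>c. \<Union>\<psi>\<in>c. sym_class H A1 l1 r1 (Suc n) (connecting n \<psi>))"
  using connecting_cocycle(3) connecting_coboundaries connecting_mult
  by (intro cohomology_map_hom A1.group_bimodule_axioms A3.group_bimodule_axioms) auto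

end

section \<open>Group rings as bimodules\<close>

lemma carrier_free_module:
  "finite S \<Longrightarrow> carrier (free_module k S) = S \<rightarrow>\<^sub>E carrier k"
  by (simp add: free_module_def)

lemma add_free_module: "s \<in> S \<Longrightarrow> (a \<oplus>\<^bsub>free_module k S\<^esub> b) s = a s \<oplus>\<^bsub>k\<^esub> b s"
  by (simp add: free_module_def)

lemma zero_free_module: "s \<in> S \<Longrightarrow> \<zero>\<^bsub>free_module k S\<^esub> s = \<zero>\<^bsub>k\<^esub>"
  by (simp add: free_module_def)

lemma abelian_group_free_module:
  assumes "abelian_group k" "finite S" shows "abelian_group (free_module k S)"
proof -
  interpret k: abelian_group k by fact
  show ?thesis
  proof (rule abelian_groupI)
    fix a assume a: "a \<in> carrier (free_module k S)"
    let ?b = "\<lambda>s\<in>S. \<ominus>\<^bsub>k\<^esub> a s"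
    have "?b \<in> carrier (free_module k S)" "?b \<oplus>\<^bsub>free_module k S\<^esub> a = \<zero>\<^bsub>free_module k S\<^esub>"
      using a assms(2) by (auto simp: free_module_def PiE_iff k.l_neg intro!: restrict_ext)
    then show "\<exists>b\<in>carrier (free_module k S). b \<oplus>\<^bsub>free_module k S\<^esub> a = \<zero>\<^bsub>free_module k S\<^esub>" by blast
    show "\<zero>\<^bsub>free_module k S\<^esub> \<oplus>\<^bsub>free_module k S\<^esub> a = a"
      using a by (auto simp: free_module_def PiE_iff extensional_def)
  qed (use assms(2) in \<open>auto simp: free_module_def PiE_iff k.a_ac intro!: restrict_ext\<close>)
qed

lemma minus_free_module:
  assumes "abelian_group k" "finite S" "a \<in> carrier (free_module k S)" "s \<in> S"
  shows "(\<ominus>\<^bsub>free_module k S\<^esub> a) s = \<ominus>\<^bsub>k\<^esub> a s"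
proof -
  interpret k: abelian_group k by fact
  interpret F: abelian_group "free_module k S" by (rule abelian_group_free_module[OF assms(1,2)])
  have "(\<ominus>\<^bsub>free_module k S\<^esub> a) s \<oplus>\<^bsub>k\<^esub> a s = \<zero>\<^bsub>k\<^esub>"
    using F.l_neg[OF assms(3)] add_free_module[OF assms(4), of k "\<ominus>\<^bsub>free_module k S\<^esub> a" a]
      zero_free_module[OF assms(4), of k] by simp
  moreover have "a s \<in> carrier k" "(\<ominus>\<^bsub>free_module k S\<^esub> a) s \<in> carrier k"
    using assms F.a_inv_closed[OF assms(3)] by (auto simp: carrier_free_module)
  ultimately show ?thesis by (simp add: k.minus_equality)
qed

lemma add_monoid_group_ring: "add_monoid (group_ring k G) = add_monoid (free_module k (carrier G))"
  by (simp add: group_ring_def)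

lemma add_monoid_eqD:
  assumes "add_monoid A = add_monoid B"
  shows "carrier A = carrier B" "add A = add B" "ring.zero A = ring.zero B" "a_inv A = a_inv B"
proof -
  show "carrier A = carrier B" "add A = add B" "ring.zero A = ring.zero B"
    using assms by simp_all
  show "a_inv A = a_inv B" using assms unfolding a_inv_def by metis
qed

lemmas group_ring_simps = add_monoid_eqD[OF add_monoid_group_ring]

lemma abelian_group_group_ring:
  assumes "abelian_group k" "finite (carrier G)" shows "abelian_group (group_ring k G)"
proof (rule comm_group_abelian_groupI)
  show "comm_group (add_monoid (group_ring k G))"
    unfolding add_monoid_group_ring
    by (rule abelian_group.a_comm_group[OF abelian_group_free_module[OF assms]])
qed

lemma group_ring_closed: "a \<in> carrier (group_ring k G) \<Longrightarrow> h \<in> carrier G \<Longrightarrow> a h \<in> carrier k"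
  by (auto simp: group_ring_simps free_module_def)

text \<open>The group elements act on the coefficients by translations, so that coefficientwise maps
  commute with the actions even if they are not additive.\<close>

lemma lmul_apply:
  assumes k: "cring k" and G: "group G" and g: "g \<in> carrier G" and a: "a \<in> carrier (group_ring k G)"
  shows "lmul k G g a = (\<lambda>h\<in>carrier G. a (inv\<^bsub>G\<^esub> g \<otimes>\<^bsub>G\<^esub> h))"
proof -
  interpret k: cring k by (rule k)
  interpret G: group G by (rule G)
  have "(\<Oplus>\<^bsub>k\<^esub>h'\<in>{h' \<in> carrier G. group_elem k G g h' \<noteq> \<zero>\<^bsub>k\<^esub>}.
      group_elem k G g h' \<otimes>\<^bsub>k\<^esub> a (inv\<^bsub>G\<^esub> h' \<otimes>\<^bsub>G\<^esub> h)) = a (inv\<^bsub>G\<^esub> g \<otimes>\<^bsub>G\<^esub> h)"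
    if h: "h \<in> carrier G" for h
  \<comment> \<open>Over the zero ring the support of \<open>g\<close> is empty instead of \<open>{g}\<close>.\<close>
  proof (cases "\<one>\<^bsub>k\<^esub> = \<zero>\<^bsub>k\<^esub>")
    case True
    have zero: "b = \<zero>\<^bsub>k\<^esub>" if "b \<in> carrier k" for b
      using that True k.l_one[OF that] k.l_null[OF that] by simp
    show ?thesis (is "?l = ?r")
    proof -
      have "?l = \<zero>\<^bsub>k\<^esub>"
        using group_ring_closed[OF a] h
        by (intro zero k.finsum_closed) (auto simp: group_elem_def intro!: k.m_closed)
      also have "\<dots> = ?r"
        using group_ring_closed[OF a, of "inv\<^bsub>G\<^esub> g \<otimes>\<^bsub>G\<^esub> h"] g h zero by simp
      finally show ?thesis .
    qed
  next
    case False
    then have "{h' \<in> carrier G. group_elem k G g h' \<noteq> \<zero>\<^bsub>k\<^esub>} = {g}"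
      using g by (auto simp: group_elem_def)
    then show ?thesis using group_ring_closed[OF a, of "inv\<^bsub>G\<^esub> g \<otimes>\<^bsub>G\<^esub> h"] g h
      by (simp add: group_elem_def)
  qed
  then show ?thesis by (auto simp: lmul_def group_ring_def)
qed

lemma rmul_apply:
  assumes k: "cring k" and G: "group G" and g: "g \<in> carrier G" and a: "a \<in> carrier (group_ring k G)"
  shows "rmul k G g a = (\<lambda>h\<in>carrier G. a (h \<otimes>\<^bsub>G\<^esub> inv\<^bsub>G\<^esub> g))"
proof -
  interpret k: cring k by (rule k)
  interpret G: group G by (rule G)
  let ?S = "{h' \<in> carrier G. a h' \<noteq> \<zero>\<^bsub>k\<^esub>}"
  have fin: "finite ?S" using a by (simp add: group_ring_simps free_module_def)
  have "(\<Oplus>\<^bsub>k\<^esub>h'\<in>?S. a h' \<otimes>\<^bsub>k\<^esub> group_elem k G g (inv\<^bsub>G\<^esub> h' \<otimes>\<^bsub>G\<^esub> h)) = a (h \<otimes>\<^bsub>G\<^esub> inv\<^bsub>G\<^esub> g)"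
    if h: "h \<in> carrier G" for h
  proof -
    let ?c = "h \<otimes>\<^bsub>G\<^esub> inv\<^bsub>G\<^esub> g"
    have c: "?c \<in> carrier G" using g h by simp
    have eq: "inv\<^bsub>G\<^esub> h' \<otimes>\<^bsub>G\<^esub> h = g \<longleftrightarrow> ?c = h'" if "h' \<in> carrier G" for h'
      using that g h by (metis G.inv_closed G.inv_solve_left G.inv_solve_right)
    have "(\<Oplus>\<^bsub>k\<^esub>h'\<in>?S. a h' \<otimes>\<^bsub>k\<^esub> group_elem k G g (inv\<^bsub>G\<^esub> h' \<otimes>\<^bsub>G\<^esub> h))
        = (\<Oplus>\<^bsub>k\<^esub>h'\<in>?S. if ?c = h' then a h' else \<zero>\<^bsub>k\<^esub>)"
      using h group_ring_closed[OF a] eq by (intro k.finsum_cong') (auto simp: group_elem_def)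
    also have "\<dots> = a ?c"
    proof (cases "?c \<in> ?S")
      case True
      then show ?thesis using fin group_ring_closed[OF a] by (intro k.finsum_singleton) auto
    next
      case False
      then have "(\<Oplus>\<^bsub>k\<^esub>h'\<in>?S. if ?c = h' then a h' else \<zero>\<^bsub>k\<^esub>) = (\<Oplus>\<^bsub>k\<^esub>h'\<in>?S. \<zero>\<^bsub>k\<^esub>)"
        by (intro k.finsum_cong') auto
      with False c show ?thesis by (simp add: k.finsum_zero)
    qed
    finally show ?thesis .
  qed
  then show ?thesis by (auto simp: rmul_def group_ring_def)
qed

lemma group_ring_bimodule:
  assumes k: "cring k" and G: "group G" and fin: "finite (carrier G)"
  shows "group_bimodule G (group_ring k G) (lmul k G) (rmul k G)"
proof -
  interpret k: cring k by (rule k)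
  interpret G: group G by (rule G)
  interpret A: abelian_group "group_ring k G"
    by (rule abelian_group_group_ring[OF k.abelian_group_axioms fin])
  have car: "carrier (group_ring k G) = carrier G \<rightarrow>\<^sub>E carrier k"
    using fin by (simp add: group_ring_simps carrier_free_module)
  have add: "a \<oplus>\<^bsub>group_ring k G\<^esub> b = (\<lambda>h\<in>carrier G. a h \<oplus>\<^bsub>k\<^esub> b h)" for a b
    by (simp add: group_ring_simps free_module_def)
  note l = lmul_apply[OF k G] and r = rmul_apply[OF k G]
  have lc: "lmul k G g a \<in> carrier (group_ring k G)"
    if "g \<in> carrier G" "a \<in> carrier (group_ring k G)" for g a
    unfolding l[OF that] using that by (auto simp: car)
  have rc: "rmul k G g a \<in> carrier (group_ring k G)"
    if "g \<in> carrier G" "a \<in> carrier (group_ring k G)" for g a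
    unfolding r[OF that] using that by (auto simp: car)
  show ?thesis
  proof
    fix g a b assume g: "g \<in> carrier G" and a: "a \<in> carrier (group_ring k G)"
      and b: "b \<in> carrier (group_ring k G)"
    show "lmul k G g (a \<oplus>\<^bsub>group_ring k G\<^esub> b) = lmul k G g a \<oplus>\<^bsub>group_ring k G\<^esub> lmul k G g b"
      using g a b A.a_closed[OF a b] by (auto simp: l add intro!: restrict_ext)
    show "rmul k G g (a \<oplus>\<^bsub>group_ring k G\<^esub> b) = rmul k G g a \<oplus>\<^bsub>group_ring k G\<^esub> rmul k G g b"
      using g a b A.a_closed[OF a b] by (auto simp: r add intro!: restrict_ext)
  next
    fix a assume a: "a \<in> carrier (group_ring k G)"
    show "lmul k G \<one>\<^bsub>G\<^esub> a = a" "rmul k G \<one>\<^bsub>G\<^esub> a = a"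
      using a by (auto simp: l r car PiE_iff extensional_def)
  next
    fix g h a assume gh: "g \<in> carrier G" "h \<in> carrier G" and a: "a \<in> carrier (group_ring k G)"
    show "lmul k G g (lmul k G h a) = lmul k G (g \<otimes>\<^bsub>G\<^esub> h) a"
      using gh
      by (subst l[OF gh(1) lc[OF gh(2) a]], subst l[OF gh(2) a], subst l[OF G.m_closed[OF gh] a])
        (auto simp: G.inv_mult_group G.m_assoc intro!: restrict_ext)
    show "rmul k G h (rmul k G g a) = rmul k G (g \<otimes>\<^bsub>G\<^esub> h) a"
      using gh
      by (subst r[OF gh(2) rc[OF gh(1) a]], subst r[OF gh(1) a], subst r[OF G.m_closed[OF gh] a])
        (auto simp: G.inv_mult_group G.m_assoc intro!: restrict_ext)
    show "lmul k G g (rmul k G h a) = rmul k G h (lmul k G g a)"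
      using gh
      by (subst l[OF gh(1) rc[OF gh(2) a]], subst r[OF gh(2) lc[OF gh(1) a]],
          subst l[OF gh(1) a], subst r[OF gh(2) a]) (auto simp: G.m_assoc intro!: restrict_ext)
  qed (use lc rc in auto)
qed

lemma trivial_bimodule:
  assumes "group H" "abelian_group A" shows "group_bimodule H A trivial_act (\<lambda>_ a. a)"
  using assms by (simp add: group_bimodule_def group_bimodule_axioms_def)

lemma coeffwise_closed:
  assumes "finite S" "\<And>a. a \<in> carrier k \<Longrightarrow> u a \<in> carrier k'" "a \<in> carrier (free_module k S)"
  shows "coeffwise S u a \<in> carrier (free_module k' S)"
  using assms by (auto simp: carrier_free_module coeffwise_def)

lemma coeffwise_lmul:
  assumes k: "cring k" "cring k'" and G: "group G" "finite (carrier G)"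
    and u: "\<And>a. a \<in> carrier k \<Longrightarrow> u a \<in> carrier k'"
    and g: "g \<in> carrier G" and a: "a \<in> carrier (group_ring k G)"
  shows "coeffwise (carrier G) u (lmul k G g a) = lmul k' G g (coeffwise (carrier G) u a)"
proof -
  interpret G: group G by (rule G)
  have "coeffwise (carrier G) u a \<in> carrier (group_ring k' G)"
    using coeffwise_closed[OF G(2) u] a by (simp add: group_ring_simps)
  then show ?thesis
    using g by (auto simp: lmul_apply[OF k(2) G(1) g] lmul_apply[OF k(1) G(1) g a] coeffwise_def)
qed

lemma coeffwise_rmul:
  assumes k: "cring k" "cring k'" and G: "group G" "finite (carrier G)"
    and u: "\<And>a. a \<in> carrier k \<Longrightarrow> u a \<in> carrier k'"
    and g: "g \<in> carrier G" and a: "a \<in> carrier (group_ring k G)"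
  shows "coeffwise (carrier G) u (rmul k G g a) = rmul k' G g (coeffwise (carrier G) u a)"
proof -
  interpret G: group G by (rule G)
  have "coeffwise (carrier G) u a \<in> carrier (group_ring k' G)"
    using coeffwise_closed[OF G(2) u] a by (simp add: group_ring_simps)
  then show ?thesis
    using g by (auto simp: rmul_apply[OF k(2) G(1) g] rmul_apply[OF k(1) G(1) g a] coeffwise_def)
qed

section \<open>Projection to the cohomology of a centralizer\<close>

lemma subgroup_centralizer:
  assumes "group G" "x \<in> carrier G"
  shows "subgroup {g \<in> carrier G. g \<otimes>\<^bsub>G\<^esub> x = x \<otimes>\<^bsub>G\<^esub> g} G"
proof -
  interpret G: group G by fact
  show ?thesis
  proof
    fix g h assume "g \<in> {g \<in> carrier G. g \<otimes>\<^bsub>G\<^esub> x = x \<otimes>\<^bsub>G\<^esub> g}" "h \<in> {g \<in> carrier G. g \<otimes>\<^bsub>G\<^esub> x = x \<otimes>\<^bsub>G\<^esub> g}"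
    then show "g \<otimes>\<^bsub>G\<^esub> h \<in> {g \<in> carrier G. g \<otimes>\<^bsub>G\<^esub> x = x \<otimes>\<^bsub>G\<^esub> g}"
      using assms(2) by (simp add: G.m_assoc) (simp add: G.m_assoc[symmetric])
  next
    fix g assume "g \<in> {g \<in> carrier G. g \<otimes>\<^bsub>G\<^esub> x = x \<otimes>\<^bsub>G\<^esub> g}"
    then have g: "g \<in> carrier G" "g \<otimes>\<^bsub>G\<^esub> x = x \<otimes>\<^bsub>G\<^esub> g" by auto
    have "g \<otimes>\<^bsub>G\<^esub> (x \<otimes>\<^bsub>G\<^esub> inv\<^bsub>G\<^esub> g) = x \<otimes>\<^bsub>G\<^esub> g \<otimes>\<^bsub>G\<^esub> inv\<^bsub>G\<^esub> g"
      using g assms(2) by (simp add: G.m_assoc[symmetric])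
    also have "\<dots> = x" using g(1) assms(2) by (simp add: G.m_assoc)
    finally show "inv\<^bsub>G\<^esub> g \<in> {g \<in> carrier G. g \<otimes>\<^bsub>G\<^esub> x = x \<otimes>\<^bsub>G\<^esub> g}"
      using g(1) assms(2) by (simp add: G.inv_solve_left')
  qed (use assms(2) in auto)
qed

lemma
  assumes "group G" "x \<in> carrier G"
  shows group_centralizer: "group (centralizer G x)"
    and inv_centralizer: "g \<in> carrier (centralizer G x) \<Longrightarrow> inv\<^bsub>centralizer G x\<^esub> g = inv\<^bsub>G\<^esub> g"
  unfolding centralizer_def
  using group.subgroup_imp_group[OF assms(1) subgroup_centralizer[OF assms]]
    group.m_inv_consistent[OF assms(1) subgroup_centralizer[OF assms]]
  by simp_all

lemma carrier_centralizer:
  "g \<in> carrier (centralizer G x) \<longleftrightarrow> g \<in> carrier G \<and> g \<otimes>\<^bsub>G\<^esub> x = x \<otimes>\<^bsub>G\<^esub> g"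
  by (simp add: centralizer_def)

lemma mult_centralizer [simp]: "monoid.mult (centralizer G x) = monoid.mult G"
  by (simp add: centralizer_def)

lemma tuples_centralizer: "gs \<in> tuples (centralizer G x) n \<Longrightarrow> gs \<in> tuples G n"
  by (auto simp: tuples_def carrier_centralizer)

lemma quotients_centralizer:
  assumes "group G" "x \<in> carrier G"
  shows "xs \<in> tuples (centralizer G x) n \<Longrightarrow> quotients (centralizer G x) xs = quotients G xs"
proof (induction n arbitrary: xs)
  case (Suc n)
  then obtain y ys where xs: "xs = y # ys" "y \<in> carrier (centralizer G x)"
    "ys \<in> tuples (centralizer G x) n"
    by (blast elim: tuples_SucE)
  with Suc.IH[OF xs(3)] show ?case
    by (cases ys) (simp_all add: inv_centralizer[OF assms])
qed simp

text \<open>The extra factor \<open>y\<close> is the product of the entries already passed.\<close>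

lemma (in group_bimodule) foldr_r:
  "y \<in> carrier H \<Longrightarrow> gs \<in> tuples H n \<Longrightarrow> a \<in> carrier A \<Longrightarrow>
    r (inv\<^bsub>H\<^esub> y) (foldr (\<lambda>h. r (inv\<^bsub>H\<^esub> h)) gs a) = r (inv\<^bsub>H\<^esub> (last (partial_products H y gs))) a
    \<and> foldr (\<lambda>h. r (inv\<^bsub>H\<^esub> h)) gs a \<in> carrier A"
proof (induction n arbitrary: y gs)
  case (Suc n)
  then obtain g hs where gs: "gs = g # hs" "g \<in> carrier H" "hs \<in> tuples H n"
    by (blast elim: tuples_SucE)
  have IH: "r (inv\<^bsub>H\<^esub> (y \<otimes>\<^bsub>H\<^esub> g)) (foldr (\<lambda>h. r (inv\<^bsub>H\<^esub> h)) hs a)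
      = r (inv\<^bsub>H\<^esub> (last (partial_products H (y \<otimes>\<^bsub>H\<^esub> g) hs))) a"
    and c: "foldr (\<lambda>h. r (inv\<^bsub>H\<^esub> h)) hs a \<in> carrier A"
    using Suc.IH[of "y \<otimes>\<^bsub>H\<^esub> g" hs] Suc.prems gs by auto
  show ?case using IH c gs Suc.prems by (simp add: r_mult r_closed H.inv_mult_group)
qed simp

text \<open>For \<open>x\<^sub>0,\<dots>,x\<^sub>n\<close> in the centralizer of \<open>x\<close>, the product of the quotients is \<open>x\<^sub>0\<^sup>-\<^sup>1x\<^sub>n\<close>, so the
  projection takes the coefficient of \<open>x\<close> in \<open>\<phi>(\<dots>) x\<^sub>n\<^sup>-\<^sup>1x\<^sub>0\<close>. As \<open>x\<^sub>0\<close> commutes with \<open>x\<close>, this is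
  its coefficient in \<open>x\<^sub>0 \<phi>(\<dots>) x\<^sub>n\<^sup>-\<^sup>1\<close>, the homogeneous form of \<open>\<phi>\<close>.\<close>

lemma projection_cochain_map:
  assumes k: "cring k" and G: "group G" "finite (carrier G)" and x: "x \<in> carrier G"
  shows "cochain_map G (group_ring k G) (lmul k G) (rmul k G)
    (centralizer G x) (free_module k {x}) trivial_act (\<lambda>_ a. a)
    (\<lambda>a. restrict a {x}) (proj_cochain k G x)"
proof -
  let ?K = "centralizer G x"
  interpret k: cring k by (rule k)
  interpret A: group_bimodule G "group_ring k G" "lmul k G" "rmul k G"
    by (rule group_ring_bimodule[OF k G])
  interpret B: group_bimodule ?K "free_module k {x}" trivial_act "\<lambda>_ a. a"
    by (intro trivial_bimodule group_centralizer[OF G(1) x] abelian_group_free_module k.abelian_group_axioms)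
      simp
  have uc: "restrict a {x} \<in> carrier (free_module k {x})" if "a \<in> carrier (group_ring k G)" for a
    using group_ring_closed[OF that x] by (simp add: carrier_free_module)
  show ?thesis
  proof
    show "carrier ?K \<subseteq> carrier G" by (auto simp: carrier_centralizer)
    show "restrict a {x} \<in> carrier (free_module k {x})" if "a \<in> carrier (group_ring k G)" for a
      by (rule uc[OF that])
    fix \<phi> n assume \<phi>: "\<phi> \<in> carrier (cochains G (group_ring k G) n)"
    have fold: "foldr (\<lambda>h. rmul k G (inv\<^bsub>G\<^esub> h)) hs (\<phi> hs)
        = rmul k G (inv\<^bsub>G\<^esub> (last (partial_products G \<one>\<^bsub>G\<^esub> hs))) (\<phi> hs)"
      "foldr (\<lambda>h. rmul k G (inv\<^bsub>G\<^esub> h)) hs (\<phi> hs) \<in> carrier (group_ring k G)"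
      if "hs \<in> tuples G n" for hs
      using A.foldr_r[OF A.H.one_closed that A.cochain_closed[OF \<phi> that]]
        A.r_one[of "foldr (\<lambda>h. rmul k G (inv\<^bsub>G\<^esub> h)) hs (\<phi> hs)"] by auto
    show "proj_cochain k G x n \<phi> \<in> carrier (cochains ?K (free_module k {x}) n)"
      using uc fold(2)[OF tuples_centralizer] by (auto simp: cochains_def proj_cochain_def)
    fix xs assume xs: "xs \<in> tuples ?K (Suc n)"
    let ?hs = "quotients G xs" and ?a = "hd xs" and ?z = "last xs"
    have xs': "xs \<in> tuples G (Suc n)" by (rule tuples_centralizer[OF xs])
    have hs: "?hs \<in> tuples G n" and hsK: "?hs \<in> tuples ?K n"
      using A.H.quotients_closed[OF xs'] B.H.quotients_closed[OF xs] quotients_centralizer[OF G(1) x xs]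
      by simp_all
    have az: "?a \<in> carrier G" "?z \<in> carrier G" "?a \<otimes>\<^bsub>G\<^esub> x = x \<otimes>\<^bsub>G\<^esub> ?a"
      using B.hd_last_closed[OF xs] by (auto simp: carrier_centralizer)
    have p: "last (partial_products G \<one>\<^bsub>G\<^esub> ?hs) \<in> carrier G"
      by (rule A.H.last_partial_products_closed[OF A.H.one_closed hs])
    have "?a \<otimes>\<^bsub>G\<^esub> last (partial_products G \<one>\<^bsub>G\<^esub> ?hs) = ?z"
      using A.H.last_partial_products_mult[OF az(1) A.H.one_closed hs] A.H.partial_products_quotients[OF xs'] az
      by simp
    then have last: "last (partial_products G \<one>\<^bsub>G\<^esub> ?hs) = inv\<^bsub>G\<^esub> ?a \<otimes>\<^bsub>G\<^esub> ?z"
      using az p by (simp add: A.H.inv_solve_left)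
    have comm: "inv\<^bsub>G\<^esub> ?a \<otimes>\<^bsub>G\<^esub> x = x \<otimes>\<^bsub>G\<^esub> inv\<^bsub>G\<^esub> ?a"
      using az x by (metis A.H.inv_closed A.H.inv_solve_left A.H.inv_solve_right A.H.m_closed A.H.m_assoc)
    note c = A.cochain_closed[OF \<phi> hs]
    have iz: "inv\<^bsub>G\<^esub> ?z \<in> carrier G" "inv\<^bsub>G\<^esub> (inv\<^bsub>G\<^esub> ?a \<otimes>\<^bsub>G\<^esub> ?z) \<in> carrier G" using az by simp_all
    have "B.homogenize (proj_cochain k G x n \<phi>) xs
        = restrict (rmul k G (inv\<^bsub>G\<^esub> (inv\<^bsub>G\<^esub> ?a \<otimes>\<^bsub>G\<^esub> ?z)) (\<phi> ?hs)) {x}"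
      unfolding B.homogenize_def quotients_centralizer[OF G(1) x xs] proj_cochain_def
        restrict_apply'[OF hsK] fold(1)[OF hs] last ..
    also have "\<dots> = restrict (A.homogenize \<phi> xs) {x}"
    proof (rule restrict_ext)
      fix y assume "y \<in> {x}"
      then have y: "y = x" by simp

      have "A.homogenize \<phi> xs y = rmul k G (inv\<^bsub>G\<^esub> ?z) (\<phi> ?hs) (inv\<^bsub>G\<^esub> ?a \<otimes>\<^bsub>G\<^esub> x)"
        using x by (simp add: A.homogenize_def lmul_apply[OF k G(1) az(1) A.r_closed[OF iz(1) c]] y)
      also have "\<dots> = \<phi> ?hs (inv\<^bsub>G\<^esub> ?a \<otimes>\<^bsub>G\<^esub> x \<otimes>\<^bsub>G\<^esub> ?z)"
        using az x by (simp add: rmul_apply[OF k G(1) iz(1) c])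
      also have "\<dots> = \<phi> ?hs (x \<otimes>\<^bsub>G\<^esub> (inv\<^bsub>G\<^esub> ?a \<otimes>\<^bsub>G\<^esub> ?z))"
        using az x by (simp add: comm A.H.m_assoc)
      also have "\<dots> = rmul k G (inv\<^bsub>G\<^esub> (inv\<^bsub>G\<^esub> ?a \<otimes>\<^bsub>G\<^esub> ?z)) (\<phi> ?hs) y"
        using az x iz c y by (simp add: rmul_apply[OF k G(1)])
      finally show "rmul k G (inv\<^bsub>G\<^esub> (inv\<^bsub>G\<^esub> ?a \<otimes>\<^bsub>G\<^esub> ?z)) (\<phi> ?hs) y = A.homogenize \<phi> xs y" by simp
    qed
    finally show "B.homogenize (proj_cochain k G x n \<phi>) xs = restrict (A.homogenize \<phi> xs) {x}" .
  next
    fix a b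
    show "restrict (a \<oplus>\<^bsub>group_ring k G\<^esub> b) {x}
        = restrict a {x} \<oplus>\<^bsub>free_module k {x}\<^esub> restrict b {x}"
      using x by (auto simp: group_ring_simps free_module_def)
  qed
qed

lemma projection_coeffwise:
  assumes k: "cring k" "cring k'" and G: "group G" "finite (carrier G)" and x: "x \<in> carrier G"
    and u: "\<And>a. a \<in> carrier k \<Longrightarrow> u a \<in> carrier k'"
    and \<phi>: "\<phi> \<in> carrier (cochains G (group_ring k G) n)"
  shows "proj_cochain k' G x n (compose (tuples G n) (coeffwise (carrier G) u) \<phi>)
    = compose (tuples (centralizer G x) n) (coeffwise {x} u) (proj_cochain k G x n \<phi>)"
proof -
  interpret A: group_bimodule G "group_ring k G" "lmul k G" "rmul k G"
    by (rule group_ring_bimodule[OF k(1) G])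
  have fold: "foldr (\<lambda>h. rmul k' G (inv\<^bsub>G\<^esub> h)) hs (coeffwise (carrier G) u a)
      = coeffwise (carrier G) u (foldr (\<lambda>h. rmul k G (inv\<^bsub>G\<^esub> h)) hs a)
      \<and> foldr (\<lambda>h. rmul k G (inv\<^bsub>G\<^esub> h)) hs a \<in> carrier (group_ring k G)"
    if "set hs \<subseteq> carrier G" "a \<in> carrier (group_ring k G)" for hs a
    using that by (induction hs) (auto simp: coeffwise_rmul[OF k G u] A.r_closed)
  have "restrict (foldr (\<lambda>h. rmul k' G (inv\<^bsub>G\<^esub> h)) hs (coeffwise (carrier G) u (\<phi> hs))) {x}
      = coeffwise {x} u (restrict (foldr (\<lambda>h. rmul k G (inv\<^bsub>G\<^esub> h)) hs (\<phi> hs)) {x})"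
    if "hs \<in> tuples G n" for hs
    using fold[of hs "\<phi> hs"] that A.cochain_closed[OF \<phi> that] x
    by (auto simp: coeffwise_def tuples_def)
  then show ?thesis
    by (auto simp: proj_cochain_def compose_def tuples_centralizer intro!: restrict_ext)
qed

section \<open>Extensions of coefficient rings\<close>

locale odd_split_coefficients =
  k1: cring k1 + k2: cring k2 + k3: cring k3
  for k1 :: "('a, 'p) ring_scheme" and k2 :: "('b, 'q) ring_scheme" and k3 :: "('c, 'r) ring_scheme" +
  fixes \<iota> :: "'a \<Rightarrow> 'b" and \<pi> :: "'b \<Rightarrow> 'c" and s :: "'c \<Rightarrow> 'b"
  assumes \<iota>: "\<iota> \<in> mon (add_monoid k1) (add_monoid k2)"
    and \<pi>: "\<pi> \<in> epi (add_monoid k2) (add_monoid k3)"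
    and exact: "\<iota> ` carrier k1 = a_kernel k2 k3 \<pi>"
    and s: "s \<in> carrier k3 \<rightarrow> carrier k2"
    and \<pi>_s: "\<And>a. a \<in> carrier k3 \<Longrightarrow> \<pi> (s a) = a"
    and s_minus: "\<And>a. a \<in> carrier k3 \<Longrightarrow> s (\<ominus>\<^bsub>k3\<^esub> a) = \<ominus>\<^bsub>k2\<^esub> s a"
begin

lemma \<iota>_closed: "a \<in> carrier k1 \<Longrightarrow> \<iota> a \<in> carrier k2"
  using \<iota> by (auto simp: mon_def hom_def)

lemma \<pi>_closed: "a \<in> carrier k2 \<Longrightarrow> \<pi> a \<in> carrier k3"
  using \<pi> by (auto simp: epi_def hom_def)

lemma s_closed: "a \<in> carrier k3 \<Longrightarrow> s a \<in> carrier k2"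
  using s by auto

text \<open>Everything is checked coefficient by coefficient. The \<open>A\<^sub>i\<close> are compared with free modules
  through their additive groups, so that group rings and trivial modules are both covered. Finiteness
  of \<open>S\<close> keeps the values of \<open>s\<close> in the free module even when \<open>s 0 \<noteq> 0\<close>.\<close>

lemma coeffwise_extension:
  assumes fin: "finite S"
    and A1: "group_bimodule H A1 l1 r1" "add_monoid A1 = add_monoid (free_module k1 S)"
    and A2: "group_bimodule H A2 l2 r2" "add_monoid A2 = add_monoid (free_module k2 S)"
    and A3: "group_bimodule H A3 l3 r3" "add_monoid A3 = add_monoid (free_module k3 S)"
    and l: "\<And>g a. g \<in> carrier H \<Longrightarrow> a \<in> carrier A1 \<Longrightarrow> coeffwise S \<iota> (l1 g a) = l2 g (coeffwise S \<iota> a)"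
      "\<And>g a. g \<in> carrier H \<Longrightarrow> a \<in> carrier A2 \<Longrightarrow> coeffwise S \<pi> (l2 g a) = l3 g (coeffwise S \<pi> a)"
      "\<And>g a. g \<in> carrier H \<Longrightarrow> a \<in> carrier A3 \<Longrightarrow> coeffwise S s (l3 g a) = l2 g (coeffwise S s a)"
    and r: "\<And>g a. g \<in> carrier H \<Longrightarrow> a \<in> carrier A1 \<Longrightarrow> coeffwise S \<iota> (r1 g a) = r2 g (coeffwise S \<iota> a)"
      "\<And>g a. g \<in> carrier H \<Longrightarrow> a \<in> carrier A2 \<Longrightarrow> coeffwise S \<pi> (r2 g a) = r3 g (coeffwise S \<pi> a)"
      "\<And>g a. g \<in> carrier H \<Longrightarrow> a \<in> carrier A3 \<Longrightarrow> coeffwise S s (r3 g a) = r2 g (coeffwise S s a)"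
  shows "odd_split_extension H A1 l1 r1 A2 l2 r2 A3 l3 r3 (coeffwise S \<iota>) (coeffwise S \<pi>)
    (coeffwise S s) (coeffwise S (inv_into (carrier k1) \<iota>))"
proof -
  note simps = add_monoid_eqD[OF A1(2)] add_monoid_eqD[OF A2(2)] add_monoid_eqD[OF A3(2)]
    carrier_free_module[OF fin]
  have inv_\<iota>: "inv_into (carrier k1) \<iota> (\<iota> a) = a" if "a \<in> carrier k1" for a
    using \<iota> that by (auto simp: mon_def)
  have ker: "b \<in> carrier k2 \<and> \<pi> b = \<zero>\<^bsub>k3\<^esub> \<longleftrightarrow> b \<in> \<iota> ` carrier k1" for b
    by (simp add: exact a_kernel_def kernel_def)
  show ?thesis
  proof (intro odd_split_extension.intro A1(1) A2(1) A3(1) odd_split_extension_axioms.intro l r)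
    fix a assume a: "a \<in> carrier A1"
    then show "coeffwise S \<iota> a \<in> carrier A2" by (auto simp: simps coeffwise_def PiE_iff \<iota>_closed)
    show "coeffwise S (inv_into (carrier k1) \<iota>) (coeffwise S \<iota> a) = a"
      using a by (auto simp: simps coeffwise_def inv_\<iota> PiE_iff extensional_def)
    fix a' assume a': "a' \<in> carrier A1"
    show "coeffwise S \<iota> (a \<oplus>\<^bsub>A1\<^esub> a') = coeffwise S \<iota> a \<oplus>\<^bsub>A2\<^esub> coeffwise S \<iota> a'"
      using a a' \<iota> by (auto simp: simps coeffwise_def free_module_def mon_def hom_def PiE_iff intro!: restrict_ext)
  next
    fix b assume b: "b \<in> carrier A2"
    then show "coeffwise S \<pi> b \<in> carrier A3" by (auto simp: simps coeffwise_def PiE_iff \<pi>_closed)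
    fix b' assume b': "b' \<in> carrier A2"
    show "coeffwise S \<pi> (b \<oplus>\<^bsub>A2\<^esub> b') = coeffwise S \<pi> b \<oplus>\<^bsub>A3\<^esub> coeffwise S \<pi> b'"
      using b b' \<pi> by (auto simp: simps coeffwise_def free_module_def epi_def hom_def PiE_iff intro!: restrict_ext)
  next
    fix c assume c: "c \<in> carrier A3"
    then show "coeffwise S s c \<in> carrier A2" by (auto simp: simps coeffwise_def PiE_iff s_closed)
    show "coeffwise S \<pi> (coeffwise S s c) = c"
      using c by (auto simp: simps coeffwise_def \<pi>_s PiE_iff extensional_def)
    have c': "c \<in> carrier (free_module k3 S)" using c by (simp add: simps)
    have sc: "coeffwise S s c \<in> carrier (free_module k2 S)"
      using c by (auto simp: simps coeffwise_def PiE_iff s_closed)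
    show "coeffwise S s (\<ominus>\<^bsub>A3\<^esub> c) = \<ominus>\<^bsub>A2\<^esub> coeffwise S s c"
    proof (rule extensionalityI[of _ S])
      show "\<ominus>\<^bsub>A2\<^esub> coeffwise S s c \<in> extensional S"
        using abelian_group.a_inv_closed[OF abelian_group_free_module[OF k2.abelian_group_axioms fin] sc]
        by (simp add: simps PiE_def)
      show "coeffwise S s (\<ominus>\<^bsub>A3\<^esub> c) t = (\<ominus>\<^bsub>A2\<^esub> coeffwise S s c) t" if t: "t \<in> S" for t
      proof -
        have "c t \<in> carrier k3" using c' t by (auto simp: carrier_free_module[OF fin])
        with t minus_free_module[OF k2.abelian_group_axioms fin sc t]
          minus_free_module[OF k3.abelian_group_axioms fin c' t]
        show ?thesis by (simp add: simps(4,8,12) coeffwise_def s_minus)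
      qed
    qed (simp add: coeffwise_def)
  next
    show "coeffwise S \<iota> ` carrier A1 = {b \<in> carrier A2. coeffwise S \<pi> b = \<zero>\<^bsub>A3\<^esub>}"
    proof (intro equalityI subsetI)
      fix b assume "b \<in> coeffwise S \<iota> ` carrier A1"
      then obtain a where a: "a \<in> carrier A1" "b = coeffwise S \<iota> a" by blast
      have "\<pi> (\<iota> y) = \<zero>\<^bsub>k3\<^esub>" if "y \<in> carrier k1" for y using that ker[of "\<iota> y"] by blast
      then have "coeffwise S \<pi> b = \<zero>\<^bsub>A3\<^esub>"
        using a by (auto simp: simps coeffwise_def free_module_def PiE_iff intro!: restrict_ext)
      moreover have "b \<in> carrier A2" using a by (auto simp: simps coeffwise_def PiE_iff \<iota>_closed)
      ultimately show "b \<in> {b \<in> carrier A2. coeffwise S \<pi> b = \<zero>\<^bsub>A3\<^esub>}" by simp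
    next
      fix b assume b: "b \<in> {b \<in> carrier A2. coeffwise S \<pi> b = \<zero>\<^bsub>A3\<^esub>}"
      have im: "b t \<in> \<iota> ` carrier k1" if t: "t \<in> S" for t
      proof -
        have "coeffwise S \<pi> b t = \<zero>\<^bsub>A3\<^esub> t" using b by simp
        then have "\<pi> (b t) = \<zero>\<^bsub>k3\<^esub>" using t by (simp add: coeffwise_def simps zero_free_module)
        moreover have "b t \<in> carrier k2" using b t by (auto simp: simps)
        ultimately show ?thesis using ker by blast
      qed
      let ?a = "coeffwise S (inv_into (carrier k1) \<iota>) b"
      have "?a \<in> carrier A1" using im by (auto simp: simps coeffwise_def intro: inv_into_into)
      moreover have "b = coeffwise S \<iota> ?a"
        using b im by (auto simp: simps coeffwise_def PiE_iff extensional_def f_inv_into_f)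
      ultimately show "b \<in> coeffwise S \<iota> ` carrier A1" by blast
    qed
  qed
qed

lemma group_ring_extension:
  assumes G: "group G" "finite (carrier G)"
  shows "odd_split_extension G (group_ring k1 G) (lmul k1 G) (rmul k1 G)
    (group_ring k2 G) (lmul k2 G) (rmul k2 G) (group_ring k3 G) (lmul k3 G) (rmul k3 G)
    (coeffwise (carrier G) \<iota>) (coeffwise (carrier G) \<pi>) (coeffwise (carrier G) s)
    (coeffwise (carrier G) (inv_into (carrier k1) \<iota>))"
  using \<iota>_closed \<pi>_closed s_closed
  by (intro coeffwise_extension G group_ring_bimodule add_monoid_group_ring coeffwise_lmul coeffwise_rmul
      k1.cring_axioms k2.cring_axioms k3.cring_axioms)

lemma trivial_extension:
  assumes "group H" "finite S"
  shows "odd_split_extension H (free_module k1 S) trivial_act (\<lambda>_ a. a)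
    (free_module k2 S) trivial_act (\<lambda>_ a. a) (free_module k3 S) trivial_act (\<lambda>_ a. a)
    (coeffwise S \<iota>) (coeffwise S \<pi>) (coeffwise S s) (coeffwise S (inv_into (carrier k1) \<iota>))"
  using assms
  by (intro coeffwise_extension trivial_bimodule abelian_group_free_module
      k1.abelian_group_axioms k2.abelian_group_axioms k3.abelian_group_axioms refl)

end

section \<open>The commutative square of connecting homomorphisms\<close>

theorem theorem2p4:
  fixes n :: nat
    and G :: "('g, 'm) monoid_scheme" and T :: "'g set" and x :: 'g
    and k1 :: "('a, 'p) ring_scheme" and k2 :: "('b, 'q) ring_scheme" and k3 :: "('c, 'r) ring_scheme"
    and \<iota> :: "'a \<Rightarrow> 'b" and \<pi> :: "'b \<Rightarrow> 'c" and s :: "'c \<Rightarrow> 'b"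
  assumes "group G" and "finite (carrier G)"
    and "conj_class_reps G T" and "x \<in> T"
    and "cring k1" and "cring k2" and "cring k3"
    and "\<iota> \<in> mon (add_monoid k1) (add_monoid k2)"
    and "\<pi> \<in> epi (add_monoid k2) (add_monoid k3)"
    and "\<iota> ` carrier k1 = a_kernel k2 k3 \<pi>"
    and "s \<in> carrier k3 \<rightarrow> carrier k2"
    and "\<And>a. a \<in> carrier k3 \<Longrightarrow> \<pi> (s a) = a"
    and "\<And>a. a \<in> carrier k3 \<Longrightarrow> s (\<ominus>\<^bsub>k3\<^esub> a) = \<ominus>\<^bsub>k2\<^esub> s a"
  shows "\<exists>B.
     group_hom (HHS k3 G n) (HHS k1 G (Suc n)) B \<and>
     (\<forall>\<phi>\<in>HHS_cocycles k3 G n.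
        (\<forall>gs\<in>tuples G (Suc n). lift_coboundary k2 G s n \<phi> gs
            \<in> a_kernel (group_ring k2 G) (group_ring k3 G) (coeffwise (carrier G) \<pi>)) \<and>
        hochschild_connecting k1 k2 G \<iota> s n \<phi> \<in> HHS_cocycles k1 G (Suc n) \<and>
        B (HHS_class k3 G n \<phi>) = HHS_class k1 G (Suc n) (hochschild_connecting k1 k2 G \<iota> s n \<phi>)) \<and>
     group_hom (HHS k3 G n) (HS (centralizer G x) (free_module k3 {x}) trivial_act n)
       (HHS_proj k3 G x n) \<and>
     group_hom (HHS k1 G (Suc n)) (HS (centralizer G x) (free_module k1 {x}) trivial_act (Suc n))
       (HHS_proj k1 G x (Suc n)) \<and>
     group_hom (HS (centralizer G x) (free_module k3 {x}) trivial_act n)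
       (HS (centralizer G x) (free_module k1 {x}) trivial_act (Suc n))
       (HS_connecting k1 k2 (centralizer G x) x \<iota> s n) \<and>
     (\<forall>c\<in>carrier (HHS k3 G n).
        HHS_proj k1 G x (Suc n) (B c)
          = HS_connecting k1 k2 (centralizer G x) x \<iota> s n (HHS_proj k3 G x n c))"
proof -
  interpret k: odd_split_coefficients k1 k2 k3 \<iota> \<pi> s
    using assms(5-13) by (simp add: odd_split_coefficients_def odd_split_coefficients_axioms_def)
  have x: "x \<in> carrier G" using assms(3,4) by (auto simp: conj_class_reps_def)
  let ?K = "centralizer G x"
  interpret G: odd_split_extension G "group_ring k1 G" "lmul k1 G" "rmul k1 G"
    "group_ring k2 G" "lmul k2 G" "rmul k2 G" "group_ring k3 G" "lmul k3 G" "rmul k3 G"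
    "coeffwise (carrier G) \<iota>" "coeffwise (carrier G) \<pi>" "coeffwise (carrier G) s"
    "coeffwise (carrier G) (inv_into (carrier k1) \<iota>)"
    by (rule k.group_ring_extension[OF assms(1,2)])
  interpret X: odd_split_extension ?K "free_module k1 {x}" trivial_act "\<lambda>_ a. a"
    "free_module k2 {x}" trivial_act "\<lambda>_ a. a" "free_module k3 {x}" trivial_act "\<lambda>_ a. a"
    "coeffwise {x} \<iota>" "coeffwise {x} \<pi>" "coeffwise {x} s" "coeffwise {x} (inv_into (carrier k1) \<iota>)"
    by (intro k.trivial_extension group_centralizer[OF assms(1) x]) simp
  interpret p1: cochain_map G "group_ring k1 G" "lmul k1 G" "rmul k1 G" ?K "free_module k1 {x}"
      trivial_act "\<lambda>_ a. a" "\<lambda>a. restrict a {x}" "proj_cochain k1 G x"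
    by (rule projection_cochain_map[OF assms(5,1,2) x])
  interpret p2: cochain_map G "group_ring k2 G" "lmul k2 G" "rmul k2 G" ?K "free_module k2 {x}"
      trivial_act "\<lambda>_ a. a" "\<lambda>a. restrict a {x}" "proj_cochain k2 G x"
    by (rule projection_cochain_map[OF assms(6,1,2) x])
  interpret p3: cochain_map G "group_ring k3 G" "lmul k3 G" "rmul k3 G" ?K "free_module k3 {x}"
      trivial_act "\<lambda>_ a. a" "\<lambda>a. restrict a {x}" "proj_cochain k3 G x"
    by (rule projection_cochain_map[OF assms(7,1,2) x])
  have conn_G: "hochschild_connecting k1 k2 G \<iota> s n \<phi> = G.connecting n \<phi>" for \<phi>
    by (simp add: hochschild_connecting_def lift_coboundary_def G.connecting_def)
  have conn_X: "group_connecting k1 k2 ?K x \<iota> s n \<psi> = X.connecting n \<psi>" for \<psi>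
    by (simp add: group_connecting_def X.connecting_def)
  have square: "proj_cochain k1 G x (Suc n) (G.connecting n \<phi>) = X.connecting n (proj_cochain k3 G x n \<phi>)"
    if \<phi>: "\<phi> \<in> HHS_cocycles k3 G n" for \<phi>
  proof (rule X.I_inject)
    have \<phi>c: "\<phi> \<in> carrier (G.A3.C n)" using \<phi> by (simp add: sym_cocycles_def sym_cochains_def)
    have cc: "G.connecting n \<phi> \<in> carrier (G.A1.C (Suc n))"
      using G.connecting_cocycle(3)[OF \<phi>] by (simp add: sym_cocycles_def sym_cochains_def)
    note p\<phi> = p3.f_cocycle[OF \<phi>]
    show "proj_cochain k1 G x (Suc n) (G.connecting n \<phi>) \<in> carrier (X.A1.C (Suc n))"
      by (rule p1.f_closed[OF cc])
    show "X.connecting n (proj_cochain k3 G x n \<phi>) \<in> carrier (X.A1.C (Suc n))"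
      using X.connecting_cocycle(3)[OF p\<phi>] by (simp add: sym_cocycles_def sym_cochains_def)
    \<comment> \<open>The left inverse of \<open>\<iota>\<close> is of no use outside the image of \<open>\<iota>\<close>, so the two cochains are
      compared after \<open>\<iota>\<close>.\<close>
    have "X.I (Suc n) (proj_cochain k1 G x (Suc n) (G.connecting n \<phi>))
        = proj_cochain k2 G x (Suc n) (G.I (Suc n) (G.connecting n \<phi>))"
      by (rule projection_coeffwise[OF assms(5,6,1,2) x k.\<iota>_closed cc, symmetric])
    also have "\<dots> = proj_cochain k2 G x (Suc n) (G.A2.\<delta> n (G.S n \<phi>))"
      by (simp only: G.connecting_cocycle(2)[OF \<phi>])
    also have "\<dots> = X.A2.\<delta> n (proj_cochain k2 G x n (G.S n \<phi>))"
      by (rule p2.f_coboundary[OF G.S.f_closed[OF \<phi>c]])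
    also have "proj_cochain k2 G x n (G.S n \<phi>) = X.S n (proj_cochain k3 G x n \<phi>)"
      by (rule projection_coeffwise[OF assms(7,6,1,2) x k.s_closed \<phi>c])
    also have "X.A2.\<delta> n (X.S n (proj_cochain k3 G x n \<phi>))
        = X.I (Suc n) (X.connecting n (proj_cochain k3 G x n \<phi>))"
      by (rule X.connecting_cocycle(2)[OF p\<phi>, symmetric])
    finally show "X.I (Suc n) (proj_cochain k1 G x (Suc n) (G.connecting n \<phi>))
        = X.I (Suc n) (X.connecting n (proj_cochain k3 G x n \<phi>))" .
  qed
  define B where "B = (\<lambda>c. \<Union>\<psi>\<in>c. HHS_class k1 G (Suc n) (G.connecting n \<psi>))"
  have B: "B (HHS_class k3 G n \<phi>) = HHS_class k1 G (Suc n) (G.connecting n \<phi>)"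
    if "\<phi> \<in> HHS_cocycles k3 G n" for \<phi>
    unfolding B_def by (rule G.connecting_class[OF that])
  have kernel: "lift_coboundary k2 G s n \<phi> gs
      \<in> a_kernel (group_ring k2 G) (group_ring k3 G) (coeffwise (carrier G) \<pi>)"
    if \<phi>: "\<phi> \<in> HHS_cocycles k3 G n" and gs: "gs \<in> tuples G (Suc n)" for \<phi> gs
  proof -
    have "\<phi> \<in> carrier (G.A3.C n)" using \<phi> by (simp add: sym_cocycles_def sym_cochains_def)
    then have "G.A2.\<delta> n (G.S n \<phi>) gs \<in> carrier (group_ring k2 G)"
      by (intro G.A2.cochain_closed[OF _ gs] G.A2.coboundary_closed G.S.f_closed)
    moreover have "coeffwise (carrier G) \<pi> (G.A2.\<delta> n (G.S n \<phi>) gs) = \<zero>\<^bsub>group_ring k3 G\<^esub>"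
      using fun_cong[OF G.connecting_cocycle(1)[OF \<phi>], of gs] gs
      by (simp add: compose_eq G.A3.one_cochains)
    ultimately show ?thesis by (simp add: a_kernel_def kernel_def lift_coboundary_def)
  qed
  have commutes: "HHS_proj k1 G x (Suc n) (B c)
      = HS_connecting k1 k2 ?K x \<iota> s n (HHS_proj k3 G x n c)"
    if c: "c \<in> carrier (HHS k3 G n)" for c
  proof -
    obtain \<phi> where \<phi>: "\<phi> \<in> HHS_cocycles k3 G n" "c = HHS_class k3 G n \<phi>"
      using c unfolding G.A3.carrier_sym_cohomology by blast
    show ?thesis
      unfolding \<phi>(2) B[OF \<phi>(1)] HHS_proj_def HS_connecting_def conn_X
        p1.induced_class[OF G.connecting_cocycle(3)[OF \<phi>(1)]] p3.induced_class[OF \<phi>(1)]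
        X.connecting_class[OF p3.f_cocycle[OF \<phi>(1)]] square[OF \<phi>(1)] ..
  qed
  have "group_hom (HHS k3 G n) (HHS k1 G (Suc n)) B"
    unfolding B_def by (rule G.connecting_hom)
  moreover have "group_hom (HHS k3 G n) (HS ?K (free_module k3 {x}) trivial_act n) (HHS_proj k3 G x n)"
    unfolding HHS_proj_def[abs_def] by (rule p3.induced_hom)
  moreover have "group_hom (HHS k1 G (Suc n)) (HS ?K (free_module k1 {x}) trivial_act (Suc n))
      (HHS_proj k1 G x (Suc n))"
    unfolding HHS_proj_def[abs_def] by (rule p1.induced_hom)
  moreover have "group_hom (HS ?K (free_module k3 {x}) trivial_act n)
      (HS ?K (free_module k1 {x}) trivial_act (Suc n)) (HS_connecting k1 k2 ?K x \<iota> s n)"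
    unfolding HS_connecting_def[abs_def] conn_X by (rule X.connecting_hom)
  ultimately show ?thesis
    unfolding conn_G using kernel G.connecting_cocycle(3) B commutes by blast
qed

end
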